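(* Let $G$ be a group and let $M$ be a $\mathbb{Z}G$-module. Then, for all $n \geq 1$, there is an isomorphism of abelian groups $$H_{2n}(G,M) \stackrel{\sim}{\longrightarrow} \varprojlim_{(F,\pi) \in \mathfrak{P}} H_{0}(G, M \otimes R_{ab}^{\otimes n}),$$ where the limit is taken over the category $\mathfrak{P}$ of free presentations of $G$ and, for an object $(F,\pi)$ of $\mathfrak{P}$, $R = \ker \pi$ and $R_{ab}$ is the associated relation module. In particular, there is an isomorphism $$H_{2n}(G,\mathbb{Z}) \stackrel{\sim}{\longrightarrow} \varprojlim_{(F,\pi) \in \mathfrak{P}} H_{0}(G, R_{ab}^{\otimes n})$$ for all $n \geq 1$.
   Context: Presentation category. For a group $G$, the objects of $\mathfrak{P}=\mathfrak{P}(G)$ are pairs $(F,\pi)$ where $F$ is a free group and $\pi : F \to G$ is a surjective group homomorphism; a morphism $(F,\pi) \to (F',\pi')$ is a group homomorphism $\varphi : F \to F'$ with $\pi' \circ \varphi = \pi$. (The free groups are taken in a fixed universe containing $G$, so that limits over $\mathfrak{P}$ make sense.) Relation module. For $(F,\pi)$ in $\mathfrak{P}$ put $R = \ker \pi$ and $R_{ab} = R/[R,R]$. Conjugation of $F$ on $R$ induces an action of $G \cong F/R$ on $R_{ab}$, which makes $R_{ab}$ a $\mathbb{Z}G$-module, called the relation module. A morphism $\varphi : (F,\pi) \to (F',\pi')$ restricts to $R \to R' = \ker \pi'$ and induces a $\mathbb{Z}G$-linear map $R_{ab} \to R'_{ab}$. Tensor products $\otimes$ are over $\mathbb{Z}$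 with diagonal $G$-action; $R_{ab}^{\otimes n}$ is the $n$-th tensor power over $\mathbb{Z}$; $H_0(G,-)$ denotes coinvariants. Thus $(F,\pi) \mapsto H_0(G, M \otimes R_{ab}^{\otimes n})$ is a functor from $\mathfrak{P}$ to abelian groups. Limit. For a functor $\mathfrak{F} : C \to Ab$ to abelian groups, $\varprojlim \mathfrak{F}$ is the subgroup of $\prod_{c \in C} \mathfrak{F}(c)$ consisting of the families $(x_c)_c$ with $\mathfrak{F}(a)(x_c) = x_{c'}$ for every morphism $a : c \to c'$ of $C$. *)

theory Defs
  imports "HOL-Algebra.Free_Abelian_Groups" "HOL-Algebra.Generated_Groups"
begin

section \<open>Modules over the integral group ring\<close>

text \<open>A module over \<open>\<int>G\<close> is an abelian group together with an action of \<open>G\<close> by group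
  automorphisms. Abelian groups are written multiplicatively, as usual in \<open>HOL-Algebra\<close>.\<close>

record ('g, 'm) gmodule = "'m monoid" +
  gact :: "'g \<Rightarrow> 'm \<Rightarrow> 'm"

locale G_module = group G + M: comm_group M
  for G :: "('g, 'b) monoid_scheme" (structure) and M :: "('g, 'm) gmodule" +
  assumes gact_hom: "g \<in> carrier G \<Longrightarrow> gact M g \<in> hom M M"
    and gact_one: "x \<in> carrier M \<Longrightarrow> gact M \<one> x = x"
    and gact_mult: "g \<in> carrier G \<Longrightarrow> h \<in> carrier G \<Longrightarrow> x \<in> carrier M \<Longrightarrow>
      gact M (g \<otimes> h) x = gact M g (gact M h x)"

definition with_action :: "('m, 'z) monoid_scheme \<Rightarrow> ('g \<Rightarrow> 'm \<Rightarrow> 'm) \<Rightarrow> ('g, 'm) gmodule" where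
  "with_action A act =
    \<lparr>carrier = carrier A, monoid.mult = (\<lambda>x y. x \<otimes>\<^bsub>A\<^esub> y), one = \<one>\<^bsub>A\<^esub>, gact = act\<rparr>"

definition trivial_module :: "('m, 'z) monoid_scheme \<Rightarrow> ('g, 'm) gmodule" where
  "trivial_module A = with_action A (\<lambda>_ x. x)"

text \<open>The map \<open>A / N' \<rightarrow> B / N\<close> induced by a homomorphism \<open>f : A \<rightarrow> B\<close> with \<open>f N' \<subseteq> N\<close>. All
  elements of a coset \<open>X\<close> of \<open>N'\<close> then have their images in the same coset of \<open>N\<close>.\<close>

definition induced_map :: "('b, 'z) monoid_scheme \<Rightarrow> 'b set \<Rightarrow> ('a \<Rightarrow> 'b) \<Rightarrow> 'a set \<Rightarrow> 'b set" where
  "induced_map B N f X = the_elem ((\<lambda>x. N #>\<^bsub>B\<^esub> f x) ` X)"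


section \<open>Tensor products over the integers\<close>

definition tensor_relations ::
  "('m, 'y) monoid_scheme \<Rightarrow> ('k, 'z) monoid_scheme \<Rightarrow> ('m \<times> 'k \<Rightarrow>\<^sub>0 int) set" where
  "tensor_relations A B = generate (free_Abelian_group (carrier A \<times> carrier B))
    ({frag_of (a \<otimes>\<^bsub>A\<^esub> a', b) - frag_of (a, b) - frag_of (a', b) | a a' b.
        a \<in> carrier A \<and> a' \<in> carrier A \<and> b \<in> carrier B} \<union>
     {frag_of (a, b \<otimes>\<^bsub>B\<^esub> b') - frag_of (a, b) - frag_of (a, b') | a b b'.
        a \<in> carrier A \<and> b \<in> carrier B \<and> b' \<in> carrier B})"

definition tensor_group ::
  "('m, 'y) monoid_scheme \<Rightarrow> ('k, 'z) monoid_scheme \<Rightarrow> ('m \<times> 'k \<Rightarrow>\<^sub>0 int) set monoid" where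
  "tensor_group A B = free_Abelian_group (carrier A \<times> carrier B) Mod tensor_relations A B"

text \<open>\<open>tensor_map A' B' f h\<close> is the map \<open>f \<otimes> h : A \<otimes> B \<rightarrow> A' \<otimes> B'\<close>.\<close>

definition tensor_map ::
  "('p, 'y) monoid_scheme \<Rightarrow> ('q, 'z) monoid_scheme \<Rightarrow> ('m \<Rightarrow> 'p) \<Rightarrow> ('k \<Rightarrow> 'q) \<Rightarrow>
    ('m \<times> 'k \<Rightarrow>\<^sub>0 int) set \<Rightarrow> ('p \<times> 'q \<Rightarrow>\<^sub>0 int) set" where
  "tensor_map A' B' f h =
    induced_map (free_Abelian_group (carrier A' \<times> carrier B')) (tensor_relations A' B')
      (frag_extend (\<lambda>(a, b). frag_of (f a, h b)))"

definition tensor ::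
  "('g, 'm) gmodule \<Rightarrow> ('g, 'k) gmodule \<Rightarrow> ('g, ('m \<times> 'k \<Rightarrow>\<^sub>0 int) set) gmodule" where
  "tensor A B =
    with_action (tensor_group A B) (\<lambda>g. tensor_map A B (gact A g) (gact B g))"

text \<open>Iterating the binary tensor product would change the type with \<open>n\<close>. The \<open>n\<close>-th tensor
  power is therefore the quotient of the free abelian group on \<open>n\<close>-tuples, i.e. lists of length
  \<open>n\<close>, by the relations of additivity in each variable. For \<open>n = 0\<close> this is \<open>\<int>\<close>.\<close>

definition tuples :: "nat \<Rightarrow> 'm set \<Rightarrow> 'm list set" where
  "tuples n S = {xs. set xs \<subseteq> S \<and> length xs = n}"

definition power_relations ::
  "nat \<Rightarrow> ('m, 'z) monoid_scheme \<Rightarrow> ('m list \<Rightarrow>\<^sub>0 int) set" where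
  "power_relations n A = generate (free_Abelian_group (tuples n (carrier A)))
    {frag_of (xs @ (a \<otimes>\<^bsub>A\<^esub> b) # ys) - frag_of (xs @ a # ys) - frag_of (xs @ b # ys) | xs a b ys.
        a \<in> carrier A \<and> b \<in> carrier A \<and> set xs \<subseteq> carrier A \<and> set ys \<subseteq> carrier A \<and>
        length xs + 1 + length ys = n}"

definition power_group ::
  "nat \<Rightarrow> ('m, 'z) monoid_scheme \<Rightarrow> ('m list \<Rightarrow>\<^sub>0 int) set monoid" where
  "power_group n A = free_Abelian_group (tuples n (carrier A)) Mod power_relations n A"

definition power_map ::
  "nat \<Rightarrow> ('p, 'z) monoid_scheme \<Rightarrow> ('m \<Rightarrow> 'p) \<Rightarrow> ('m list \<Rightarrow>\<^sub>0 int) set \<Rightarrow> ('p list \<Rightarrow>\<^sub>0 int) set" where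
  "power_map n A' f =
    induced_map (free_Abelian_group (tuples n (carrier A'))) (power_relations n A')
      (frag_extend (\<lambda>xs. frag_of (map f xs)))"

definition tensor_power ::
  "nat \<Rightarrow> ('g, 'm) gmodule \<Rightarrow> ('g, ('m list \<Rightarrow>\<^sub>0 int) set) gmodule" where
  "tensor_power n A = with_action (power_group n A) (\<lambda>g. power_map n A (gact A g))"


section \<open>Coinvariants and group homology\<close>

definition coinv_relations :: "('g, 'b) monoid_scheme \<Rightarrow> ('g, 'm) gmodule \<Rightarrow> 'm set" where
  "coinv_relations G A =
    generate A {gact A g x \<otimes>\<^bsub>A\<^esub> inv\<^bsub>A\<^esub> x | g x. g \<in> carrier G \<and> x \<in> carrier A}"

definition coinvariants :: "('g, 'b) monoid_scheme \<Rightarrow> ('g, 'm) gmodule \<Rightarrow> 'm set monoid" where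
  "coinvariants G A = A Mod coinv_relations G A"

definition coinv_map ::
  "('g, 'b) monoid_scheme \<Rightarrow> ('g, 'k) gmodule \<Rightarrow> ('m \<Rightarrow> 'k) \<Rightarrow> 'm set \<Rightarrow> 'k set" where
  "coinv_map G B f = induced_map B (coinv_relations G B) f"

text \<open>The standard free resolution of the trivial module \<open>\<int>\<close>: in degree \<open>k\<close> the free abelian group
  on \<open>(k + 1)\<close>-tuples of elements of \<open>G\<close>, on which \<open>G\<close> acts by left multiplication of all
  components, with boundary \<open>\<Sum>i\<le>k. (-1)^i (g\<^sub>0, \<dots>, g\<^sub>i omitted, \<dots>, g\<^sub>k)\<close> for \<open>k \<ge> 1\<close>.\<close>

definition std_resolution ::
  "('g, 'b) monoid_scheme \<Rightarrow> nat \<Rightarrow> ('g, 'g list \<Rightarrow>\<^sub>0 int) gmodule" where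
  "std_resolution G k = with_action (free_Abelian_group (tuples (Suc k) (carrier G)))
    (\<lambda>g. frag_extend (\<lambda>xs. frag_of (map (\<lambda>x. g \<otimes>\<^bsub>G\<^esub> x) xs)))"

definition std_boundary :: "nat \<Rightarrow> ('g list \<Rightarrow>\<^sub>0 int) \<Rightarrow> ('g list \<Rightarrow>\<^sub>0 int)" where
  "std_boundary k =
    frag_extend (\<lambda>xs. \<Sum>i\<le>k. frag_cmul ((- 1) ^ i) (frag_of (take i xs @ drop (Suc i) xs)))"

text \<open>\<open>H\<^sub>k(G, M)\<close> is the homology of the complex \<open>M \<otimes>\<^sub>G P\<close>, where \<open>P\<close> is the standard resolution and
  \<open>M \<otimes>\<^sub>G P\<close> denotes the coinvariants of \<open>M \<otimes> P\<close> under the diagonal action, i.e. the tensor product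
  over \<open>\<int>G\<close> of \<open>P\<close> with \<open>M\<close>, viewed as a right module by \<open>x g = g\<^sup>-\<^sup>1 x\<close>.\<close>

definition homology_chains ::
  "('g, 'b) monoid_scheme \<Rightarrow> ('g, 'm) gmodule \<Rightarrow> nat \<Rightarrow>
    ('m \<times> ('g list \<Rightarrow>\<^sub>0 int) \<Rightarrow>\<^sub>0 int) set set monoid" where
  "homology_chains G M k = coinvariants G (tensor M (std_resolution G k))"

text \<open>The boundary map from degree \<open>Suc k\<close> to degree \<open>k\<close>.\<close>

definition homology_boundary ::
  "('g, 'b) monoid_scheme \<Rightarrow> ('g, 'm) gmodule \<Rightarrow> nat \<Rightarrow>
    ('m \<times> ('g list \<Rightarrow>\<^sub>0 int) \<Rightarrow>\<^sub>0 int) set set \<Rightarrow>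
    ('m \<times> ('g list \<Rightarrow>\<^sub>0 int) \<Rightarrow>\<^sub>0 int) set set" where
  "homology_boundary G M k = coinv_map G (tensor M (std_resolution G k))
    (tensor_map M (std_resolution G k) (\<lambda>x. x) (std_boundary (Suc k)))"

definition homology_cycles ::
  "('g, 'b) monoid_scheme \<Rightarrow> ('g, 'm) gmodule \<Rightarrow> nat \<Rightarrow>
    ('m \<times> ('g list \<Rightarrow>\<^sub>0 int) \<Rightarrow>\<^sub>0 int) set set set" where
  "homology_cycles G M k = (case k of
      0 \<Rightarrow> carrier (homology_chains G M 0)
    | Suc j \<Rightarrow> kernel (homology_chains G M (Suc j)) (homology_chains G M j)
                 (homology_boundary G M j))"

definition group_homology ::
  "('g, 'b) monoid_scheme \<Rightarrow> ('g, 'm) gmodule \<Rightarrow> nat \<Rightarrow>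
    ('m \<times> ('g list \<Rightarrow>\<^sub>0 int) \<Rightarrow>\<^sub>0 int) set set set monoid" where
  "group_homology G M k = (homology_chains G M k)\<lparr>carrier := homology_cycles G M k\<rparr> Mod
    (homology_boundary G M k ` carrier (homology_chains G M (Suc k)))"


section \<open>Free groups and presentations\<close>

text \<open>Words in \<open>X\<close> and formal inverses: \<open>(x, True)\<close> stands for \<open>x\<close> and \<open>(x, False)\<close> for its inverse.
  A word is reduced if no letter is adjacent to its formal inverse.\<close>

definition reduced_words :: "'u set \<Rightarrow> ('u \<times> bool) list set" where
  "reduced_words X =
    {w. fst ` set w \<subseteq> X \<and> successively (\<lambda>(x, b) (y, c). x = y \<longrightarrow> b = c) w}"

definition word_value :: "('u, 'z) monoid_scheme \<Rightarrow> ('u \<times> bool) list \<Rightarrow> 'u" where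
  "word_value F w =
    foldr (\<lambda>(x, b) y. (if b then x else inv\<^bsub>F\<^esub> x) \<otimes>\<^bsub>F\<^esub> y) w \<one>\<^bsub>F\<^esub>"

text \<open>A group is free on \<open>X\<close> if each of its elements is the value of exactly one reduced word
  in \<open>X\<close>, i.e. if evaluation identifies it with the group of reduced words in \<open>X\<close>.\<close>

definition free_basis :: "('u, 'z) monoid_scheme \<Rightarrow> 'u set \<Rightarrow> bool" where
  "free_basis F X \<longleftrightarrow>
    X \<subseteq> carrier F \<and> bij_betw (word_value F) (reduced_words X) (carrier F)"

definition free_group :: "('u, 'z) monoid_scheme \<Rightarrow> bool" where
  "free_group F \<longleftrightarrow> group F \<and> (\<exists>X. free_basis F X)"

text \<open>The category of free presentations of \<open>G\<close>. The type \<open>'u\<close> plays the role of the universe from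
  which the carriers of the free groups are taken. Values of multiplications and homomorphisms
  outside the carriers are not normalised. This only adds isomorphic copies of objects, and it does
  not affect the maps induced by morphisms on the elements of the relation modules.\<close>

type_synonym ('u, 'g) presentation = "'u monoid \<times> ('u \<Rightarrow> 'g)"

definition presentations :: "('g, 'b) monoid_scheme \<Rightarrow> ('u, 'g) presentation set" where
  "presentations G =
    {(F, \<pi>). free_group F \<and> \<pi> \<in> hom F G \<and> \<pi> ` carrier F = carrier G}"

definition presentation_homs ::
  "('u, 'g) presentation \<Rightarrow> ('u, 'g) presentation \<Rightarrow> ('u \<Rightarrow> 'u) set" where
  "presentation_homs = (\<lambda>(F, \<pi>) (F', \<pi>').
    {\<phi> \<in> hom F F'. \<forall>x\<in>carrier F. \<pi>' (\<phi> x) = \<pi> x})"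


section \<open>Relation modules\<close>

definition relation_group ::
  "('g, 'b) monoid_scheme \<Rightarrow> ('u, 'g) presentation \<Rightarrow> 'u set monoid" where
  "relation_group G = (\<lambda>(F, \<pi>).
    F\<lparr>carrier := kernel F G \<pi>\<rparr> Mod derived F (kernel F G \<pi>))"

text \<open>An element \<open>g\<close> of \<open>G\<close> acts on a coset \<open>r [R, R]\<close> by conjugation with any preimage \<open>f\<close> of \<open>g\<close>.
  The result does not depend on \<open>f\<close>, so the set below has exactly one element.\<close>

definition relation_module ::
  "('g, 'b) monoid_scheme \<Rightarrow> ('u, 'g) presentation \<Rightarrow> ('g, 'u set) gmodule" where
  "relation_module G = (\<lambda>(F, \<pi>). with_action (relation_group G (F, \<pi>))
    (\<lambda>g X. the_elem {f <#\<^bsub>F\<^esub> X #>\<^bsub>F\<^esub> inv\<^bsub>F\<^esub> f | f. f \<in> carrier F \<and> \<pi> f = g}))"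

text \<open>The map \<open>R\<^sub>a\<^sub>b \<rightarrow> R'\<^sub>a\<^sub>b\<close> induced by a morphism into the presentation \<open>(F', \<pi>')\<close>.\<close>

definition relation_map ::
  "('g, 'b) monoid_scheme \<Rightarrow> ('u, 'g) presentation \<Rightarrow> ('u \<Rightarrow> 'u) \<Rightarrow> 'u set \<Rightarrow> 'u set" where
  "relation_map G = (\<lambda>(F', \<pi>') \<phi>.
    induced_map (F'\<lparr>carrier := kernel F' G \<pi>'\<rparr>) (derived F' (kernel F' G \<pi>')) \<phi>)"


section \<open>Limits of abelian groups\<close>

text \<open>The limit over a category with objects \<open>Obj\<close> and morphism sets \<open>Hom c c'\<close> of the functor with
  values \<open>A c\<close> on objects and \<open>A_map c c' a : A c \<rightarrow> A c'\<close> on morphisms.\<close>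

definition limit_group ::
  "'o set \<Rightarrow> ('o \<Rightarrow> 'o \<Rightarrow> 'f set) \<Rightarrow> ('o \<Rightarrow> ('x, 'z) monoid_scheme) \<Rightarrow>
    ('o \<Rightarrow> 'o \<Rightarrow> 'f \<Rightarrow> 'x \<Rightarrow> 'x) \<Rightarrow> ('o \<Rightarrow> 'x) monoid" where
  "limit_group Obj Hom A A_map = (product_group Obj A)\<lparr>carrier :=
    {x \<in> carrier (product_group Obj A).
       \<forall>c\<in>Obj. \<forall>c'\<in>Obj. \<forall>a\<in>Hom c c'. A_map c c' a (x c) = x c'}\<rparr>"

end

theory Submission
  imports Defs
begin

text \<open>
  Write \<open>C\<close> for the standard resolution. The concatenation of tuples makes the augmented complex a
  monoid under joins, and a join with a cycle \<open>z\<close> satisfies \<open>\<partial>(c * z) = \<partial>c * z\<close>. Every set-theoretic section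
  of a free presentation gives a 2-cocycle \<open>f : C\<^sub>2 \<rightarrow> R\<^sub>a\<^sub>b\<close>, and its cup power
  \<open>(g\<^sub>0, \<dots>, g\<^sub>2\<^sub>n) \<mapsto> f(g\<^sub>0, g\<^sub>1, g\<^sub>2) \<otimes> f(g\<^sub>2, g\<^sub>3, g\<^sub>4) \<otimes> \<dots>\<close> induces
  \<open>\<Theta> : H\<^sub>2\<^sub>n(G, M) \<rightarrow> H\<^sub>0(G, M \<otimes> R\<^sub>a\<^sub>b\<^sup>n)\<close>. Two sections give cohomologous cocycles, hence the same \<open>\<Theta>\<close>, so the
  maps \<open>\<Theta>\<close> are compatible with all morphisms of presentations and define a map into the limit.

  For the presentation \<open>c\<close> whose free group has one generator for each element of \<open>G\<close>, Fox
  calculus identifies \<open>R\<^sub>a\<^sub>b\<close> with the cycles in \<open>C\<^sub>1\<close>, and joining these cycles gives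
  \<open>J : R\<^sub>a\<^sub>b\<^sup>n \<rightarrow> C\<^sub>2\<^sub>n\<^sub>-\<^sub>1\<close>. The map \<open>\<rho> \<mapsto> (1) * J \<rho>\<close> into \<open>C\<^sub>2\<^sub>n\<close> is equivariant up to boundaries and inverts \<open>\<Theta>\<close> on
  the kernel of \<open>J\<close>: the composite on chains is a part of an augmented equivariant endomorphism of
  \<open>C\<close>, which is homotopic to the identity. An element of the limit has equal images under the two
  inclusions of \<open>c\<close> into the presentation \<open>c'\<close> with two generators for each element of \<open>G\<close>.
  The Fox derivative that only sees the first copy turns these two images into \<open>J x\<close> and \<open>0\<close>, so \<open>J x = 0\<close>.
\<close>

section \<open>Joins in the augmented standard complex\<close>

text \<open>The presentation \<open>c\<close> maps to every presentation. An element of the limit is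
  therefore determined by its component at \<open>c\<close>, and any two morphisms out of
  \<open>c\<close> with the same target agree on that component. It suffices that \<Theta> at
  \<open>c\<close> is injective on homology and reaches every element with this property;
  compatibility with morphisms supplies the other components.

  The kernel of \<open>J\<close> enters because the cone over the cycle \<open>J \<rho>\<close> has
  boundary \<open>J \<rho>\<close>, so an element killed by \<open>J\<close> is lifted to a cycle.
  Coning at 1 does not commute with \<open>G\<close>, but two cones over one cycle differ by a
  boundary.

  One generator per group element gives a section whose cocycle has the boundary of the triangle abc
  as Fox derivative, without correction terms. This turns \<open>J\<close> after \<Theta> into a
  formula inside \<open>C\<close>, independent of the presentation. The empty simplex in degree -1
  lets the homotopy to the identity be built by coning alone, with no base case to guess.

  The universe has to be infinite so that words over it, and two labelled copies of
  \<open>G\<close>, can be encoded in it.\<close>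

definition prepend :: "'g \<Rightarrow> ('g list \<Rightarrow>\<^sub>0 int) \<Rightarrow> ('g list \<Rightarrow>\<^sub>0 int)" where
  "prepend x = frag_extend (\<lambda>xs. frag_of (x # xs))"

definition join :: "('g list \<Rightarrow>\<^sub>0 int) \<Rightarrow> ('g list \<Rightarrow>\<^sub>0 int) \<Rightarrow> ('g list \<Rightarrow>\<^sub>0 int)" where
  "join a b = frag_extend (\<lambda>xs. frag_extend (\<lambda>ys. frag_of (xs @ ys)) b) a"

text \<open>A list of length \<open>k + 1\<close> is a simplex of dimension \<open>k\<close>. The empty list spans the augmentation, in
  degree \<open>-1\<close>.\<close>

fun boundary_list :: "'g list \<Rightarrow> ('g list \<Rightarrow>\<^sub>0 int)" where
  "boundary_list [] = 0"
| "boundary_list (x # xs) = frag_of xs - prepend x (boundary_list xs)"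

abbreviation boundary :: "('g list \<Rightarrow>\<^sub>0 int) \<Rightarrow> ('g list \<Rightarrow>\<^sub>0 int)" where
  "boundary \<equiv> frag_extend boundary_list"

lemmas frag_linear = frag_extend_add frag_extend_diff frag_extend_minus

lemma frag_UNIV_induct [case_names zero one diff]:
  assumes "P 0" "\<And>x. P (frag_of x)" "\<And>a b. P a \<Longrightarrow> P b \<Longrightarrow> P (a - b)"
  shows "P c"
  using frag_induction [of c UNIV P] assms by auto

lemma frag_extend_frag_extend:
  "frag_extend f (frag_extend g c) = frag_extend (\<lambda>x. frag_extend f (g x)) c"
  by (induction c rule: frag_UNIV_induct) (auto simp: frag_linear)

lemma frag_extend_id [simp]: "frag_extend frag_of c = c"
  by (metis frag_expansion)

lemma frag_extend_fun_diff:
  "frag_extend (\<lambda>x. f x - g x) c = frag_extend f c - frag_extend g c"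
  by (induction c rule: frag_UNIV_induct) (auto simp: frag_linear)

lemma frag_extend_fun_add:
  "frag_extend (\<lambda>x. f x + g x) c = frag_extend f c + frag_extend g c"
  by (induction c rule: frag_UNIV_induct) (auto simp: frag_linear)

lemma frag_extend_fun_zero [simp]: "frag_extend (\<lambda>x. 0) c = 0"
  by (simp add: frag_extend_eq_0)

lemma prepend_of [simp]: "prepend x (frag_of xs) = frag_of (x # xs)"
  by (simp add: prepend_def)

lemma prepend_0 [simp]: "prepend x 0 = 0"
  by (simp add: prepend_def)

lemma prepend_linear:
  "prepend x (a + b) = prepend x a + prepend x b" "prepend x (a - b) = prepend x a - prepend x b" "prepend x (- a) = - prepend x a"
  by (simp_all add: prepend_def frag_linear)

lemma frag_extend_prepend: "frag_extend f (prepend x z) = frag_extend (\<lambda>xs. f (x # xs)) z"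
  by (simp add: prepend_def frag_extend_frag_extend)

text \<open>Prepending \<open>x\<close> is the cone with apex \<open>x\<close>, and coning is a
  contracting homotopy. With the empty simplex the formula also covers single vertices, without a
  separate case for the augmentation.\<close>

lemma boundary_prepend: "boundary (prepend x z) = z - prepend x (boundary z)"
  by (induction z rule: frag_UNIV_induct) (auto simp: frag_linear prepend_linear)

lemma boundary_boundary [simp]: "boundary (boundary z) = 0"
proof -
  have "boundary (boundary_list xs) = 0" for xs :: "'a list"
    by (induction xs) (auto simp: frag_linear boundary_prepend)
  then show ?thesis by (simp add: frag_extend_frag_extend)
qed

lemma join_linear_left:
  "join 0 b = 0" "join (a + a') b = join a b + join a' b" "join (a - a') b = join a b - join a' b"
  by (simp_all add: join_def frag_linear)

lemma join_linear_right:
  "join a 0 = 0" "join a (b + b') = join a b + join a b'" "join a (b - b') = join a b - join a b'"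
  by (simp_all add: join_def frag_linear frag_extend_fun_add frag_extend_fun_diff)

lemma join_Nil [simp]: "join (frag_of []) b = b" "join a (frag_of []) = a"
  by (simp_all add: join_def)

lemma join_Cons: "join (frag_of (x # xs)) b = prepend x (join (frag_of xs) b)"
  by (simp add: join_def prepend_def frag_extend_frag_extend)

lemma join_prepend: "join (prepend x a) b = prepend x (join a b)"
  by (induction a rule: frag_UNIV_induct) (auto simp: join_linear_left prepend_linear join_Cons)

text \<open>The second term of the Leibniz rule for joins carries a sign that depends on the degree
  of \<open>a\<close>. It vanishes when \<open>b\<close> is a cycle, so degrees need not be
  tracked.\<close>

lemma boundary_join:
  assumes "boundary b = 0"
  shows "boundary (join a b) = join (boundary a) b"
proof -
  have "boundary (join (frag_of xs) b) = join (boundary_list xs) b" for xs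
    by (induction xs) (auto simp: assms join_Cons boundary_prepend join_linear_left join_prepend)
  then show ?thesis
    by (induction a rule: frag_UNIV_induct) (auto simp: join_linear_left frag_linear)
qed

lemma keys_frag_extend_subset:
  assumes "Poly_Mapping.keys z \<subseteq> S" "\<And>x. x \<in> S \<Longrightarrow> Poly_Mapping.keys (f x) \<subseteq> T"
  shows "Poly_Mapping.keys (frag_extend f z) \<subseteq> T"
  using assms by (intro order_trans [OF keys_frag_extend]) blast

lemma keys_prepend:
  assumes "x \<in> S" "Poly_Mapping.keys z \<subseteq> tuples k S"
  shows "Poly_Mapping.keys (prepend x z) \<subseteq> tuples (Suc k) S"
  unfolding prepend_def using assms by (intro keys_frag_extend_subset [of _ "tuples k S"]) (auto simp: tuples_def)

lemma keys_boundary_list: "set xs \<subseteq> S \<Longrightarrow> Poly_Mapping.keys (boundary_list xs) \<subseteq> tuples (length xs - 1) S"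
proof (induction xs)
  case (Cons x xs)
  have "Poly_Mapping.keys (prepend x (boundary_list xs)) \<subseteq> tuples (length xs) S"
  proof (cases xs)
    case (Cons y ys)
    then show ?thesis
      using Cons.IH Cons.prems keys_prepend [of x S "boundary_list xs" "length ys"] by simp
  qed simp
  then show ?case
    using Cons.prems keys_diff [of "frag_of xs" "prepend x (boundary_list xs)"] by (auto simp: tuples_def)
qed simp

lemma keys_boundary:
  "Poly_Mapping.keys z \<subseteq> tuples (Suc k) S \<Longrightarrow> Poly_Mapping.keys (boundary z) \<subseteq> tuples k S"
  using keys_boundary_list [where S=S] by (intro keys_frag_extend_subset) (fastforce simp: tuples_def)+

lemma keys_join:
  assumes "Poly_Mapping.keys a \<subseteq> tuples k S" "Poly_Mapping.keys b \<subseteq> tuples l S"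
  shows "Poly_Mapping.keys (join a b) \<subseteq> tuples (k + l) S"
  unfolding join_def
  by (intro keys_frag_extend_subset [OF assms(1)] keys_frag_extend_subset [OF assms(2)])
    (auto simp: tuples_def)

text \<open>The recursive boundary carries no degree, which suits cones and joins; this links it to
  the given complex.\<close>

lemma std_boundary_eq_boundary:
  assumes "Poly_Mapping.keys z \<subseteq> tuples (Suc k) S"
  shows "std_boundary k z = boundary z"
proof -
  have *: "(\<Sum>i\<le>k. frag_cmul ((- 1) ^ i) (frag_of (take i xs @ drop (Suc i) xs))) = boundary_list xs"
    if "length xs = Suc k" for xs :: "'a list"
    using that
  proof (induction k arbitrary: xs)
    case 0
    then show ?case by (cases xs) auto
  next
    case (Suc k)
    then obtain y ys where xs: "xs = y # ys" "length ys = Suc k" by (cases xs) auto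
    \<comment> \<open>The summand for i = 0 omits the first vertex. All others keep it, and shifting
      the index reverses their signs, which is the minus sign of the recursion.\<close>
    have "(\<Sum>i\<le>Suc k. frag_cmul ((- 1) ^ i) (frag_of (take i xs @ drop (Suc i) xs)))
       = frag_of ys + (\<Sum>i\<le>k. frag_cmul ((- 1) ^ Suc i) (frag_of (y # take i ys @ drop (Suc i) ys)))"
      by (subst sum.atMost_Suc_shift) (simp add: xs)
    also have "(\<Sum>i\<le>k. frag_cmul ((- 1) ^ Suc i) (frag_of (y # take i ys @ drop (Suc i) ys)))
      = - prepend y (\<Sum>i\<le>k. frag_cmul ((- 1) ^ i) (frag_of (take i ys @ drop (Suc i) ys)))"
      by (simp add: prepend_def frag_extend_sum frag_extend_cmul o_def sum_negf [symmetric])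
    finally show ?case using Suc.IH [OF xs(2)] xs by simp
  qed
  show ?thesis
    unfolding std_boundary_def using assms by (intro frag_extend_eq *) (auto simp: tuples_def)
qed

text \<open>Used in two roles: on simplices it is the chain map of a map of vertices, such as
  translation by \<open>g\<close>; on tuples of module elements it represents the tensor power of a
  homomorphism.\<close>

definition map_chain :: "('a \<Rightarrow> 'b) \<Rightarrow> ('a list \<Rightarrow>\<^sub>0 int) \<Rightarrow> ('b list \<Rightarrow>\<^sub>0 int)" where
  "map_chain u = frag_extend (\<lambda>xs. frag_of (map u xs))"

lemma map_chain_of [simp]: "map_chain u (frag_of xs) = frag_of (map u xs)"
  by (simp add: map_chain_def)

lemma map_chain_linear:
  "map_chain u 0 = 0" "map_chain u (a + b) = map_chain u a + map_chain u b" "map_chain u (a - b) = map_chain u a - map_chain u b"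
  "map_chain u (- a) = - map_chain u a"
  by (simp_all add: map_chain_def frag_linear)

lemma map_chain_prepend: "map_chain u (prepend x z) = prepend (u x) (map_chain u z)"
  by (induction z rule: frag_UNIV_induct) (auto simp: prepend_linear map_chain_linear)

lemma map_chain_boundary_list: "map_chain u (boundary_list xs) = boundary_list (map u xs)"
  by (induction xs) (auto simp: map_chain_linear map_chain_prepend)

lemma map_chain_boundary: "map_chain u (boundary z) = boundary (map_chain u z)"
  by (induction z rule: frag_UNIV_induct) (auto simp: frag_linear map_chain_linear map_chain_boundary_list)

lemma map_chain_join: "map_chain u (join a b) = join (map_chain u a) (map_chain u b)"
proof -
  have "map_chain u (join (frag_of xs) b) = join (frag_of (map u xs)) (map_chain u b)" for xs
    by (induction xs) (auto simp: join_Cons map_chain_prepend)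
  then show ?thesis
    by (induction a rule: frag_UNIV_induct) (auto simp: join_linear_left map_chain_linear)
qed

lemma map_chain_map_chain: "map_chain u (map_chain v z) = map_chain (u \<circ> v) z"
  by (induction z rule: frag_UNIV_induct) (auto simp: map_chain_linear o_def)

lemma keys_map_chain:
  assumes "Poly_Mapping.keys z \<subseteq> tuples k S" "u ` S \<subseteq> T"
  shows "Poly_Mapping.keys (map_chain u z) \<subseteq> tuples k T"
  unfolding map_chain_def using assms
  by (intro keys_frag_extend_subset) (auto simp: tuples_def)

section \<open>Cup products\<close>

text \<open>The Alexander-Whitney product: the front face feeds \<open>f\<close>, and the back face
  starts again at the shared vertex \<open>c\<close>. The value of \<open>f\<close> is handed to
  \<open>\<chi>\<close> instead of being multiplied, because the product is a join in one use and a
  tensor in the others.\<close>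

fun cup2 :: "('g \<Rightarrow> 'g \<Rightarrow> 'g \<Rightarrow> 'k) \<Rightarrow> ('k \<Rightarrow> 'g list \<Rightarrow> ('v \<Rightarrow>\<^sub>0 int)) \<Rightarrow> 'g list \<Rightarrow> ('v \<Rightarrow>\<^sub>0 int)" where
  "cup2 f \<chi> (a # b # c # r) = \<chi> (f a b c) (c # r)"
| "cup2 f \<chi> _ = 0"

fun cup1 :: "('g \<Rightarrow> 'g \<Rightarrow> 'k) \<Rightarrow> ('k \<Rightarrow> 'g list \<Rightarrow> ('v \<Rightarrow>\<^sub>0 int)) \<Rightarrow> 'g list \<Rightarrow> ('v \<Rightarrow>\<^sub>0 int)" where
  "cup1 h \<chi> (a # b # r) = \<chi> (h a b) (b # r)"
| "cup1 h \<chi> _ = 0"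

text \<open>The Leibniz rule for a cochain of degree two. The boundary of the back face also omits
  the shared vertex \<open>c\<close>, which does not arise from a face of the whole simplex; the
  last term of the bracket cancels it and completes the coboundary of \<open>f\<close>.\<close>

lemma cup2_boundary_list:
  "frag_extend (cup2 f \<chi>) (boundary_list (a # b # c # d # r)) =
    frag_extend (\<chi> (f a b c)) (boundary_list (c # d # r)) +
    (\<chi> (f b c d) (d # r) - \<chi> (f a c d) (d # r) + \<chi> (f a b d) (d # r) - \<chi> (f a b c) (d # r))"
  by (simp add: frag_linear prepend_linear frag_extend_prepend)

text \<open>The Leibniz rule in odd degree, hence the minus sign before the boundary of the back
  face.\<close>

lemma cup1_boundary_list:
  "frag_extend (cup1 h \<chi>) (boundary_list (a # b # c # r)) =
    \<chi> (h b c) (c # r) - \<chi> (h a c) (c # r) + \<chi> (h a b) (c # r)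
      - frag_extend (\<chi> (h a b)) (boundary_list (b # c # r))"
  by (simp add: frag_linear prepend_linear frag_extend_prepend)

section \<open>An endomorphism of the augmented standard complex\<close>

text \<open>The cup power of the tautological 2-cocycle that sends a triangle to its boundary, with
  the values joined: 2n + 1 vertices give chains on 2n vertices. \<open>concat_power_Theta\<close>
  recognises it as \<open>J\<close> after \<Theta>.\<close>

fun triangle_join :: "'g list \<Rightarrow> ('g list \<Rightarrow>\<^sub>0 int)" where
  "triangle_join (a # b # c # r) = join (boundary_list [a, b, c]) (triangle_join (c # r))"
| "triangle_join _ = frag_of []"

text \<open>Boundaries of triangles form a cocycle because the boundary of a tetrahedron is a cycle,
  and cup powers of cocycles are cocycles.\<close>

lemma triangle_join_boundary_list: "even (length c) \<Longrightarrow> c \<noteq> [] \<Longrightarrow> frag_extend triangle_join (boundary_list c) = 0"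
proof (induction c rule: induct_list012)
  case (3 a b r)
  show ?case
  proof (cases r)
    case Nil
    then show ?thesis by (simp add: frag_linear)
  next
    case (Cons c r')
    with 3 obtain d r'' where r: "r = c # d # r''" by (cases r') auto
    \<comment> \<open>Three vertices are needed here: on a single vertex
      \<open>triangle_join\<close> is the empty simplex, whereas \<open>cup2\<close> is 0.\<close>
    have *: "frag_extend triangle_join z = frag_extend (cup2 (\<lambda>a b c. boundary_list [a,b,c]) (\<lambda>k x. join k (triangle_join x))) z"
      if "\<forall>x\<in>Poly_Mapping.keys z. length x \<ge> 3" for z :: "'a list \<Rightarrow>\<^sub>0 int"
    proof (intro frag_extend_eq)
      fix x assume "x \<in> Poly_Mapping.keys z"
      with that obtain p q s t where "x = p # q # s # t"
        by (metis Suc_le_length_iff numeral_3_eq_3)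
      then show "triangle_join x = cup2 (\<lambda>a b c. boundary_list [a,b,c]) (\<lambda>k x. join k (triangle_join x)) x" by simp
    qed
    have len: "\<forall>x\<in>Poly_Mapping.keys (boundary_list (a # b # c # d # r'')). length x \<ge> 3"
      using keys_boundary_list [of "a # b # c # d # r''" UNIV] by (auto simp: tuples_def)
    have J: "frag_extend (\<lambda>x. join k (triangle_join x)) z = join k (frag_extend triangle_join z)" for k z
      by (induction z rule: frag_UNIV_induct) (auto simp: frag_linear join_linear_right)
    have "frag_extend triangle_join (boundary_list (c # d # r'')) = 0"
      using 3 r by auto
    then have "frag_extend triangle_join (boundary_list (a # b # c # d # r'')) =
      join (boundary_list [b,c,d]) (triangle_join (d # r'')) - join (boundary_list [a,c,d]) (triangle_join (d # r''))
      + join (boundary_list [a,b,d]) (triangle_join (d # r'')) - join (boundary_list [a,b,c]) (triangle_join (d # r''))"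
      by (simp only: * [OF len] cup2_boundary_list J join_linear_right add_0_left)
    also have "\<dots> = join (boundary_list [b,c,d] - boundary_list [a,c,d] + boundary_list [a,b,d] - boundary_list [a,b,c]) (triangle_join (d # r''))"
      by (simp only: join_linear_left)
    \<comment> \<open>The four triangles are the signed faces of a tetrahedron.\<close>
    also have "boundary_list [b,c,d] - boundary_list [a,c,d] + boundary_list [a,b,d] - boundary_list [a,b,c] = boundary (boundary_list [a,b,c,d])"
      by (simp add: frag_linear prepend_linear)
    also have "boundary (boundary_list [a,b,c,d]) = 0"
      using boundary_boundary [of "frag_of [a,b,c,d]"] by (simp only: frag_extend_of)
    finally show ?thesis by (simp only: r join_linear_left)
  qed
qed auto

text \<open>The first factor of the join is a boundary and the rest is a cycle by induction, so
  \<open>boundary_join\<close> applies.\<close>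

lemma boundary_triangle_join: "odd (length c) \<Longrightarrow> boundary (triangle_join c) = 0"
proof (induction c rule: triangle_join.induct)
  case (1 a b c r)
  then have "boundary (triangle_join (c # r)) = 0" by simp
  then show ?case by (simp only: triangle_join.simps boundary_join) (simp add: join_linear_left frag_linear prepend_linear)
qed auto

text \<open>A chain endomorphism of the augmented complex, the identity up to degree 1. In degree \<open>2 n\<close> it is
  the composite of \<open>\<Theta>\<close> with \<open>\<rho> \<mapsto> (g\<^sub>0) * J \<rho>\<close>, where \<open>g\<^sub>0\<close> is the first vertex.\<close>

fun collapse :: "'g list \<Rightarrow> ('g list \<Rightarrow>\<^sub>0 int)" where
  "collapse [] = frag_of []"
| "collapse (x # xs) = prepend x (if even (length xs) then triangle_join (x # xs) else collapse xs)"

text \<open>The second claim is carried along because the step to an even number of vertices needs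
  the boundary of \<open>collapse xs\<close> explicitly. It holds since a list of odd length is sent
  to a cone over a cycle.\<close>

lemma boundary_collapse: "frag_extend collapse (boundary_list c) = boundary (collapse c) \<and> (odd (length c) \<longrightarrow> boundary (collapse c) = triangle_join c)"
proof (induction c)
  case (Cons x xs)
  have collapse_boundary_list: "frag_extend collapse (boundary_list (x # xs)) = collapse xs - frag_extend (\<lambda>y. collapse (x # y)) (boundary_list xs)"
    by (simp add: frag_linear frag_extend_prepend)
  show ?case
  proof (cases "even (length xs)")
    case True
    have *: "frag_extend (\<lambda>y. collapse (x # y)) (boundary_list xs) = prepend x (frag_extend collapse (boundary_list xs))"
      (is "?L = _")
    proof -
      have "?L = frag_extend (\<lambda>y. prepend x (collapse y)) (boundary_list xs)"
      proof (intro frag_extend_eq)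
        fix y assume "y \<in> Poly_Mapping.keys (boundary_list xs)"
        then have "length y = length xs - 1" "xs \<noteq> []" using keys_boundary_list [of xs UNIV] by (auto simp: tuples_def)
        then show "collapse (x # y) = prepend x (collapse y)" using True by auto
      qed
      also have "\<dots> = prepend x (frag_extend collapse (boundary_list xs))"
        by (simp add: prepend_def frag_extend_frag_extend)
      finally show ?thesis .
    qed
    have bk: "boundary (collapse (x # xs)) = triangle_join (x # xs)"
      using True by (simp add: boundary_prepend boundary_triangle_join)
    \<comment> \<open>For \<open>xs = b # c # r'\<close> the left side is the chain bc - xc + xb
      joined with the cycle \<open>triangle_join (c # r')\<close>, and that chain is the boundary of
      the triangle xbc.\<close>
    have "collapse xs - prepend x (boundary (collapse xs)) = triangle_join (x # xs)"
    proof (cases xs)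
      case (Cons b r)
      then obtain c r' where r: "r = c # r'" using True by (cases r) auto
      have k: "collapse (b # c # r') = prepend b (prepend c (triangle_join (c # r')))" using True Cons r by auto
      have w: "boundary (triangle_join (c # r')) = 0" using True Cons r by (intro boundary_triangle_join) auto
      show ?thesis
        by (simp add: k boundary_prepend w Cons r prepend_linear join_linear_left join_Cons join_prepend del: collapse.simps)
    qed simp
    with * bk collapse_boundary_list Cons.IH True show ?thesis by auto
  next
    case False
    have *: "frag_extend (\<lambda>y. collapse (x # y)) (boundary_list xs) = prepend x (frag_extend triangle_join (prepend x (boundary_list xs)))"
      (is "?L = _")
    proof -
      have "?L = frag_extend (\<lambda>y. prepend x (triangle_join (x # y))) (boundary_list xs)"
      proof (intro frag_extend_eq)
        fix y assume "y \<in> Poly_Mapping.keys (boundary_list xs)"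
        then have "length y = length xs - 1" using keys_boundary_list [of xs UNIV] by (auto simp: tuples_def)
        then show "collapse (x # y) = prepend x (triangle_join (x # y))" using False by auto
      qed
      also have "\<dots> = prepend x (frag_extend triangle_join (prepend x (boundary_list xs)))"
        by (simp add: prepend_def frag_extend_frag_extend)
      finally show ?thesis .
    qed
    \<comment> \<open>The cocycle property on \<open>x # xs\<close> trades all the faces that
      contain \<open>x\<close> for the single face \<open>xs\<close>.\<close>
    have "frag_extend triangle_join (boundary_list (x # xs)) = 0" using False by (intro triangle_join_boundary_list) auto
    then have "triangle_join xs = frag_extend triangle_join (prepend x (boundary_list xs))" by (simp add: frag_linear)
    then show ?thesis using * collapse_boundary_list Cons.IH False by (auto simp: boundary_prepend)
  qed
qed auto

text \<open>The usual acyclicity argument made explicit: the obstruction is a cycle and is coned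
  off. The apex is the first vertex of the simplex itself, so the construction commutes with maps of
  vertices and hence with \<open>G\<close>. The index counts vertices, and it starts at 0 because
  \<open>collapse\<close> fixes the empty simplex.\<close>

fun collapse_htpy :: "nat \<Rightarrow> 'g list \<Rightarrow> ('g list \<Rightarrow>\<^sub>0 int)" where
  "collapse_htpy 0 c = 0"
| "collapse_htpy (Suc k) c = prepend (hd c) (collapse c - frag_of c - frag_extend (collapse_htpy k) (boundary_list c))"

lemma collapse_htpy_homotopy:
  "length c = k \<Longrightarrow> boundary (collapse_htpy k c) + frag_extend (collapse_htpy (k - 1)) (boundary_list c) = collapse c - frag_of c"
proof (induction k arbitrary: c)
  case (Suc k)
  let ?z = "collapse c - frag_of c - frag_extend (collapse_htpy k) (boundary_list c)"
  have "frag_extend (\<lambda>x. boundary (collapse_htpy k x) + frag_extend (collapse_htpy (k - 1)) (boundary_list x)) (boundary_list c)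
      = frag_extend (\<lambda>x. collapse x - frag_of x) (boundary_list c)"
    using keys_boundary_list [of c UNIV] Suc.prems by (intro frag_extend_eq Suc.IH) (auto simp: tuples_def)
  moreover have "frag_extend (\<lambda>x. boundary (collapse_htpy k x) + frag_extend (collapse_htpy (k - 1)) (boundary_list x)) (boundary_list c)
      = boundary (frag_extend (collapse_htpy k) (boundary_list c)) + frag_extend (collapse_htpy (k - 1)) (boundary (boundary_list c))"
    by (simp add: frag_extend_fun_add frag_extend_frag_extend)
  moreover have "boundary (boundary_list c) = 0" using boundary_boundary [of "frag_of c"] by simp
  ultimately have "boundary (frag_extend (collapse_htpy k) (boundary_list c)) = frag_extend collapse (boundary_list c) - boundary_list c"
    by (simp add: frag_extend_fun_diff)
  \<comment> \<open>The obstruction is a cycle because \<open>collapse\<close> is a chain map, so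
    its cone has it as boundary.\<close>
  then have "boundary ?z = 0" using boundary_collapse [of c] by (auto simp: frag_linear)
  then show ?case by (simp add: boundary_prepend)
qed simp

lemma keys_triangle_join: "set c \<subseteq> S \<Longrightarrow> length c = 2 * n + 1 \<Longrightarrow> Poly_Mapping.keys (triangle_join c) \<subseteq> tuples (2 * n) S"
proof (induction c arbitrary: n rule: triangle_join.induct)
  case (1 a b c r)
  then obtain m where n: "n = Suc m" by (cases n) auto
  have "Poly_Mapping.keys (triangle_join (c # r)) \<subseteq> tuples (2 * m) S"
    using 1 n by (intro "1.IH") auto
  then have "Poly_Mapping.keys (triangle_join (a # b # c # r)) \<subseteq> tuples (2 + 2 * m) S"
    unfolding triangle_join.simps using 1 keys_boundary_list [of "[a,b,c]" S]
    by (intro keys_join) (auto simp del: boundary_list.simps simp: eval_nat_numeral)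
  then show ?case using n by simp
qed (auto simp: tuples_def)

lemma keys_collapse: "set c \<subseteq> S \<Longrightarrow> Poly_Mapping.keys (collapse c) \<subseteq> tuples (length c) S"
proof (induction c)
  case (Cons x xs)
  then show ?case
    using keys_triangle_join [of "x # xs" S "length xs div 2"]
    by (cases "even (length xs)") (simp_all add: keys_prepend)
qed (auto simp: tuples_def)

lemma keys_collapse_htpy: "set c \<subseteq> S \<Longrightarrow> length c = k \<Longrightarrow> Poly_Mapping.keys (collapse_htpy k c) \<subseteq> tuples (Suc k) S"
proof (induction k arbitrary: c)
  case (Suc k)
  have "Poly_Mapping.keys (frag_extend (collapse_htpy k) (boundary_list c)) \<subseteq> tuples (Suc k) S"
    using Suc keys_boundary_list [of c S]
    by (intro keys_frag_extend_subset [of _ "tuples k S"] Suc.IH) (auto simp: tuples_def)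
  then have "Poly_Mapping.keys (collapse c - frag_of c - frag_extend (collapse_htpy k) (boundary_list c)) \<subseteq> tuples (Suc k) S"
    using keys_collapse [of c S] Suc.prems
    by (intro order_trans [OF keys_diff] Un_least) (auto simp: tuples_def)
  moreover have "hd c \<in> S" using Suc.prems by (cases c) auto
  ultimately show ?case by (simp add: keys_prepend)
qed simp

lemma map_chain_triangle_join: "map_chain u (triangle_join c) = triangle_join (map u c)"
  by (induction c rule: triangle_join.induct) (simp_all add: map_chain_join map_chain_linear map_chain_prepend)

lemma map_chain_collapse: "map_chain u (collapse c) = collapse (map u c)"
  by (induction c) (auto simp: map_chain_prepend map_chain_triangle_join simp del: triangle_join.simps)

lemma map_chain_collapse_htpy: "c \<noteq> [] \<or> k = 0 \<Longrightarrow> length c = k \<Longrightarrow> map_chain u (collapse_htpy k c) = collapse_htpy k (map u c)"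
proof (induction k arbitrary: c)
  case (Suc k)
  have "map_chain u (frag_extend (collapse_htpy k) (boundary_list c)) = frag_extend (\<lambda>x. map_chain u (collapse_htpy k x)) (boundary_list c)"
    by (simp add: map_chain_def frag_extend_frag_extend)
  also have "\<dots> = frag_extend (\<lambda>x. collapse_htpy k (map u x)) (boundary_list c)"
    using keys_boundary_list [of c UNIV] Suc.prems
    by (intro frag_extend_eq Suc.IH) (auto simp: tuples_def)
  also have "\<dots> = frag_extend (collapse_htpy k) (map_chain u (boundary_list c))"
    by (simp add: map_chain_def frag_extend_frag_extend)
  finally show ?case
    using Suc.prems by (cases c) (simp_all add: map_chain_prepend map_chain_linear map_chain_collapse map_chain_boundary_list del: boundary_list.simps collapse.simps)
qed (auto simp: map_chain_linear)

section \<open>Quotients by generated subgroups\<close>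

lemma group_homI: "group A \<Longrightarrow> group B \<Longrightarrow> f \<in> hom A B \<Longrightarrow> group_hom A B f"
  by (simp add: group_hom_def group_hom_axioms_def)

lemma hom_kills_generate:
  assumes "group A" "group U" "f \<in> hom A U" "S \<subseteq> carrier A" "\<And>s. s \<in> S \<Longrightarrow> f s = \<one>\<^bsub>U\<^esub>"
  shows "generate A S \<subseteq> kernel A U f"
proof -
  interpret group_hom A U f using assms by (intro group_homI)
  show ?thesis
    using assms by (intro G.generate_subgroup_incl subgroup_kernel) (auto simp: kernel_def)
qed

lemma normal_generate:
  assumes "comm_group A" "S \<subseteq> carrier A"
  shows "generate A S \<lhd> A"
  using assms by (simp add: comm_group.normal_iff_subgroup comm_group.axioms(2) group.generate_is_subgroup)

lemma comm_group_Mod_generate: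
  assumes "comm_group A" "S \<subseteq> carrier A"
  shows "comm_group (A Mod generate A S)"
  using assms by (simp add: comm_group.abelian_FactGroup comm_group.axioms(2) group.generate_is_subgroup)

lemma Mod_generate_hom:
  assumes "comm_group A" "S \<subseteq> carrier A"
  shows "(\<lambda>x. generate A S #>\<^bsub>A\<^esub> x) \<in> hom A (A Mod generate A S)"
  using normal.r_coset_hom_Mod [OF normal_generate [OF assms]] .

lemma Mod_generate_eqI:
  assumes "comm_group A" "S \<subseteq> carrier A" "x \<in> carrier A" "y \<in> carrier A"
    "x \<otimes>\<^bsub>A\<^esub> inv\<^bsub>A\<^esub> y \<in> generate A S"
  shows "generate A S #>\<^bsub>A\<^esub> x = generate A S #>\<^bsub>A\<^esub> y"
proof -
  interpret comm_group A by fact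
  have "subgroup (generate A S) A" by (simp add: assms generate_is_subgroup)
  then have "x \<in> generate A S #>\<^bsub>A\<^esub> y"
    using assms subgroup.rcos_module [OF _ is_group] by blast
  then show ?thesis
    using \<open>subgroup _ A\<close> assms by (metis repr_independence)
qed

lemma Mod_generate_universal:
  assumes "comm_group A" "S \<subseteq> carrier A" "group U" "f \<in> hom A U" "\<And>s. s \<in> S \<Longrightarrow> f s = \<one>\<^bsub>U\<^esub>"
  obtains h where "h \<in> hom (A Mod generate A S) U"
    "\<And>x. x \<in> carrier A \<Longrightarrow> h (generate A S #>\<^bsub>A\<^esub> x) = f x"
proof -
  interpret group_hom A U f using assms by (intro group_homI) (auto simp: comm_group.axioms)
  show ?thesis
    using FactGroup_universal_kernel [OF normal_generate [OF assms(1,2)] hom_kills_generate] assms that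
    by (metis G.is_group)
qed

lemma carrier_Mod: "X \<in> carrier (A Mod N) \<longleftrightarrow> (\<exists>x\<in>carrier A. X = N #>\<^bsub>A\<^esub> x)"
  by (auto simp: carrier_FactGroup)

lemma induced_map_coset:
  assumes "group A" "subgroup N' A" "N \<lhd> B" "f \<in> hom A B" "f ` N' \<subseteq> N" "x \<in> carrier A"
  shows "induced_map B N f (N' #>\<^bsub>A\<^esub> x) = N #>\<^bsub>B\<^esub> f x"
proof -
  interpret A: group A by fact
  interpret N: normal N B by fact
  have "N #>\<^bsub>B\<^esub> f y = N #>\<^bsub>B\<^esub> f x" if y: "y \<in> N' #>\<^bsub>A\<^esub> x" for y
  proof -
    obtain n where n: "n \<in> N'" "y = n \<otimes>\<^bsub>A\<^esub> x" using y by (auto simp: r_coset_def)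
    have "n \<in> carrier A" using n assms(2) by (metis subgroup.mem_carrier)
    have fx: "f x \<in> carrier B" using assms(4,6) by (rule hom_in_carrier)
    have fn: "f n \<in> N" using n(1) assms(5) by blast
    then have "f n \<in> carrier B" using N.subset by blast
    then have "N #>\<^bsub>B\<^esub> (f n \<otimes>\<^bsub>B\<^esub> f x) = (N #>\<^bsub>B\<^esub> f n) #>\<^bsub>B\<^esub> f x"
      by (rule N.coset_mult_assoc [OF N.subset _ fx, symmetric])
    also have "N #>\<^bsub>B\<^esub> f n = N" by (rule N.rcos_const [OF N.is_group fn])
    finally show ?thesis
      using hom_mult [OF assms(4) \<open>n \<in> carrier A\<close> assms(6)] n(2) by simp
  qed
  moreover have "x \<in> N' #>\<^bsub>A\<^esub> x" using A.rcos_self assms by blast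
  ultimately have "(\<lambda>y. N #>\<^bsub>B\<^esub> f y) ` (N' #>\<^bsub>A\<^esub> x) = {N #>\<^bsub>B\<^esub> f x}" by blast
  then show ?thesis by (simp add: induced_map_def)
qed

lemma induced_map_hom:
  assumes "group A" "N' \<lhd> A" "N \<lhd> B" "f \<in> hom A B" "f ` N' \<subseteq> N"
  shows "induced_map B N f \<in> hom (A Mod N') (B Mod N)"
proof (rule homI)
  interpret N': normal N' A by fact
  interpret N: normal N B by fact
  have *: "induced_map B N f (N' #>\<^bsub>A\<^esub> x) = N #>\<^bsub>B\<^esub> f x" if "x \<in> carrier A" for x
    using that assms N'.is_subgroup by (intro induced_map_coset)
  note fc = hom_in_carrier [OF assms(4)]
  show "induced_map B N f X \<in> carrier (B Mod N)" if "X \<in> carrier (A Mod N')" for X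
    using that fc by (auto simp: carrier_Mod *)
  show "induced_map B N f (X \<otimes>\<^bsub>A Mod N'\<^esub> Y) = induced_map B N f X \<otimes>\<^bsub>B Mod N\<^esub> induced_map B N f Y"
    if XY: "X \<in> carrier (A Mod N')" "Y \<in> carrier (A Mod N')" for X Y
  proof -
    obtain x y where xy: "x \<in> carrier A" "y \<in> carrier A" "X = N' #>\<^bsub>A\<^esub> x" "Y = N' #>\<^bsub>A\<^esub> y"
      using XY by (auto simp: carrier_Mod)
    then show ?thesis
      using assms fc by (simp add: N'.rcos_sum N.rcos_sum * hom_mult)
  qed
qed

lemma induced_map_generate:
  assumes "comm_group A" "comm_group B" "S \<subseteq> carrier A" "S' \<subseteq> carrier B" "f \<in> hom A B"
    "\<And>s. s \<in> S \<Longrightarrow> f s \<in> generate B S'"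
  shows "induced_map B (generate B S') f \<in> hom (A Mod generate A S) (B Mod generate B S')"
    and "x \<in> carrier A \<Longrightarrow>
      induced_map B (generate B S') f (generate A S #>\<^bsub>A\<^esub> x) = generate B S' #>\<^bsub>B\<^esub> f x"
proof -
  interpret A: comm_group A by fact
  interpret B: comm_group B by fact
  interpret f: group_hom A B f by (intro group_homI assms A.is_group B.is_group)
  have "f ` generate A S = generate B (f ` S)"
    using assms f.generate_img by metis
  also have "\<dots> \<subseteq> generate B S'"
    using assms by (intro B.generate_subgroup_incl B.generate_is_subgroup) auto
  finally have "f ` generate A S \<subseteq> generate B S'" .
  then show "induced_map B (generate B S') f \<in> hom (A Mod generate A S) (B Mod generate B S')"
    by (intro induced_map_hom normal_generate assms A.is_group)
  show "induced_map B (generate B S') f (generate A S #>\<^bsub>A\<^esub> x) = generate B S' #>\<^bsub>B\<^esub> f x"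
    if "x \<in> carrier A"
    by (intro induced_map_coset normal_generate assms A.is_group A.generate_is_subgroup that)
      fact
qed

section \<open>Homomorphisms out of free abelian groups\<close>

lemma free_Abelian_group_hom_eqI:
  assumes "group U" "f \<in> hom (free_Abelian_group I) U" "h \<in> hom (free_Abelian_group I) U"
    "\<And>i. i \<in> I \<Longrightarrow> f (frag_of i) = h (frag_of i)" "Poly_Mapping.keys z \<subseteq> I"
  shows "f z = h z"
  using assms(5)
proof (induct z rule: free_Abelian_group_induct [consumes 1, case_names zero diff one])
  case zero
  then show ?case using assms(1-3) by (metis group_free_Abelian_group hom_one one_free_Abelian_group)
next
  case (diff x y)
  interpret f: group_hom "free_Abelian_group I" U f by (intro group_homI assms group_free_Abelian_group)
  interpret h: group_hom "free_Abelian_group I" U h by (intro group_homI assms group_free_Abelian_group)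
  have "k (x - y) = k x \<otimes>\<^bsub>U\<^esub> inv\<^bsub>U\<^esub> k y" if "group_hom (free_Abelian_group I) U k" for k
  proof -
    interpret k: group_hom "free_Abelian_group I" U k by fact
    have "k (x + - y) = k x \<otimes>\<^bsub>U\<^esub> k (- y)"
      using k.hom_mult [of x "- y"] diff by simp
    then show ?thesis using k.hom_inv [of y] diff by simp
  qed
  then show ?case using diff f.group_hom_axioms h.group_hom_axioms by metis
qed (use assms in auto)

lemma frag_extend_hom:
  assumes "\<And>i. i \<in> I \<Longrightarrow> Poly_Mapping.keys (\<phi> i) \<subseteq> J"
  shows "frag_extend \<phi> \<in> hom (free_Abelian_group I) (free_Abelian_group J)"
proof (rule homI)
  show "frag_extend \<phi> x \<in> carrier (free_Abelian_group J)" if "x \<in> carrier (free_Abelian_group I)" for x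
    using that assms keys_frag_extend_subset [of x I \<phi> J] by simp
qed (simp add: frag_extend_add)

lemma keys_relationD: "x \<in> Poly_Mapping.keys (frag_of a - frag_of b - frag_of c) \<Longrightarrow> x = a \<or> x = b \<or> x = c"
  using keys_diff [of "frag_of a - frag_of b" "frag_of c"] keys_diff [of "frag_of a" "frag_of b"] by auto

lemma keys_relation: "a \<in> I \<Longrightarrow> b \<in> I \<Longrightarrow> c \<in> I \<Longrightarrow>
    Poly_Mapping.keys (frag_of a - frag_of b - frag_of c) \<subseteq> I"
  using keys_diff [of "frag_of a - frag_of b" "frag_of c"] keys_diff [of "frag_of a" "frag_of b"] by auto

text \<open>All defining relations of tensor products and tensor powers have this shape, so
  respecting them means additivity in one variable. \<open>coset_relation\<close> is the counterpart
  for the quotient map.\<close>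

lemma hom_relation_one:
  assumes "comm_group U" "h \<in> hom (free_Abelian_group I) U" "a \<in> I" "b \<in> I" "c \<in> I"
    "h (frag_of a) = h (frag_of b) \<otimes>\<^bsub>U\<^esub> h (frag_of c)"
  shows "h (frag_of a - frag_of b - frag_of c) = \<one>\<^bsub>U\<^esub>"
proof -
  interpret comm_group U by fact
  interpret h: group_hom "free_Abelian_group I" U h
    by (intro group_homI assms is_group group_free_Abelian_group)
  have "h (frag_of a) = h ((frag_of a - frag_of b - frag_of c) + (frag_of b + frag_of c))" by simp
  also have "\<dots> = h (frag_of a - frag_of b - frag_of c) \<otimes>\<^bsub>U\<^esub> h (frag_of b + frag_of c)"
    using assms keys_relation [of a I b c] keys_add [of "frag_of b" "frag_of c"]
    by (subst h.hom_mult [symmetric]) auto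
  also have "h (frag_of b + frag_of c) = h (frag_of a)"
    using assms h.hom_mult [of "frag_of b" "frag_of c"] by simp
  finally have e: "h (frag_of a) = h (frag_of a - frag_of b - frag_of c) \<otimes>\<^bsub>U\<^esub> h (frag_of a)" .
  have "h (frag_of a) \<in> carrier U" "h (frag_of a - frag_of b - frag_of c) \<in> carrier U"
    using assms keys_relation [of a I b c] by (simp_all add: h.hom_closed)
  then show ?thesis using e by (metis r_cancel_one')
qed

lemma coset_relation:
  assumes "S \<subseteq> carrier (free_Abelian_group I)" "a \<in> I" "b \<in> I" "c \<in> I"
    "frag_of a - frag_of b - frag_of c \<in> S"
  defines "F \<equiv> free_Abelian_group I"
  shows "generate F S #>\<^bsub>F\<^esub> frag_of a =
    (generate F S #>\<^bsub>F\<^esub> frag_of b) \<otimes>\<^bsub>F Mod generate F S\<^esub> (generate F S #>\<^bsub>F\<^esub> frag_of c)"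
proof -
  have F: "comm_group F" by (simp add: F_def abelian_free_Abelian_group)
  have "generate F S #>\<^bsub>F\<^esub> frag_of a = generate F S #>\<^bsub>F\<^esub> (frag_of b + frag_of c)"
  proof (rule Mod_generate_eqI [OF F])
    have gen: "frag_of a - frag_of b - frag_of c \<in> generate F S"
      using assms by (auto intro: generate.incl)
    have inv: "inv\<^bsub>F\<^esub> (frag_of b + frag_of c) = - (frag_of b + frag_of c)"
      unfolding F_def using assms keys_add [of "frag_of b" "frag_of c"]
      by (intro inv_free_Abelian_group) auto
    have "frag_of a \<otimes>\<^bsub>F\<^esub> inv\<^bsub>F\<^esub> (frag_of b + frag_of c) = frag_of a - frag_of b - frag_of c"
      by (subst inv) (simp add: F_def)
    with gen show "frag_of a \<otimes>\<^bsub>F\<^esub> inv\<^bsub>F\<^esub> (frag_of b + frag_of c) \<in> generate F S"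
      by simp
  qed (use assms keys_add [of "frag_of b" "frag_of c"] in \<open>auto simp: F_def\<close>)
  then show ?thesis
    using hom_mult [OF Mod_generate_hom [OF F], of S "frag_of b" "frag_of c"] assms by (simp add: F_def)
qed

section \<open>Tensor products\<close>

definition tens where
  "tens A B a b = tensor_relations A B #>\<^bsub>free_Abelian_group (carrier A \<times> carrier B)\<^esub> frag_of (a, b)"

definition tensor_gens ::
  "('m, 'y) monoid_scheme \<Rightarrow> ('k, 'z) monoid_scheme \<Rightarrow> ('m \<times> 'k \<Rightarrow>\<^sub>0 int) set" where
  "tensor_gens A B =
    {frag_of (a \<otimes>\<^bsub>A\<^esub> a', b) - frag_of (a, b) - frag_of (a', b) | a a' b.
        a \<in> carrier A \<and> a' \<in> carrier A \<and> b \<in> carrier B} \<union>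
     {frag_of (a, b \<otimes>\<^bsub>B\<^esub> b') - frag_of (a, b) - frag_of (a, b') | a b b'.
        a \<in> carrier A \<and> b \<in> carrier B \<and> b' \<in> carrier B}"

lemma tensor_relations_eq:
  "tensor_relations A B = generate (free_Abelian_group (carrier A \<times> carrier B)) (tensor_gens A B)"
  by (simp add: tensor_relations_def tensor_gens_def)

context
  fixes A :: "('m, 'y) monoid_scheme" and B :: "('k, 'z) monoid_scheme"
  assumes A: "comm_group A" and B: "comm_group B"
begin

interpretation A: comm_group A by (rule A)
interpretation B: comm_group B by (rule B)

lemma tensor_gens_carrier: "tensor_gens A B \<subseteq> carrier (free_Abelian_group (carrier A \<times> carrier B))"
  unfolding tensor_gens_def by (auto dest!: keys_relationD)

lemma comm_group_tensor_group: "comm_group (tensor_group A B)"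
  unfolding tensor_group_def tensor_relations_eq
  by (intro comm_group_Mod_generate abelian_free_Abelian_group tensor_gens_carrier)

lemma tensor_coset_hom:
  "(\<lambda>z. tensor_relations A B #>\<^bsub>free_Abelian_group (carrier A \<times> carrier B)\<^esub> z)
    \<in> hom (free_Abelian_group (carrier A \<times> carrier B)) (tensor_group A B)"
  unfolding tensor_group_def tensor_relations_eq
  by (intro Mod_generate_hom abelian_free_Abelian_group tensor_gens_carrier)

lemma tens_closed: "a \<in> carrier A \<Longrightarrow> b \<in> carrier B \<Longrightarrow> tens A B a b \<in> carrier (tensor_group A B)"
  unfolding tens_def using tensor_coset_hom by (rule hom_in_carrier) simp

lemma tens_add_left:
  "a \<in> carrier A \<Longrightarrow> a' \<in> carrier A \<Longrightarrow> b \<in> carrier B \<Longrightarrow>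
    tens A B (a \<otimes>\<^bsub>A\<^esub> a') b = tens A B a b \<otimes>\<^bsub>tensor_group A B\<^esub> tens A B a' b"
  unfolding tens_def tensor_group_def tensor_relations_eq
  by (intro coset_relation tensor_gens_carrier) (auto simp: tensor_gens_def)

lemma tens_add_right:
  "a \<in> carrier A \<Longrightarrow> b \<in> carrier B \<Longrightarrow> b' \<in> carrier B \<Longrightarrow>
    tens A B a (b \<otimes>\<^bsub>B\<^esub> b') = tens A B a b \<otimes>\<^bsub>tensor_group A B\<^esub> tens A B a b'"
  unfolding tens_def tensor_group_def tensor_relations_eq
  by (intro coset_relation tensor_gens_carrier) (auto simp: tensor_gens_def)

lemma tensor_group_universal:
  assumes U: "comm_group U"
    and \<beta>: "\<And>a b. a \<in> carrier A \<Longrightarrow> b \<in> carrier B \<Longrightarrow> \<beta> a b \<in> carrier U"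
    and l: "\<And>a a' b. a \<in> carrier A \<Longrightarrow> a' \<in> carrier A \<Longrightarrow> b \<in> carrier B \<Longrightarrow>
      \<beta> (a \<otimes>\<^bsub>A\<^esub> a') b = \<beta> a b \<otimes>\<^bsub>U\<^esub> \<beta> a' b"
    and r: "\<And>a b b'. a \<in> carrier A \<Longrightarrow> b \<in> carrier B \<Longrightarrow> b' \<in> carrier B \<Longrightarrow>
      \<beta> a (b \<otimes>\<^bsub>B\<^esub> b') = \<beta> a b \<otimes>\<^bsub>U\<^esub> \<beta> a b'"
  obtains h where "h \<in> hom (tensor_group A B) U"
    "\<And>a b. a \<in> carrier A \<Longrightarrow> b \<in> carrier B \<Longrightarrow> h (tens A B a b) = \<beta> a b"
proof -
  interpret U: comm_group U by fact
  obtain q where q: "q \<in> hom (free_Abelian_group (carrier A \<times> carrier B)) U"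
    "\<And>x. x \<in> carrier A \<times> carrier B \<Longrightarrow> q (frag_of x) = (\<lambda>(a, b). \<beta> a b) x"
  proof (rule U.free_Abelian_group_universal)
    show "(\<lambda>(a, b). \<beta> a b) ` (carrier A \<times> carrier B) \<subseteq> carrier U" using \<beta> by auto
  qed (rule that)
  have kill: "q s = \<one>\<^bsub>U\<^esub>" if "s \<in> tensor_gens A B" for s
    using that unfolding tensor_gens_def
    by (auto intro!: hom_relation_one [OF U q(1)] simp: q(2) l r)
  obtain h where h: "h \<in> hom (tensor_group A B) U"
    "\<And>z. z \<in> carrier (free_Abelian_group (carrier A \<times> carrier B)) \<Longrightarrow>
      h (tensor_relations A B #>\<^bsub>free_Abelian_group (carrier A \<times> carrier B)\<^esub> z) = q z"
    by (rule Mod_generate_universal [OF abelian_free_Abelian_group tensor_gens_carrier U.is_group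
          q(1) kill, folded tensor_relations_eq, folded tensor_group_def]) (assumption | rule that)+
  show ?thesis
    by (rule that [OF h(1)]) (simp add: tens_def h(2) q(2))
qed

text \<open>Together with \<open>tensor_group_universal\<close> this hides the encoding by cosets:
  maps out of a tensor product are built and compared on the generators
  \<open>tens A B a b\<close>.\<close>

lemma tensor_group_hom_eqI:
  assumes "group U" "f \<in> hom (tensor_group A B) U" "h \<in> hom (tensor_group A B) U"
    "\<And>a b. a \<in> carrier A \<Longrightarrow> b \<in> carrier B \<Longrightarrow> f (tens A B a b) = h (tens A B a b)"
    "x \<in> carrier (tensor_group A B)"
  shows "f x = h x"
proof -
  obtain z where z: "Poly_Mapping.keys z \<subseteq> carrier A \<times> carrier B"
    "x = tensor_relations A B #>\<^bsub>free_Abelian_group (carrier A \<times> carrier B)\<^esub> z"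
    using assms(5) by (auto simp: tensor_group_def carrier_Mod)
  show ?thesis
    unfolding z(2)
  proof (rule free_Abelian_group_hom_eqI [OF assms(1) _ _ _ z(1)])
    show "(\<lambda>z. f (tensor_relations A B #>\<^bsub>free_Abelian_group (carrier A \<times> carrier B)\<^esub> z))
        \<in> hom (free_Abelian_group (carrier A \<times> carrier B)) U"
      using hom_compose [OF tensor_coset_hom assms(2)] by (simp add: o_def)
    show "(\<lambda>z. h (tensor_relations A B #>\<^bsub>free_Abelian_group (carrier A \<times> carrier B)\<^esub> z))
        \<in> hom (free_Abelian_group (carrier A \<times> carrier B)) U"
      using hom_compose [OF tensor_coset_hom assms(3)] by (simp add: o_def)
  qed (use assms(4) in \<open>auto simp: tens_def\<close>)
qed

end

lemma tensor_map_hom: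
  assumes "comm_group A" "comm_group B" "comm_group A'" "comm_group B'"
    and f: "f \<in> hom A A'" and h: "h \<in> hom B B'"
  shows "tensor_map A' B' f h \<in> hom (tensor_group A B) (tensor_group A' B')"
    and "a \<in> carrier A \<Longrightarrow> b \<in> carrier B \<Longrightarrow>
      tensor_map A' B' f h (tens A B a b) = tens A' B' (f a) (h b)"
proof -
  let ?q = "frag_extend (\<lambda>(a, b). frag_of (f a, h b))"
  note fh = hom_in_carrier [OF f] hom_in_carrier [OF h]
  have q: "?q \<in> hom (free_Abelian_group (carrier A \<times> carrier B)) (free_Abelian_group (carrier A' \<times> carrier B'))"
    by (intro frag_extend_hom) (auto simp: fh)
  have qs: "?q s \<in> generate (free_Abelian_group (carrier A' \<times> carrier B')) (tensor_gens A' B')"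
    if "s \<in> tensor_gens A B" for s
  proof (rule generate.incl)
    show "?q s \<in> tensor_gens A' B'"
      using that unfolding tensor_gens_def
      by (auto simp: frag_linear hom_mult [OF f] hom_mult [OF h]) (use fh in blast)+
  qed
  note * = induced_map_generate [OF abelian_free_Abelian_group abelian_free_Abelian_group
      tensor_gens_carrier [OF assms(1,2)] tensor_gens_carrier [OF assms(3,4)] q qs]
  show "tensor_map A' B' f h \<in> hom (tensor_group A B) (tensor_group A' B')"
    unfolding tensor_map_def tensor_group_def tensor_relations_eq using * by blast
  show "tensor_map A' B' f h (tens A B a b) = tens A' B' (f a) (h b)"
    if "a \<in> carrier A" "b \<in> carrier B"
    unfolding tensor_map_def tens_def tensor_relations_eq using *(2) [of "frag_of (a, b)"] that by simp
qed

section \<open>Tensor powers\<close>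

text \<open>Defined on formal combinations of tuples, not only on tuples, so that cup powers can be
  computed as chains and passed to the quotient at the end.\<close>

definition power_class where
  "power_class n A z = power_relations n A #>\<^bsub>free_Abelian_group (tuples n (carrier A))\<^esub> z"

definition power_gens :: "nat \<Rightarrow> ('m, 'z) monoid_scheme \<Rightarrow> ('m list \<Rightarrow>\<^sub>0 int) set" where
  "power_gens n A =
    {frag_of (xs @ (a \<otimes>\<^bsub>A\<^esub> b) # ys) - frag_of (xs @ a # ys) - frag_of (xs @ b # ys) | xs a b ys.
        a \<in> carrier A \<and> b \<in> carrier A \<and> set xs \<subseteq> carrier A \<and> set ys \<subseteq> carrier A \<and>
        length xs + 1 + length ys = n}"

lemma power_relations_eq:
  "power_relations n A = generate (free_Abelian_group (tuples n (carrier A))) (power_gens n A)"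
  by (simp add: power_relations_def power_gens_def)

context
  fixes n :: nat and A :: "('m, 'y) monoid_scheme"
  assumes A: "comm_group A"
begin

interpretation A: comm_group A by (rule A)

lemma power_gens_carrier: "power_gens n A \<subseteq> carrier (free_Abelian_group (tuples n (carrier A)))"
proof
  fix s assume "s \<in> power_gens n A"
  then obtain xs a b ys where s: "s = frag_of (xs @ (a \<otimes>\<^bsub>A\<^esub> b) # ys) - frag_of (xs @ a # ys) - frag_of (xs @ b # ys)"
    "a \<in> carrier A" "b \<in> carrier A" "set xs \<subseteq> carrier A" "set ys \<subseteq> carrier A" "length xs + 1 + length ys = n"
    by (auto simp: power_gens_def)
  then have "Poly_Mapping.keys s \<subseteq> tuples n (carrier A)"
    by (simp only: s(1)) (rule keys_relation, auto simp: tuples_def)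
  then show "s \<in> carrier (free_Abelian_group (tuples n (carrier A)))" by simp
qed

lemma comm_group_power_group: "comm_group (power_group n A)"
  unfolding power_group_def power_relations_eq
  by (intro comm_group_Mod_generate abelian_free_Abelian_group power_gens_carrier)

lemma power_class_hom: "power_class n A \<in> hom (free_Abelian_group (tuples n (carrier A))) (power_group n A)"
  unfolding power_group_def power_relations_eq power_class_def [abs_def]
  by (intro Mod_generate_hom abelian_free_Abelian_group power_gens_carrier)

lemma power_group_universal:
  assumes U: "comm_group U"
    and \<beta>: "\<And>xs. xs \<in> tuples n (carrier A) \<Longrightarrow> \<beta> xs \<in> carrier U"
    and add: "\<And>xs a b ys. a \<in> carrier A \<Longrightarrow> b \<in> carrier A \<Longrightarrow> set xs \<subseteq> carrier A \<Longrightarrow>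
      set ys \<subseteq> carrier A \<Longrightarrow> length xs + 1 + length ys = n \<Longrightarrow>
      \<beta> (xs @ (a \<otimes>\<^bsub>A\<^esub> b) # ys) = \<beta> (xs @ a # ys) \<otimes>\<^bsub>U\<^esub> \<beta> (xs @ b # ys)"
  obtains h where "h \<in> hom (power_group n A) U"
    "\<And>xs. xs \<in> tuples n (carrier A) \<Longrightarrow> h (power_class n A (frag_of xs)) = \<beta> xs"
proof -
  interpret U: comm_group U by fact
  obtain q where q: "q \<in> hom (free_Abelian_group (tuples n (carrier A))) U"
    "\<And>x. x \<in> tuples n (carrier A) \<Longrightarrow> q (frag_of x) = \<beta> x"
  proof (rule U.free_Abelian_group_universal)
    show "\<beta> ` tuples n (carrier A) \<subseteq> carrier U" using \<beta> by auto
  qed (rule that)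
  have kill: "q s = \<one>\<^bsub>U\<^esub>" if "s \<in> power_gens n A" for s
    using that unfolding power_gens_def
    by (auto intro!: hom_relation_one [OF U q(1)] simp: q(2) tuples_def add)
  obtain h where h: "h \<in> hom (power_group n A) U"
    "\<And>z. z \<in> carrier (free_Abelian_group (tuples n (carrier A))) \<Longrightarrow> h (power_class n A z) = q z"
    by (rule Mod_generate_universal [OF abelian_free_Abelian_group power_gens_carrier U.is_group
          q(1) kill, folded power_relations_eq, folded power_group_def power_class_def]) (assumption | rule that)+
  show ?thesis
    by (rule that [OF h(1)]) (simp add: h(2) q(2))
qed

lemma carrier_power_group:
  "X \<in> carrier (power_group n A) \<longleftrightarrow>
    (\<exists>z. Poly_Mapping.keys z \<subseteq> tuples n (carrier A) \<and> X = power_class n A z)"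
  by (simp add: power_group_def carrier_Mod power_class_def Bex_def)

lemma power_group_hom_eqI:
  assumes "group U" "f \<in> hom (power_group n A) U" "h \<in> hom (power_group n A) U"
    "\<And>xs. xs \<in> tuples n (carrier A) \<Longrightarrow> f (power_class n A (frag_of xs)) = h (power_class n A (frag_of xs))"
    "x \<in> carrier (power_group n A)"
  shows "f x = h x"
proof -
  obtain z where z: "Poly_Mapping.keys z \<subseteq> tuples n (carrier A)" "x = power_class n A z"
    using assms(5) by (auto simp: carrier_power_group)
  show ?thesis
    unfolding z(2)
  proof (rule free_Abelian_group_hom_eqI [OF assms(1) _ _ _ z(1)])
    show "(\<lambda>z. f (power_class n A z)) \<in> hom (free_Abelian_group (tuples n (carrier A))) U"
      using hom_compose [OF power_class_hom assms(2)] by (simp add: o_def)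
    show "(\<lambda>z. h (power_class n A z)) \<in> hom (free_Abelian_group (tuples n (carrier A))) U"
      using hom_compose [OF power_class_hom assms(3)] by (simp add: o_def)
  qed (use assms(4) in auto)
qed

lemma power_class_eqI:
  assumes "Poly_Mapping.keys x \<subseteq> tuples n (carrier A)" "Poly_Mapping.keys y \<subseteq> tuples n (carrier A)"
    "x - y \<in> power_relations n A"
  shows "power_class n A x = power_class n A y"
  unfolding power_class_def power_relations_eq
  by (rule Mod_generate_eqI [OF abelian_free_Abelian_group power_gens_carrier])
    (use assms in \<open>simp_all add: power_relations_eq\<close>)

end

lemma power_map_hom:
  assumes "comm_group A" "comm_group A'" and f: "f \<in> hom A A'"
  shows "power_map n A' f \<in> hom (power_group n A) (power_group n A')"
    and "Poly_Mapping.keys z \<subseteq> tuples n (carrier A) \<Longrightarrow>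
      power_map n A' f (power_class n A z) = power_class n A' (map_chain f z)"
proof -
  note fc = hom_in_carrier [OF f]
  have q: "map_chain f \<in> hom (free_Abelian_group (tuples n (carrier A))) (free_Abelian_group (tuples n (carrier A')))"
    unfolding map_chain_def by (intro frag_extend_hom) (auto simp: fc tuples_def)
  have qs: "map_chain f s \<in> generate (free_Abelian_group (tuples n (carrier A'))) (power_gens n A')"
    if s: "s \<in> power_gens n A" for s
  proof (rule generate.incl)
    obtain xs a b ys where s: "s = frag_of (xs @ (a \<otimes>\<^bsub>A\<^esub> b) # ys) - frag_of (xs @ a # ys) - frag_of (xs @ b # ys)"
      "a \<in> carrier A" "b \<in> carrier A" "set xs \<subseteq> carrier A" "set ys \<subseteq> carrier A" "length xs + 1 + length ys = n"
      using s by (auto simp: power_gens_def)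
    have "map_chain f s = frag_of (map f xs @ (f a \<otimes>\<^bsub>A'\<^esub> f b) # map f ys)
        - frag_of (map f xs @ f a # map f ys) - frag_of (map f xs @ f b # map f ys)"
      using s by (simp add: map_chain_linear hom_mult [OF f])
    moreover have "f a \<in> carrier A'" "f b \<in> carrier A'" "set (map f xs) \<subseteq> carrier A'" "set (map f ys) \<subseteq> carrier A'"
        "length (map f xs) + 1 + length (map f ys) = n"
      using s fc by auto
    ultimately show "map_chain f s \<in> power_gens n A'"
      unfolding power_gens_def by blast
  qed
  note * = induced_map_generate [OF abelian_free_Abelian_group abelian_free_Abelian_group
      power_gens_carrier [OF assms(1)] power_gens_carrier [OF assms(2)] q qs]
  show "power_map n A' f \<in> hom (power_group n A) (power_group n A')"
    unfolding power_map_def power_group_def power_relations_eq map_chain_def [symmetric] using * by blast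
  show "power_map n A' f (power_class n A z) = power_class n A' (map_chain f z)"
    if "Poly_Mapping.keys z \<subseteq> tuples n (carrier A)"
    unfolding power_map_def power_class_def power_relations_eq map_chain_def [symmetric] using *(2) [of z] that by simp
qed

section \<open>Coinvariants\<close>

lemma with_action_simps [simp]:
  "carrier (with_action A act) = carrier A" "x \<otimes>\<^bsub>with_action A act\<^esub> y = x \<otimes>\<^bsub>A\<^esub> y"
  "\<one>\<^bsub>with_action A act\<^esub> = \<one>\<^bsub>A\<^esub>" "gact (with_action A act) = act"
  by (simp_all add: with_action_def)

lemma hom_with_action_simps [simp]:
  "hom (with_action A act) B = hom A B" "hom B (with_action A act) = hom B A"
  by (simp_all add: hom_def)

lemma comm_group_with_action [simp]:
  assumes "comm_group A"
  shows "comm_group (with_action A act)"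
proof -
  interpret comm_group A by fact
  show ?thesis
    by (rule comm_groupI) (auto simp: m_ac intro: exI [of _ "inv\<^bsub>A\<^esub> _"] bexI [of _ "inv\<^bsub>A\<^esub> _"])
qed

text \<open>The structure that is passed through all constructions: an abelian group with one
  endomorphism for each element of \<open>G\<close>. In this form closure under tensor products and
  tensor powers is immediate from functoriality.\<close>

definition gmod :: "('g, 'b) monoid_scheme \<Rightarrow> ('g, 'm) gmodule \<Rightarrow> bool" where
  "gmod G A \<longleftrightarrow> comm_group A \<and> (\<forall>g\<in>carrier G. gact A g \<in> hom A A)"

lemma gmod_comm_group: "gmod G A \<Longrightarrow> comm_group A"
  and gmod_hom: "gmod G A \<Longrightarrow> g \<in> carrier G \<Longrightarrow> gact A g \<in> hom A A"
  and gmod_closed: "gmod G A \<Longrightarrow> g \<in> carrier G \<Longrightarrow> x \<in> carrier A \<Longrightarrow> gact A g x \<in> carrier A"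
  by (auto simp: gmod_def dest: hom_in_carrier)

lemma G_module_imp_gmod: "G_module G A \<Longrightarrow> gmod G A"
  by (simp add: gmod_def G_module_def G_module_axioms_def)

definition equivariant ::
  "('g, 'b) monoid_scheme \<Rightarrow> ('g, 'm) gmodule \<Rightarrow> ('g, 'k) gmodule \<Rightarrow> ('m \<Rightarrow> 'k) \<Rightarrow> bool" where
  "equivariant G A B f \<longleftrightarrow> f \<in> hom A B \<and>
    (\<forall>g\<in>carrier G. \<forall>x\<in>carrier A. f (gact A g x) = gact B g (f x))"

lemma equivariant_hom: "equivariant G A B f \<Longrightarrow> f \<in> hom A B"
  and equivariant_act: "equivariant G A B f \<Longrightarrow> g \<in> carrier G \<Longrightarrow> x \<in> carrier A \<Longrightarrow>
    f (gact A g x) = gact B g (f x)"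
  by (auto simp: equivariant_def)

definition coinv_gens :: "('g, 'b) monoid_scheme \<Rightarrow> ('g, 'm) gmodule \<Rightarrow> 'm set" where
  "coinv_gens G A = {gact A g x \<otimes>\<^bsub>A\<^esub> inv\<^bsub>A\<^esub> x | g x. g \<in> carrier G \<and> x \<in> carrier A}"

lemma coinv_relations_eq: "coinv_relations G A = generate A (coinv_gens G A)"
  by (simp add: coinv_relations_def coinv_gens_def)

definition coinv_class where "coinv_class G A x = coinv_relations G A #>\<^bsub>A\<^esub> x"

context
  fixes G :: "('g, 'b) monoid_scheme" and A :: "('g, 'm) gmodule"
  assumes gA: "gmod G A"
begin

interpretation A: comm_group A by (rule gmod_comm_group [OF gA])

lemma coinv_gens_carrier: "coinv_gens G A \<subseteq> carrier A"
  by (auto simp: coinv_gens_def gmod_closed [OF gA])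

lemma comm_group_coinvariants: "comm_group (coinvariants G A)"
  unfolding coinvariants_def coinv_relations_eq
  by (intro comm_group_Mod_generate coinv_gens_carrier A.comm_group_axioms)

lemma coinv_class_hom: "coinv_class G A \<in> hom A (coinvariants G A)"
  unfolding coinvariants_def coinv_relations_eq coinv_class_def [abs_def]
  by (intro Mod_generate_hom coinv_gens_carrier A.comm_group_axioms)

lemma coinv_class_act: "g \<in> carrier G \<Longrightarrow> x \<in> carrier A \<Longrightarrow> coinv_class G A (gact A g x) = coinv_class G A x"
  unfolding coinv_class_def coinv_relations_eq
  by (rule Mod_generate_eqI [OF A.comm_group_axioms coinv_gens_carrier])
    (auto intro!: generate.incl simp: coinv_gens_def gmod_closed [OF gA])

lemma carrier_coinvariants: "X \<in> carrier (coinvariants G A) \<longleftrightarrow> (\<exists>x\<in>carrier A. X = coinv_class G A x)"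
  by (simp add: coinvariants_def carrier_Mod coinv_class_def)

lemma coinvariants_universal:
  assumes U: "group U" and f: "f \<in> hom A U"
    and inv: "\<And>g x. g \<in> carrier G \<Longrightarrow> x \<in> carrier A \<Longrightarrow> f (gact A g x) = f x"
  obtains h where "h \<in> hom (coinvariants G A) U" "\<And>x. x \<in> carrier A \<Longrightarrow> h (coinv_class G A x) = f x"
proof -
  interpret f: group_hom A U f by (intro group_homI A.is_group U f)
  have kill: "f s = \<one>\<^bsub>U\<^esub>" if "s \<in> coinv_gens G A" for s
    using that by (auto simp: coinv_gens_def inv gmod_closed [OF gA])
  show ?thesis
    by (rule Mod_generate_universal [OF A.comm_group_axioms coinv_gens_carrier U f kill,
          folded coinv_relations_eq, folded coinvariants_def coinv_class_def]) (assumption | rule that)+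
qed

lemma coinvariants_hom_eqI:
  assumes "\<And>x. x \<in> carrier A \<Longrightarrow> f (coinv_class G A x) = h (coinv_class G A x)" "X \<in> carrier (coinvariants G A)"
  shows "f X = h X"
  using assms by (auto simp: carrier_coinvariants)

end

lemma coinv_map_hom:
  assumes gA: "gmod G A" and gB: "gmod G B" and f: "equivariant G A B f"
  shows "coinv_map G B f \<in> hom (coinvariants G A) (coinvariants G B)"
    and "x \<in> carrier A \<Longrightarrow> coinv_map G B f (coinv_class G A x) = coinv_class G B (f x)"
proof -
  have A: "comm_group A" and B: "comm_group B" using gA gB by (auto simp: gmod_def)
  interpret A: comm_group A by (rule A)
  interpret B: comm_group B by (rule B)
  interpret f: group_hom A B f by (intro group_homI A.is_group B.is_group equivariant_hom [OF f])
  have qs: "f s \<in> generate B (coinv_gens G B)" if s: "s \<in> coinv_gens G A" for s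
  proof (rule generate.incl)
    obtain g x where s: "s = gact A g x \<otimes>\<^bsub>A\<^esub> inv\<^bsub>A\<^esub> x" "g \<in> carrier G" "x \<in> carrier A"
      using s by (auto simp: coinv_gens_def)
    then have "f s = gact B g (f x) \<otimes>\<^bsub>B\<^esub> inv\<^bsub>B\<^esub> (f x)"
      by (simp add: gmod_closed [OF gA] equivariant_act [OF f])
    then show "f s \<in> coinv_gens G B"
      unfolding coinv_gens_def using s f.hom_closed [of x] by blast
  qed
  note * = induced_map_generate [OF A B coinv_gens_carrier [OF gA] coinv_gens_carrier [OF gB]
      equivariant_hom [OF f] qs]
  show "coinv_map G B f \<in> hom (coinvariants G A) (coinvariants G B)"
    unfolding coinv_map_def coinvariants_def coinv_relations_eq using *(1) .
  show "coinv_map G B f (coinv_class G A x) = coinv_class G B (f x)" if "x \<in> carrier A"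
    unfolding coinv_map_def coinv_class_def coinv_relations_eq using *(2) [OF _ that] .
qed

section \<open>The functor \<open>H\<^sub>0(G, M \<otimes> -)\<close>\<close>

lemma tensor_simps [simp]:
  "carrier (tensor A B) = carrier (tensor_group A B)"
  "x \<otimes>\<^bsub>tensor A B\<^esub> y = x \<otimes>\<^bsub>tensor_group A B\<^esub> y"
  "hom (tensor A B) U = hom (tensor_group A B) U" "hom U (tensor A B) = hom U (tensor_group A B)"
  "gact (tensor A B) g = tensor_map A B (gact A g) (gact B g)"
  by (simp_all add: tensor_def)

lemma gmod_tensor:
  assumes "gmod G A" "gmod G B"
  shows "gmod G (tensor A B)"
  using assms comm_group_tensor_group [of A B] tensor_map_hom(1) [of A B A B]
  by (auto simp: gmod_def) (simp add: tensor_def)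

lemma tensor_map_equivariant:
  assumes M: "gmod G M" and B: "gmod G B" and B': "gmod G B'" and u: "equivariant G B B' u"
  shows "equivariant G (tensor M B) (tensor M B') (tensor_map M B' (\<lambda>x. x) u)"
  unfolding equivariant_def
proof (intro conjI ballI)
  have cM: "comm_group M" and cB: "comm_group B" and cB': "comm_group B'"
    using M B B' by (auto simp: gmod_def)
  have idM: "(\<lambda>x. x) \<in> hom M M" by (simp add: hom_def)
  have uh: "u \<in> hom B B'" using u by (rule equivariant_hom)
  note ut = tensor_map_hom [OF cM cB cM cB' idM uh]
  show "tensor_map M B' (\<lambda>x. x) u \<in> hom (tensor M B) (tensor M B')" using ut(1) by simp
  fix g x assume g: "g \<in> carrier G" and x: "x \<in> carrier (tensor M B)"
  note gt = tensor_map_hom [OF cM cB cM cB gmod_hom [OF M g] gmod_hom [OF B g]]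
  note gt' = tensor_map_hom [OF cM cB' cM cB' gmod_hom [OF M g] gmod_hom [OF B' g]]
  have "(tensor_map M B' (\<lambda>x. x) u \<circ> tensor_map M B (gact M g) (gact B g)) x =
        (tensor_map M B' (gact M g) (gact B' g) \<circ> tensor_map M B' (\<lambda>x. x) u) x"
  proof (rule tensor_group_hom_eqI [OF cM cB _ hom_compose [OF gt(1) ut(1)] hom_compose [OF ut(1) gt'(1)]])
    show "group (tensor_group M B')" using comm_group_tensor_group [OF cM cB'] by (simp add: comm_group_def)
  qed (use x g in \<open>auto simp: gt(2) ut(2) gt'(2) hom_in_carrier [OF uh] gmod_closed [OF M] gmod_closed [OF B]
          equivariant_act [OF u]\<close>)
  then show "tensor_map M B' (\<lambda>x. x) u (gact (tensor M B) g x) =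
      gact (tensor M B') g (tensor_map M B' (\<lambda>x. x) u x)" by simp
qed

definition coinv_tensor where "coinv_tensor G M B m b = coinv_class G (tensor M B) (tens M B m b)"

context
  fixes G :: "('g, 'b) monoid_scheme" and M :: "('g, 'm) gmodule" and B :: "('g, 'k) gmodule"
  assumes M: "gmod G M" and B: "gmod G B"
begin

interpretation M: comm_group M by (rule gmod_comm_group [OF M])
interpretation B: comm_group B by (rule gmod_comm_group [OF B])

lemmas tMB = gmod_tensor [OF M B]
lemmas cMB = gmod_comm_group [OF M] gmod_comm_group [OF B]

lemma comm_group_T: "comm_group (coinvariants G (tensor M B))"
  by (rule comm_group_coinvariants [OF tMB])

lemma coinv_class_tensor_hom: "coinv_class G (tensor M B) \<in> hom (tensor_group M B) (coinvariants G (tensor M B))"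
  using coinv_class_hom [OF tMB] by simp

lemma coinv_tensor_closed: "m \<in> carrier M \<Longrightarrow> b \<in> carrier B \<Longrightarrow> coinv_tensor G M B m b \<in> carrier (coinvariants G (tensor M B))"
  unfolding coinv_tensor_def by (intro hom_in_carrier [OF coinv_class_tensor_hom] tens_closed cMB)

lemma coinv_tensor_add_left: "m \<in> carrier M \<Longrightarrow> m' \<in> carrier M \<Longrightarrow> b \<in> carrier B \<Longrightarrow>
   coinv_tensor G M B (m \<otimes>\<^bsub>M\<^esub> m') b = coinv_tensor G M B m b \<otimes>\<^bsub>coinvariants G (tensor M B)\<^esub> coinv_tensor G M B m' b"
  unfolding coinv_tensor_def by (simp add: tens_add_left cMB hom_mult [OF coinv_class_tensor_hom] tens_closed)

lemma coinv_tensor_add_right: "m \<in> carrier M \<Longrightarrow> b \<in> carrier B \<Longrightarrow> b' \<in> carrier B \<Longrightarrow>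
   coinv_tensor G M B m (b \<otimes>\<^bsub>B\<^esub> b') = coinv_tensor G M B m b \<otimes>\<^bsub>coinvariants G (tensor M B)\<^esub> coinv_tensor G M B m b'"
  unfolding coinv_tensor_def by (simp add: tens_add_right cMB hom_mult [OF coinv_class_tensor_hom] tens_closed)

lemma coinv_tensor_hom_right: "m \<in> carrier M \<Longrightarrow> coinv_tensor G M B m \<in> hom B (coinvariants G (tensor M B))"
  by (rule homI) (simp_all add: coinv_tensor_closed coinv_tensor_add_right)

lemma coinv_tensor_act: "g \<in> carrier G \<Longrightarrow> m \<in> carrier M \<Longrightarrow> b \<in> carrier B \<Longrightarrow>
   coinv_tensor G M B (gact M g m) (gact B g b) = coinv_tensor G M B m b"
  unfolding coinv_tensor_def
  using coinv_class_act [OF tMB, of g "tens M B m b"]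
  by (simp add: tensor_map_hom(2) cMB gmod_hom [OF M] gmod_hom [OF B] tens_closed)

text \<open>Coinvariants of the diagonal action are a tensor product over the group ring, so they
  classify biadditive maps that do not change when both arguments are moved by the same
  \<open>g\<close>.\<close>

lemma T_universal:
  assumes U: "comm_group U"
    and c: "\<And>m b. m \<in> carrier M \<Longrightarrow> b \<in> carrier B \<Longrightarrow> \<beta> m b \<in> carrier U"
    and l: "\<And>m m' b. m \<in> carrier M \<Longrightarrow> m' \<in> carrier M \<Longrightarrow> b \<in> carrier B \<Longrightarrow>
      \<beta> (m \<otimes>\<^bsub>M\<^esub> m') b = \<beta> m b \<otimes>\<^bsub>U\<^esub> \<beta> m' b"
    and r: "\<And>m b b'. m \<in> carrier M \<Longrightarrow> b \<in> carrier B \<Longrightarrow> b' \<in> carrier B \<Longrightarrow>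
      \<beta> m (b \<otimes>\<^bsub>B\<^esub> b') = \<beta> m b \<otimes>\<^bsub>U\<^esub> \<beta> m b'"
    and inv: "\<And>g m b. g \<in> carrier G \<Longrightarrow> m \<in> carrier M \<Longrightarrow> b \<in> carrier B \<Longrightarrow>
      \<beta> (gact M g m) (gact B g b) = \<beta> m b"
  obtains h where "h \<in> hom (coinvariants G (tensor M B)) U"
    "\<And>m b. m \<in> carrier M \<Longrightarrow> b \<in> carrier B \<Longrightarrow> h (coinv_tensor G M B m b) = \<beta> m b"
proof -
  interpret U: comm_group U by fact
  obtain q where q: "q \<in> hom (tensor_group M B) U"
    "\<And>m b. m \<in> carrier M \<Longrightarrow> b \<in> carrier B \<Longrightarrow> q (tens M B m b) = \<beta> m b"
    by (rule tensor_group_universal [OF cMB U, of \<beta>]) (assumption | rule c l r that)+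
  have qi: "q (gact (tensor M B) g x) = q x" if g: "g \<in> carrier G" and x: "x \<in> carrier (tensor M B)" for g x
  proof -
    note gt = tensor_map_hom [OF cMB cMB gmod_hom [OF M g] gmod_hom [OF B g]]
    have "(q \<circ> tensor_map M B (gact M g) (gact B g)) x = q x"
      by (rule tensor_group_hom_eqI [OF cMB U.is_group hom_compose [OF gt(1) q(1)] q(1)])
        (use x g in \<open>auto simp: gt(2) q(2) gmod_closed [OF M] gmod_closed [OF B] inv\<close>)
    then show ?thesis by simp
  qed
  have "q \<in> hom (tensor M B) U" using q(1) by simp
  then obtain h where h: "h \<in> hom (coinvariants G (tensor M B)) U"
    "\<And>x. x \<in> carrier (tensor M B) \<Longrightarrow> h (coinv_class G (tensor M B) x) = q x"
    by (rule coinvariants_universal [OF tMB U.is_group _ qi]) (assumption | rule that)+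
  show ?thesis
    by (rule that [OF h(1)]) (simp add: coinv_tensor_def h(2) tens_closed cMB q(2))
qed

lemma T_hom_eqI:
  assumes U: "group U" and f: "f \<in> hom (coinvariants G (tensor M B)) U"
    and h: "h \<in> hom (coinvariants G (tensor M B)) U"
    and eq: "\<And>m b. m \<in> carrier M \<Longrightarrow> b \<in> carrier B \<Longrightarrow> f (coinv_tensor G M B m b) = h (coinv_tensor G M B m b)"
    and X: "X \<in> carrier (coinvariants G (tensor M B))"
  shows "f X = h X"
proof (rule coinvariants_hom_eqI [OF tMB _ X])
  fix x assume "x \<in> carrier (tensor M B)"
  then have x: "x \<in> carrier (tensor_group M B)" by simp
  have "(f \<circ> coinv_class G (tensor M B)) x = (h \<circ> coinv_class G (tensor M B)) x"
    by (rule tensor_group_hom_eqI [OF cMB U hom_compose [OF coinv_class_tensor_hom f]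
          hom_compose [OF coinv_class_tensor_hom h] _ x]) (simp add: eq coinv_tensor_def [symmetric])
  then show "f (coinv_class G (tensor M B) x) = h (coinv_class G (tensor M B) x)" by simp
qed

end

text \<open>The functor \<open>H\<^sub>0(G, M \<otimes> -)\<close> on maps. The boundaries of the
  chain complex, \<Theta>, \<open>J\<close> and the transition maps of the limit all have this form,
  so identities between them can be checked on pure tensors by \<open>T_hom_eqI\<close>.\<close>

definition Tmap where
  "Tmap G M B' u = coinv_map G (tensor M B') (tensor_map M B' (\<lambda>x. x) u)"

lemma Tmap_hom:
  assumes M: "gmod G M" and B: "gmod G B" and B': "gmod G B'" and u: "equivariant G B B' u"
  shows "Tmap G M B' u \<in> hom (coinvariants G (tensor M B)) (coinvariants G (tensor M B'))"
    and "m \<in> carrier M \<Longrightarrow> b \<in> carrier B \<Longrightarrow> Tmap G M B' u (coinv_tensor G M B m b) = coinv_tensor G M B' m (u b)"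
proof -
  note * = coinv_map_hom [OF gmod_tensor [OF M B] gmod_tensor [OF M B'] tensor_map_equivariant [OF assms]]
  show "Tmap G M B' u \<in> hom (coinvariants G (tensor M B)) (coinvariants G (tensor M B'))"
    unfolding Tmap_def by (rule *(1))
  have cM: "comm_group M" and cB: "comm_group B" and cB': "comm_group B'"
    using M B B' by (auto simp: gmod_def)
  have idM: "(\<lambda>x. x) \<in> hom M M" by (simp add: hom_def)
  show "Tmap G M B' u (coinv_tensor G M B m b) = coinv_tensor G M B' m (u b)" if "m \<in> carrier M" "b \<in> carrier B"
    unfolding Tmap_def coinv_tensor_def using that *(2) [of "tens M B m b"]
      tensor_map_hom(2) [OF cM cB cM cB' idM equivariant_hom [OF u] that]
    by (simp add: tens_closed [OF cM cB])
qed

section \<open>Tensor powers and the standard resolution as modules\<close>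

lemma tensor_power_simps [simp]:
  "carrier (tensor_power n A) = carrier (power_group n A)"
  "x \<otimes>\<^bsub>tensor_power n A\<^esub> y = x \<otimes>\<^bsub>power_group n A\<^esub> y"
  "hom (tensor_power n A) U = hom (power_group n A) U" "hom U (tensor_power n A) = hom U (power_group n A)"
  "gact (tensor_power n A) g = power_map n A (gact A g)"
  by (simp_all add: tensor_power_def)

lemma gmod_tensor_power: "gmod G A \<Longrightarrow> gmod G (tensor_power n A)"
  using comm_group_power_group [of A n] power_map_hom(1) [of A A]
  by (auto simp: gmod_def) (simp add: tensor_power_def)

lemma power_map_equivariant:
  assumes A: "gmod G A" and B: "gmod G B" and u: "equivariant G A B u"
  shows "equivariant G (tensor_power n A) (tensor_power n B) (power_map n B u)"
  unfolding equivariant_def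
proof (intro conjI ballI)
  have cA: "comm_group A" and cB: "comm_group B" using A B by (auto simp: gmod_def)
  note pm = power_map_hom [OF cA cB equivariant_hom [OF u]]
  show "power_map n B u \<in> hom (tensor_power n A) (tensor_power n B)" using pm(1) by simp
  fix g x assume g: "g \<in> carrier G" and "x \<in> carrier (tensor_power n A)"
  then obtain z where z: "Poly_Mapping.keys z \<subseteq> tuples n (carrier A)" "x = power_class n A z"
    by (auto simp: carrier_power_group [OF cA])
  have "map_chain u (map_chain (gact A g) z) = map_chain (gact B g) (map_chain u z)"
    unfolding map_chain_map_chain unfolding map_chain_def
    using z g by (intro frag_extend_eq)
      (auto simp: tuples_def equivariant_act [OF u] subset_iff intro!: arg_cong [where f=frag_of])
  moreover have "Poly_Mapping.keys (map_chain (gact A g) z) \<subseteq> tuples n (carrier A)"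
    by (rule keys_map_chain [OF z(1)]) (use gmod_closed [OF A g] in auto)
  moreover have "Poly_Mapping.keys (map_chain u z) \<subseteq> tuples n (carrier B)"
    by (rule keys_map_chain [OF z(1)]) (use hom_in_carrier [OF equivariant_hom [OF u]] in auto)
  ultimately show "power_map n B u (gact (tensor_power n A) g x) = gact (tensor_power n B) g (power_map n B u x)"
    by (simp add: z pm(2) power_map_hom(2) [OF cA cA gmod_hom [OF A g]]
      power_map_hom(2) [OF cB cB gmod_hom [OF B g]])
qed

abbreviation translate :: "('g, 'b) monoid_scheme \<Rightarrow> 'g \<Rightarrow> ('g list \<Rightarrow>\<^sub>0 int) \<Rightarrow> ('g list \<Rightarrow>\<^sub>0 int)" where
  "translate G g \<equiv> map_chain (\<lambda>x. g \<otimes>\<^bsub>G\<^esub> x)"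

lemma std_resolution_simps [simp]:
  "z \<in> carrier (std_resolution G k) \<longleftrightarrow> Poly_Mapping.keys z \<subseteq> tuples (Suc k) (carrier G)"
  "x \<otimes>\<^bsub>std_resolution G k\<^esub> y = x + y" "\<one>\<^bsub>std_resolution G k\<^esub> = 0"
  "gact (std_resolution G k) g = translate G g"
  by (simp_all add: std_resolution_def map_chain_def)

lemma comm_group_std_resolution: "comm_group (std_resolution G k)"
  by (simp add: std_resolution_def abelian_free_Abelian_group)

lemma hom_std_resolution:
  "hom (std_resolution G k) U = hom (free_Abelian_group (tuples (Suc k) (carrier G))) U"
  "hom U (std_resolution G k) = hom U (free_Abelian_group (tuples (Suc k) (carrier G)))"
  by (simp_all add: std_resolution_def)

lemma gmod_std_resolution:
  assumes "group G"
  shows "gmod G (std_resolution G k)"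
proof -
  interpret group G by fact
  show ?thesis
    unfolding gmod_def
  proof (intro conjI ballI homI)
    fix g x assume "g \<in> carrier G" "x \<in> carrier (std_resolution G k)"
    then show "gact (std_resolution G k) g x \<in> carrier (std_resolution G k)"
      using keys_map_chain [of x "Suc k" "carrier G" "\<lambda>x. g \<otimes>\<^bsub>G\<^esub> x" "carrier G"] by auto
  qed (simp_all add: comm_group_std_resolution map_chain_linear)
qed

lemma std_boundary_equivariant:
  assumes "group G"
  shows "equivariant G (std_resolution G (Suc k)) (std_resolution G k) (std_boundary (Suc k))"
proof -
  interpret group G by fact
  have g: "Poly_Mapping.keys (translate G g z) \<subseteq> tuples (Suc (Suc k)) (carrier G)"
    if "g \<in> carrier G" "Poly_Mapping.keys z \<subseteq> tuples (Suc (Suc k)) (carrier G)" for g z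
    using that by (intro keys_map_chain) auto
  show ?thesis
    using keys_boundary [where S="carrier G" and k="Suc k"] g
    by (simp add: equivariant_def hom_def Pi_iff std_boundary_eq_boundary [where S="carrier G"] frag_linear map_chain_boundary
        keys_add [THEN order_trans])
qed

section \<open>Iterated cup products of a 2-cocycle\<close>

fun theta_list :: "('g \<Rightarrow> 'g \<Rightarrow> 'g \<Rightarrow> 'k) \<Rightarrow> 'g list \<Rightarrow> 'k list" where
  "theta_list f (a # b # c # r) = f a b c # theta_list f (c # r)"
| "theta_list f _ = []"

text \<open>If \<open>f' = f + \<delta>h\<close> then \<open>f'\<^sup>n - f\<^sup>n = \<delta>(h \<union> f\<^sup>n\<^sup>-\<^sup>1 + f' \<union> h \<union> f\<^sup>n\<^sup>-\<^sup>2 + \<dots>)\<close> for cup powers.\<close>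

fun theta_htpy :: "('g \<Rightarrow> 'g \<Rightarrow> 'g \<Rightarrow> 'k) \<Rightarrow> ('g \<Rightarrow> 'g \<Rightarrow> 'g \<Rightarrow> 'k) \<Rightarrow> ('g \<Rightarrow> 'g \<Rightarrow> 'k) \<Rightarrow> 'g list \<Rightarrow> ('k list \<Rightarrow>\<^sub>0 int)" where
  "theta_htpy f f' h [a, b] = frag_of [h a b]"
| "theta_htpy f f' h (a # b # c # r) = frag_of (h a b # theta_list f (b # c # r)) + prepend (f' a b c) (theta_htpy f f' h (c # r))"
| "theta_htpy f f' h _ = 0"

abbreviation theta where "theta f \<equiv> frag_extend (\<lambda>c. frag_of (theta_list f c))"

section \<open>Calculation modulo the relations of a tensor power\<close>

lemma power_relations_closed:
  assumes K: "comm_group K"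
  shows "0 \<in> power_relations n K"
    and "x \<in> power_relations n K \<Longrightarrow> y \<in> power_relations n K \<Longrightarrow> x + y \<in> power_relations n K"
    and "x \<in> power_relations n K \<Longrightarrow> y \<in> power_relations n K \<Longrightarrow> x - y \<in> power_relations n K"
    and "x \<in> power_relations n K \<Longrightarrow> - x \<in> power_relations n K"
proof -
  interpret S: subgroup "power_relations n K" "free_Abelian_group (tuples n (carrier K))"
    unfolding power_relations_eq
    by (intro group.generate_is_subgroup group_free_Abelian_group power_gens_carrier K)
  show "0 \<in> power_relations n K" using S.one_closed by simp
  show plus: "x \<in> power_relations n K \<Longrightarrow> y \<in> power_relations n K \<Longrightarrow> x + y \<in> power_relations n K" for x y
    using S.m_closed by simp
  show minus: "- x \<in> power_relations n K"
    if x: "x \<in> power_relations n K" for x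
    using S.m_inv_closed [OF x] subsetD [OF S.subset x] by simp
  show "x \<in> power_relations n K \<Longrightarrow> y \<in> power_relations n K \<Longrightarrow> x - y \<in> power_relations n K"
    using plus [of x "- y"] minus by simp
qed

text \<open>Tensoring with a fixed left factor preserves relations. This allows identities between
  cup powers to be proved by recursion on the first factor.\<close>

lemma prepend_power_relations:
  assumes K: "comm_group K" and k: "k \<in> carrier K" and z: "z \<in> power_relations n K"
  shows "prepend k z \<in> power_relations (Suc n) K"
proof -
  let ?F = "free_Abelian_group (tuples n (carrier K))" and ?F' = "free_Abelian_group (tuples (Suc n) (carrier K))"
  have "prepend k \<in> hom ?F ?F'"
    unfolding prepend_def using k by (intro frag_extend_hom) (auto simp: tuples_def)
  then interpret p: group_hom ?F ?F' "prepend k" by (intro group_homI) auto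
  have "prepend k s \<in> power_relations (Suc n) K" if s: "s \<in> power_gens n K" for s
  proof -
    obtain xs a b ys where s: "s = frag_of (xs @ (a \<otimes>\<^bsub>K\<^esub> b) # ys) - frag_of (xs @ a # ys) - frag_of (xs @ b # ys)"
      "a \<in> carrier K" "b \<in> carrier K" "set xs \<subseteq> carrier K" "set ys \<subseteq> carrier K" "length xs + 1 + length ys = n"
      using s by (auto simp: power_gens_def)
    have "prepend k s = frag_of ((k # xs) @ (a \<otimes>\<^bsub>K\<^esub> b) # ys) - frag_of ((k # xs) @ a # ys) - frag_of ((k # xs) @ b # ys)"
      by (simp add: s prepend_linear)
    moreover have "set (k # xs) \<subseteq> carrier K" "length (k # xs) + 1 + length ys = Suc n" using s k by auto
    ultimately have "prepend k s \<in> power_gens (Suc n) K"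
      unfolding power_gens_def using s by blast
    then show ?thesis by (simp add: power_relations_eq generate.incl)
  qed
  then have "generate ?F' (prepend k ` power_gens n K) \<subseteq> power_relations (Suc n) K"
    unfolding power_relations_eq
    by (intro p.H.generate_subgroup_incl p.H.generate_is_subgroup power_gens_carrier K) auto
  then show ?thesis
    using z p.generate_img [OF power_gens_carrier [OF K]] unfolding power_relations_eq by auto
qed

lemma prepend_add_relation:
  assumes K: "comm_group K" and k: "k \<in> carrier K" "l \<in> carrier K"
    and z: "Poly_Mapping.keys z \<subseteq> tuples n (carrier K)"
  shows "prepend (k \<otimes>\<^bsub>K\<^esub> l) z - prepend k z - prepend l z \<in> power_relations (Suc n) K"
  using z
proof (induct z rule: free_Abelian_group_induct [consumes 1, case_names zero diff one])
  case (diff x y)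
  have "prepend (k \<otimes>\<^bsub>K\<^esub> l) (x - y) - prepend k (x - y) - prepend l (x - y) =
    (prepend (k \<otimes>\<^bsub>K\<^esub> l) x - prepend k x - prepend l x) - (prepend (k \<otimes>\<^bsub>K\<^esub> l) y - prepend k y - prepend l y)"
    by (simp add: prepend_linear)
  then show ?case using diff power_relations_closed(3) [OF K] by metis
next
  case (one xs)
  have "frag_of ([] @ (k \<otimes>\<^bsub>K\<^esub> l) # xs) - frag_of ([] @ k # xs) - frag_of ([] @ l # xs) \<in> power_gens (Suc n) K"
    unfolding power_gens_def using k one
    by (intro CollectI exI [of _ "[]"] exI [of _ k] exI [of _ l] exI [of _ xs]) (auto simp: tuples_def)
  then show ?case by (simp add: power_relations_eq generate.incl)
qed (simp add: power_relations_closed(1) [OF K])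

text \<open>The shape in which cocycle identities are applied: two positive terms against two
  negative ones, so that no inverses in \<open>K\<close> occur.\<close>

lemma prepend_relation22:
  assumes K: "comm_group K" and z: "Poly_Mapping.keys z \<subseteq> tuples n (carrier K)"
    and c: "x1 \<in> carrier K" "x2 \<in> carrier K" "x3 \<in> carrier K" "x4 \<in> carrier K"
    and eq: "x1 \<otimes>\<^bsub>K\<^esub> x3 = x2 \<otimes>\<^bsub>K\<^esub> x4"
  shows "prepend x1 z - prepend x2 z + prepend x3 z - prepend x4 z \<in> power_relations (Suc n) K"
proof -
  have "prepend x1 z - prepend x2 z + prepend x3 z - prepend x4 z =
    (prepend (x2 \<otimes>\<^bsub>K\<^esub> x4) z - prepend x2 z - prepend x4 z) - (prepend (x1 \<otimes>\<^bsub>K\<^esub> x3) z - prepend x1 z - prepend x3 z)"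
    by (simp add: eq)
  then show ?thesis
    using prepend_add_relation [OF K c(2,4) z] prepend_add_relation [OF K c(1,3) z] power_relations_closed(3) [OF K]
    by metis
qed

text \<open>An equivariant homogeneous 2-cocycle. The negative terms of the coboundary stand on the
  right of the equation, as \<open>prepend_relation22\<close> expects.\<close>

definition cocycle :: "('g, 'b) monoid_scheme \<Rightarrow> ('g, 'k) gmodule \<Rightarrow> ('g \<Rightarrow> 'g \<Rightarrow> 'g \<Rightarrow> 'k) \<Rightarrow> bool" where
  "cocycle G K f \<longleftrightarrow>
    (\<forall>a\<in>carrier G. \<forall>b\<in>carrier G. \<forall>c\<in>carrier G. f a b c \<in> carrier K) \<and>
    (\<forall>a\<in>carrier G. \<forall>b\<in>carrier G. \<forall>c\<in>carrier G. \<forall>d\<in>carrier G.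
      f b c d \<otimes>\<^bsub>K\<^esub> f a b d = f a c d \<otimes>\<^bsub>K\<^esub> f a b c) \<and>
    (\<forall>g\<in>carrier G. \<forall>a\<in>carrier G. \<forall>b\<in>carrier G. \<forall>c\<in>carrier G.
      f (g \<otimes>\<^bsub>G\<^esub> a) (g \<otimes>\<^bsub>G\<^esub> b) (g \<otimes>\<^bsub>G\<^esub> c) = gact K g (f a b c))"

lemma cocycle_closed: "cocycle G K f \<Longrightarrow> a \<in> carrier G \<Longrightarrow> b \<in> carrier G \<Longrightarrow> c \<in> carrier G \<Longrightarrow> f a b c \<in> carrier K"
  and cocycle_eq: "cocycle G K f \<Longrightarrow> a \<in> carrier G \<Longrightarrow> b \<in> carrier G \<Longrightarrow> c \<in> carrier G \<Longrightarrow> d \<in> carrier G \<Longrightarrow>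
     f b c d \<otimes>\<^bsub>K\<^esub> f a b d = f a c d \<otimes>\<^bsub>K\<^esub> f a b c"
  and cocycle_act: "cocycle G K f \<Longrightarrow> g \<in> carrier G \<Longrightarrow> a \<in> carrier G \<Longrightarrow> b \<in> carrier G \<Longrightarrow> c \<in> carrier G \<Longrightarrow>
     f (g \<otimes>\<^bsub>G\<^esub> a) (g \<otimes>\<^bsub>G\<^esub> b) (g \<otimes>\<^bsub>G\<^esub> c) = gact K g (f a b c)"
  unfolding cocycle_def by blast+

lemma length_theta_list: "length (theta_list f c) = (length c - 1) div 2"
  by (induction f c rule: theta_list.induct) auto

lemma set_theta_list: "cocycle G K f \<Longrightarrow> set c \<subseteq> carrier G \<Longrightarrow> set (theta_list f c) \<subseteq> carrier K"
  by (induction f c rule: theta_list.induct) (auto simp: cocycle_closed)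

lemma theta_list_tuples: "cocycle G K f \<Longrightarrow> c \<in> tuples (Suc (2 * j)) (carrier G) \<Longrightarrow> theta_list f c \<in> tuples j (carrier K)"
  using set_theta_list [of G K f c] length_theta_list [of f c] by (simp add: tuples_def)

lemma keys_theta: "cocycle G K f \<Longrightarrow> Poly_Mapping.keys z \<subseteq> tuples (Suc (2 * j)) (carrier G) \<Longrightarrow>
    Poly_Mapping.keys (theta f z) \<subseteq> tuples j (carrier K)"
  by (erule keys_frag_extend_subset) (simp add: theta_list_tuples)

lemma theta_list_act: "cocycle G K f \<Longrightarrow> g \<in> carrier G \<Longrightarrow> set c \<subseteq> carrier G \<Longrightarrow>
    theta_list f (map (\<lambda>x. g \<otimes>\<^bsub>G\<^esub> x) c) = map (gact K g) (theta_list f c)"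
  by (induction f c rule: theta_list.induct) (auto simp: cocycle_act)

text \<open>Leibniz rule: one part of the boundary is the cocycle identity in the first factor, the
  other is the induction hypothesis under a fixed first factor.\<close>

lemma theta_boundary_list:
  assumes K: "comm_group K" and f: "cocycle G K f"
  shows "c \<in> tuples (2 * j + 2) (carrier G) \<Longrightarrow> theta f (boundary_list c) \<in> power_relations j K"
proof (induction j arbitrary: c)
  case 0
  then obtain a b where "c = [a, b]" by (auto simp: tuples_def length_Suc_conv numeral_2_eq_2)
  \<comment> \<open>Both ends of an edge give the empty tensor, and the two terms cancel.\<close>
  then show ?case by (simp add: frag_linear power_relations_closed(1) [OF K])
next
  case (Suc j)
  then obtain a b x d r where c: "c = a # b # x # d # r" and len: "length r = 2 * j"
    by (auto simp: tuples_def length_Suc_conv numeral_2_eq_2)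
  have G: "a \<in> carrier G" "b \<in> carrier G" "x \<in> carrier G" "d \<in> carrier G" "set r \<subseteq> carrier G"
    using Suc.prems by (auto simp: c tuples_def)
  let ?\<chi> = "\<lambda>k y. frag_of (k # theta_list f y)"
  have "theta f (boundary_list c) = frag_extend (cup2 f ?\<chi>) (boundary_list c)"
  proof (rule frag_extend_eq)
    fix y assume "y \<in> Poly_Mapping.keys (boundary_list c)"
    then have "length y = length r + 3" using keys_boundary_list [of c UNIV] by (auto simp: c tuples_def)
    then obtain p q s t where "y = p # q # s # t"
      by (auto simp: length_Suc_conv numeral_3_eq_3)
    then show "frag_of (theta_list f y) = cup2 f ?\<chi> y" by simp
  qed
  also have "\<dots> = frag_extend (?\<chi> (f a b x)) (boundary_list (x # d # r)) +
     (prepend (f b x d) (frag_of (theta_list f (d # r))) - prepend (f a x d) (frag_of (theta_list f (d # r)))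
      + prepend (f a b d) (frag_of (theta_list f (d # r))) - prepend (f a b x) (frag_of (theta_list f (d # r))))"
    unfolding c cup2_boundary_list by simp
  also have "frag_extend (?\<chi> (f a b x)) (boundary_list (x # d # r)) = prepend (f a b x) (theta f (boundary_list (x # d # r)))"
    by (simp add: prepend_def frag_extend_frag_extend)
  finally have eq: "theta f (boundary_list c) = prepend (f a b x) (theta f (boundary_list (x # d # r))) +
     (prepend (f b x d) (frag_of (theta_list f (d # r))) - prepend (f a x d) (frag_of (theta_list f (d # r)))
      + prepend (f a b d) (frag_of (theta_list f (d # r))) - prepend (f a b x) (frag_of (theta_list f (d # r))))" .
  have "theta f (boundary_list (x # d # r)) \<in> power_relations j K"
    using G len by (intro Suc.IH) (auto simp: tuples_def)
  then have "prepend (f a b x) (theta f (boundary_list (x # d # r))) \<in> power_relations (Suc j) K"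
    using G by (intro prepend_power_relations [OF K] cocycle_closed [OF f])
  \<comment> \<open>The cocycle identity for the vertices a, b, x, d, tensored with the value on the
    back face.\<close>
  moreover have "prepend (f b x d) (frag_of (theta_list f (d # r))) - prepend (f a x d) (frag_of (theta_list f (d # r)))
      + prepend (f a b d) (frag_of (theta_list f (d # r))) - prepend (f a b x) (frag_of (theta_list f (d # r))) \<in> power_relations (Suc j) K"
    using G len theta_list_tuples [OF f, of "d # r" j]
    by (intro prepend_relation22 [OF K] cocycle_closed [OF f] cocycle_eq [OF f]) (auto simp: tuples_def)
  ultimately show ?case
    unfolding eq by (rule power_relations_closed(2) [OF K])
qed

text \<open>The middle clause is \<open>f' = f + \<delta>h\<close> with
  \<open>\<delta>h a b c = h b c - h a c + h a b\<close>, again arranged without inverses.\<close>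

definition cohomotopy where
  "cohomotopy G K f f' h \<longleftrightarrow>
    (\<forall>a\<in>carrier G. \<forall>b\<in>carrier G. h a b \<in> carrier K) \<and>
    (\<forall>a\<in>carrier G. \<forall>b\<in>carrier G. \<forall>c\<in>carrier G.
      f' a b c \<otimes>\<^bsub>K\<^esub> h a c = f a b c \<otimes>\<^bsub>K\<^esub> (h b c \<otimes>\<^bsub>K\<^esub> h a b)) \<and>
    (\<forall>g\<in>carrier G. \<forall>a\<in>carrier G. \<forall>b\<in>carrier G. h (g \<otimes>\<^bsub>G\<^esub> a) (g \<otimes>\<^bsub>G\<^esub> b) = gact K g (h a b))"

lemma cohomotopy_closed: "cohomotopy G K f f' h \<Longrightarrow> a \<in> carrier G \<Longrightarrow> b \<in> carrier G \<Longrightarrow> h a b \<in> carrier K"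
  and cohomotopy_eq: "cohomotopy G K f f' h \<Longrightarrow> a \<in> carrier G \<Longrightarrow> b \<in> carrier G \<Longrightarrow> c \<in> carrier G \<Longrightarrow>
     f' a b c \<otimes>\<^bsub>K\<^esub> h a c = f a b c \<otimes>\<^bsub>K\<^esub> (h b c \<otimes>\<^bsub>K\<^esub> h a b)"
  and cohomotopy_act: "cohomotopy G K f f' h \<Longrightarrow> g \<in> carrier G \<Longrightarrow> a \<in> carrier G \<Longrightarrow> b \<in> carrier G \<Longrightarrow>
     h (g \<otimes>\<^bsub>G\<^esub> a) (g \<otimes>\<^bsub>G\<^esub> b) = gact K g (h a b)"
  unfolding cohomotopy_def by blast+

lemma keys_theta_htpy:
  assumes f: "cocycle G K f" and f': "cocycle G K f'" and h: "cohomotopy G K f f' h"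
  shows "c \<in> tuples (2 * j) (carrier G) \<Longrightarrow> Poly_Mapping.keys (theta_htpy f f' h c) \<subseteq> tuples j (carrier K)"
proof (induction j arbitrary: c)
  case 0
  then show ?case by (simp add: tuples_def)
next
  case (Suc j)
  then obtain a b r where c: "c = a # b # r" and len: "length r = 2 * j"
    and G: "a \<in> carrier G" "b \<in> carrier G" "set r \<subseteq> carrier G"
    by (auto simp: tuples_def length_Suc_conv)
  show ?case
  proof (cases r)
    case Nil
    then show ?thesis using len G by (auto simp: c tuples_def cohomotopy_closed [OF h])
  next
    case (Cons x r')
    have 1: "theta_list f (b # x # r') \<in> tuples j (carrier K)"
      using G len by (intro theta_list_tuples [OF f]) (auto simp: tuples_def Cons)
    have 2: "Poly_Mapping.keys (theta_htpy f f' h (x # r')) \<subseteq> tuples j (carrier K)"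
      using G len by (intro Suc.IH) (auto simp: tuples_def Cons)
    have "Poly_Mapping.keys (prepend (f' a b x) (theta_htpy f f' h (x # r'))) \<subseteq> tuples (Suc j) (carrier K)"
      using G by (intro keys_prepend 2 cocycle_closed [OF f']) (auto simp: Cons)
    moreover have "Poly_Mapping.keys (frag_of (h a b # theta_list f (b # x # r'))) \<subseteq> tuples (Suc j) (carrier K)"
      using 1 cohomotopy_closed [OF h G(1,2)] by (simp add: tuples_def)
    ultimately show ?thesis
      unfolding c Cons theta_htpy.simps by (intro order_trans [OF keys_add] Un_least)
  qed
qed

lemma theta_htpy_act:
  assumes f: "cocycle G K f" and f': "cocycle G K f'" and h: "cohomotopy G K f f' h"
    and g: "g \<in> carrier G"
  shows "c \<in> tuples (2 * j) (carrier G) \<Longrightarrow>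
    theta_htpy f f' h (map (\<lambda>x. g \<otimes>\<^bsub>G\<^esub> x) c) = map_chain (gact K g) (theta_htpy f f' h c)"
proof (induction j arbitrary: c)
  case 0
  then show ?case by (simp add: tuples_def map_chain_linear)
next
  case (Suc j)
  then obtain a b r where c: "c = a # b # r" and len: "length r = 2 * j"
    and G: "a \<in> carrier G" "b \<in> carrier G" "set r \<subseteq> carrier G"
    by (auto simp: tuples_def length_Suc_conv)
  show ?case
  proof (cases r)
    case Nil
    then show ?thesis using G by (simp add: c cohomotopy_act [OF h g])
  next
    case (Cons x r')
    have 1: "theta_htpy f f' h (map (\<lambda>x. g \<otimes>\<^bsub>G\<^esub> x) (x # r')) = map_chain (gact K g) (theta_htpy f f' h (x # r'))"
      using G len by (intro Suc.IH) (auto simp: tuples_def Cons)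
    have 2: "theta_list f (map (\<lambda>x. g \<otimes>\<^bsub>G\<^esub> x) (b # x # r')) = map (gact K g) (theta_list f (b # x # r'))"
      using G len by (intro theta_list_act [OF f g]) (auto simp: Cons)
    show ?thesis
      using 1 2 G by (simp add: c Cons map_chain_linear map_chain_prepend cocycle_act [OF f' g] cohomotopy_act [OF h g]
        del: theta_list.simps)
  qed
qed

text \<open>The homotopy is \<open>l = h \<union> f^(n-1) + f' \<union> l'\<close>, with
  \<open>l'\<close> the homotopy one power lower. As \<open>f\<close> and \<open>f'\<close> are
  cocycles, the Leibniz rule gives \<open>\<delta>l = \<delta>h \<union> f^(n-1) + f' \<union>
  \<delta>l'\<close>. Inserting \<open>\<delta>h = f' - f\<close> and the induction hypothesis for
  \<open>l'\<close>, the mixed terms \<open>f' \<union> f^(n-1)\<close> cancel.\<close>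

lemma theta_htpy_boundary_list:
  assumes K: "comm_group K" and f: "cocycle G K f" and f': "cocycle G K f'" and h: "cohomotopy G K f f' h"
  shows "c \<in> tuples (2 * j + 1) (carrier G) \<Longrightarrow>
    frag_extend (theta_htpy f f' h) (boundary_list c) - frag_of (theta_list f' c) + frag_of (theta_list f c) \<in> power_relations j K"
proof (induction j arbitrary: c)
  case 0
  then obtain a where "c = [a]" by (auto simp: tuples_def length_Suc_conv)
  then show ?case by (simp add: power_relations_closed(1) [OF K])
next
  case (Suc j)
  then obtain a b x r where c: "c = a # b # x # r" and len: "length r = 2 * j"
    by (auto simp: tuples_def length_Suc_conv)
  have G: "a \<in> carrier G" "b \<in> carrier G" "x \<in> carrier G" "set r \<subseteq> carrier G"
    using Suc.prems by (auto simp: c tuples_def)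
  note N = power_relations_closed [OF K]
  interpret comm_group K by (rule K)
  let ?\<chi> = "\<lambda>k y. frag_of (k # theta_list f y)" and ?\<chi>' = "\<lambda>k y. prepend k (theta_htpy f f' h y)"
  let ?t = "frag_of (theta_list f (x # r))" and ?t' = "frag_of (theta_list f' (x # r))"
  have t: "Poly_Mapping.keys ?t \<subseteq> tuples j (carrier K)"
    using G len theta_list_tuples [OF f, of "x # r" j] by (simp add: tuples_def)
  have "frag_extend (theta_htpy f f' h) (boundary_list c) = frag_extend (\<lambda>y. cup1 h ?\<chi> y + cup2 f' ?\<chi>' y) (boundary_list c)"
  proof (rule frag_extend_eq)
    fix y assume "y \<in> Poly_Mapping.keys (boundary_list c)"
    then have "length y = length r + 2" using keys_boundary_list [of c UNIV] by (auto simp: c tuples_def)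
    then obtain p q t where y: "y = p # q # t"
      by (auto simp: length_Suc_conv numeral_2_eq_2)
    then show "theta_htpy f f' h y = cup1 h ?\<chi> y + cup2 f' ?\<chi>' y" by (cases t) simp_all
  qed
  then have 0: "frag_extend (theta_htpy f f' h) (boundary_list c) = frag_extend (cup1 h ?\<chi>) (boundary_list c) + frag_extend (cup2 f' ?\<chi>') (boundary_list c)"
    by (simp add: frag_extend_fun_add)
  have c1: "frag_extend (cup1 h ?\<chi>) (boundary_list c) =
      prepend (h b x) ?t - prepend (h a x) ?t + prepend (h a b) ?t - prepend (h a b) (theta f (boundary_list (b # x # r)))"
    unfolding c cup1_boundary_list by (simp add: prepend_def frag_extend_frag_extend)
  have "theta f (boundary_list (b # x # r)) \<in> power_relations j K"
    using G len by (intro theta_boundary_list [OF K f]) (auto simp: tuples_def)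
  \<comment> \<open>The term of the Leibniz rule in which the coboundary falls on the power of
    \<open>f\<close>.\<close>
  then have n1: "prepend (h a b) (theta f (boundary_list (b # x # r))) \<in> power_relations (Suc j) K"
    using G by (intro prepend_power_relations [OF K] cohomotopy_closed [OF h])
  \<comment> \<open>The summand \<open>f' \<union> l'\<close>: the induction hypothesis under the
    first factor \<open>f' a b x\<close>, plus the cocycle identity of \<open>f'\<close>.\<close>
  have n2: "frag_extend (cup2 f' ?\<chi>') (boundary_list c) - prepend (f' a b x) ?t' + prepend (f' a b x) ?t
      \<in> power_relations (Suc j) K"
  proof (cases r)
    case Nil
    then show ?thesis by (simp add: c frag_linear prepend_linear N(1))
  next
    case (Cons d r')
    let ?l = "theta_htpy f f' h (d # r')"
    have l: "Poly_Mapping.keys ?l \<subseteq> tuples j (carrier K)"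
      using G len Cons by (intro keys_theta_htpy [OF f f' h]) (auto simp: tuples_def)
    have c2: "frag_extend (cup2 f' ?\<chi>') (boundary_list c) =
        prepend (f' a b x) (frag_extend (theta_htpy f f' h) (boundary_list (x # r)))
        + (prepend (f' b x d) ?l - prepend (f' a x d) ?l + prepend (f' a b d) ?l - prepend (f' a b x) ?l)"
      unfolding c Cons cup2_boundary_list by (simp add: prepend_def frag_extend_frag_extend)
    have "frag_extend (theta_htpy f f' h) (boundary_list (x # r)) - ?t' + ?t \<in> power_relations j K"
      using G len by (intro Suc.IH) (auto simp: tuples_def)
    then have "prepend (f' a b x) (frag_extend (theta_htpy f f' h) (boundary_list (x # r)) - ?t' + ?t) \<in> power_relations (Suc j) K"
      using G by (intro prepend_power_relations [OF K] cocycle_closed [OF f'])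
    moreover have "prepend (f' b x d) ?l - prepend (f' a x d) ?l + prepend (f' a b d) ?l - prepend (f' a b x) ?l
        \<in> power_relations (Suc j) K"
      using G Cons by (intro prepend_relation22 [OF K l] cocycle_closed [OF f'] cocycle_eq [OF f']) auto
    ultimately have "prepend (f' a b x) (frag_extend (theta_htpy f f' h) (boundary_list (x # r)) - ?t' + ?t)
        + (prepend (f' b x d) ?l - prepend (f' a x d) ?l + prepend (f' a b d) ?l - prepend (f' a b x) ?l) \<in> power_relations (Suc j) K"
      by (rule N(2))
    then show ?thesis unfolding c2 by (simp add: prepend_linear algebra_simps)
  qed
  have cl: "f a b x \<in> carrier K" "f' a b x \<in> carrier K" "h b x \<in> carrier K" "h a b \<in> carrier K" "h a x \<in> carrier K"
    using G by (auto intro: cocycle_closed [OF f] cocycle_closed [OF f'] cohomotopy_closed [OF h])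
  have "prepend (f' a b x) ?t - prepend (f a b x) ?t + prepend (h a x) ?t - prepend (h b x \<otimes>\<^bsub>K\<^esub> h a b) ?t \<in> power_relations (Suc j) K"
    using cl G by (intro prepend_relation22 [OF K t] cohomotopy_eq [OF h]) auto
  moreover have "prepend (h b x \<otimes>\<^bsub>K\<^esub> h a b) ?t - prepend (h b x) ?t - prepend (h a b) ?t \<in> power_relations (Suc j) K"
    using cl by (intro prepend_add_relation [OF K _ _ t])
  ultimately have "(prepend (f' a b x) ?t - prepend (f a b x) ?t + prepend (h a x) ?t - prepend (h b x \<otimes>\<^bsub>K\<^esub> h a b) ?t)
      + (prepend (h b x \<otimes>\<^bsub>K\<^esub> h a b) ?t - prepend (h b x) ?t - prepend (h a b) ?t) \<in> power_relations (Suc j) K"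
    by (rule N(2))
  \<comment> \<open>The equation \<open>f' = f + \<delta>h\<close> tensored with the remaining
    factors.\<close>
  then have n3: "prepend (f' a b x) ?t - prepend (f a b x) ?t + prepend (h a x) ?t - prepend (h b x) ?t - prepend (h a b) ?t
      \<in> power_relations (Suc j) K"
    by (simp add: algebra_simps)
  have "(frag_extend (cup2 f' ?\<chi>') (boundary_list c) - prepend (f' a b x) ?t' + prepend (f' a b x) ?t)
     - prepend (h a b) (theta f (boundary_list (b # x # r)))
     - (prepend (f' a b x) ?t - prepend (f a b x) ?t + prepend (h a x) ?t - prepend (h b x) ?t - prepend (h a b) ?t)
     \<in> power_relations (Suc j) K"
    by (intro N(3) n1 n2 n3)
  also have "(frag_extend (cup2 f' ?\<chi>') (boundary_list c) - prepend (f' a b x) ?t' + prepend (f' a b x) ?t)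
     - prepend (h a b) (theta f (boundary_list (b # x # r)))
     - (prepend (f' a b x) ?t - prepend (f a b x) ?t + prepend (h a x) ?t - prepend (h b x) ?t - prepend (h a b) ?t)
     = frag_extend (theta_htpy f f' h) (boundary_list c) - frag_of (theta_list f' c) + frag_of (theta_list f c)"
    unfolding 0 c1 by (simp add: c del: boundary_list.simps)
  finally show ?case .
qed

definition Theta where "Theta n K f z = power_class n K (theta f z)"

definition Theta_htpy where "Theta_htpy n K f f' h z = power_class n K (frag_extend (theta_htpy f f' h) z)"

lemma Theta_equivariant:
  assumes K: "gmod G K" and f: "cocycle G K f"
  shows "equivariant G (std_resolution G (2 * n)) (tensor_power n K) (Theta n K f)"
  unfolding equivariant_def
proof (intro conjI ballI)
  have cK: "comm_group K" using K by (rule gmod_comm_group)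
  have "theta f \<in> hom (free_Abelian_group (tuples (Suc (2 * n)) (carrier G))) (free_Abelian_group (tuples n (carrier K)))"
    by (intro frag_extend_hom) (simp add: theta_list_tuples [OF f])
  from hom_compose [OF this power_class_hom [OF cK]]
  show "Theta n K f \<in> hom (std_resolution G (2 * n)) (tensor_power n K)"
    by (simp add: hom_std_resolution Theta_def [abs_def] o_def)
  fix g z assume g: "g \<in> carrier G" and "z \<in> carrier (std_resolution G (2 * n))"
  then have z: "Poly_Mapping.keys z \<subseteq> tuples (Suc (2 * n)) (carrier G)" by simp
  have "theta f (translate G g z) = map_chain (gact K g) (theta f z)"
    unfolding map_chain_def frag_extend_frag_extend
    using z by (intro frag_extend_eq) (auto simp: tuples_def theta_list_act [OF f g] subset_iff)
  then show "Theta n K f (gact (std_resolution G (2 * n)) g z) = gact (tensor_power n K) g (Theta n K f z)"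
    by (simp add: Theta_def power_map_hom(2) [OF cK cK gmod_hom [OF K g]] keys_theta [OF f z])
qed

lemma Theta_htpy_equivariant:
  assumes K: "gmod G K" and f: "cocycle G K f" and f': "cocycle G K f'" and h: "cohomotopy G K f f' h"
  shows "equivariant G (std_resolution G (Suc (2 * n))) (tensor_power (Suc n) K) (Theta_htpy (Suc n) K f f' h)"
  unfolding equivariant_def
proof (intro conjI ballI)
  have cK: "comm_group K" using K by (rule gmod_comm_group)
  have collapse: "Poly_Mapping.keys (theta_htpy f f' h c) \<subseteq> tuples (Suc n) (carrier K)"
    if "c \<in> tuples (Suc (Suc (2 * n))) (carrier G)" for c
    using keys_theta_htpy [OF f f' h, of c "Suc n"] that by simp
  have "frag_extend (theta_htpy f f' h) \<in> hom (free_Abelian_group (tuples (Suc (Suc (2 * n))) (carrier G))) (free_Abelian_group (tuples (Suc n) (carrier K)))"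
    by (intro frag_extend_hom collapse)
  from hom_compose [OF this power_class_hom [OF cK]]
  show "Theta_htpy (Suc n) K f f' h \<in> hom (std_resolution G (Suc (2 * n))) (tensor_power (Suc n) K)"
    by (simp add: hom_std_resolution Theta_htpy_def [abs_def] o_def)
  fix g z assume g: "g \<in> carrier G" and "z \<in> carrier (std_resolution G (Suc (2 * n)))"
  then have z: "Poly_Mapping.keys z \<subseteq> tuples (Suc (Suc (2 * n))) (carrier G)" by simp
  have "frag_extend (theta_htpy f f' h) (translate G g z) = map_chain (gact K g) (frag_extend (theta_htpy f f' h) z)"
    unfolding map_chain_def frag_extend_frag_extend
    using z theta_htpy_act [OF f f' h g, of _ "Suc n"]
    by (intro frag_extend_eq) (auto simp: map_chain_def subset_iff)
  then show "Theta_htpy (Suc n) K f f' h (gact (std_resolution G (Suc (2 * n))) g z) =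
      gact (tensor_power (Suc n) K) g (Theta_htpy (Suc n) K f f' h z)"
    using keys_frag_extend_subset [OF z collapse]
    by (simp add: Theta_htpy_def power_map_hom(2) [OF cK cK gmod_hom [OF K g]])
qed

lemma power_relations_frag_extend:
  assumes K: "comm_group K" and z: "Poly_Mapping.keys z \<subseteq> S" and "\<And>c. c \<in> S \<Longrightarrow> \<phi> c \<in> power_relations n K"
  shows "frag_extend \<phi> z \<in> power_relations n K"
  using z
  by (induct z rule: free_Abelian_group_induct [consumes 1, case_names zero diff one])
    (simp_all add: frag_linear power_relations_closed [OF K] assms(3))

lemma Theta_boundary:
  assumes K: "comm_group K" and f: "cocycle G K f"
    and z: "Poly_Mapping.keys z \<subseteq> tuples (Suc (Suc (2 * n))) (carrier G)"
  shows "Theta n K f (boundary z) = \<one>\<^bsub>power_group n K\<^esub>"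
proof -
  have "theta f (boundary z) \<in> power_relations n K"
    unfolding frag_extend_frag_extend
    by (rule power_relations_frag_extend [OF K z]) (simp add: theta_boundary_list [OF K f])
  moreover have "Poly_Mapping.keys (theta f (boundary z)) \<subseteq> tuples n (carrier K)"
    by (intro keys_theta [OF f] keys_boundary z)
  ultimately have "Theta n K f (boundary z) = power_class n K 0"
    unfolding Theta_def by (intro power_class_eqI [OF K]) auto
  also have "\<dots> = \<one>\<^bsub>power_group n K\<^esub>"
    using hom_one [OF power_class_hom [OF K]] comm_group_power_group [OF K, of n]
    by (simp add: comm_group_def)
  finally show ?thesis .
qed

lemma Theta_cohomotopy:
  assumes K: "comm_group K" and f: "cocycle G K f" and f': "cocycle G K f'" and h: "cohomotopy G K f f' h"
    and z: "Poly_Mapping.keys z \<subseteq> tuples (Suc (Suc (Suc (2 * n)))) (carrier G)"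
  shows "Theta (Suc n) K f' z = Theta (Suc n) K f z \<otimes>\<^bsub>power_group (Suc n) K\<^esub> Theta_htpy (Suc n) K f f' h (boundary z)"
proof -
  let ?l = "frag_extend (theta_htpy f f' h)"
  have k1: "Poly_Mapping.keys (theta f z) \<subseteq> tuples (Suc n) (carrier K)"
    using keys_theta [OF f, of z "Suc n"] z by simp
  have k2: "Poly_Mapping.keys (theta f' z) \<subseteq> tuples (Suc n) (carrier K)"
    using keys_theta [OF f', of z "Suc n"] z by simp
  have k3: "Poly_Mapping.keys (?l (boundary z)) \<subseteq> tuples (Suc n) (carrier K)"
    by (rule keys_frag_extend_subset [OF keys_boundary [OF z]])
      (use keys_theta_htpy [OF f f' h, of _ "Suc n"] in simp)
  note k = k1 k2 k3
  have "frag_extend (\<lambda>c. ?l (boundary_list c) - frag_of (theta_list f' c) + frag_of (theta_list f c)) z \<in> power_relations (Suc n) K"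
    by (rule power_relations_frag_extend [OF K z]) (use theta_htpy_boundary_list [OF K f f' h, of _ "Suc n"] in simp)
  then have "?l (boundary z) - theta f' z + theta f z \<in> power_relations (Suc n) K"
    by (simp add: frag_extend_fun_add frag_extend_fun_diff frag_extend_frag_extend)
  then have "theta f' z - (theta f z + ?l (boundary z)) \<in> power_relations (Suc n) K"
    using power_relations_closed(4) [OF K, of "?l (boundary z) - theta f' z + theta f z"] by (simp add: algebra_simps)
  then have "power_class (Suc n) K (theta f' z) = power_class (Suc n) K (theta f z + ?l (boundary z))"
    by (rule power_class_eqI [OF K k2 order_trans [OF keys_add Un_least [OF k1 k3]]])
  also have "\<dots> = power_class (Suc n) K (theta f z) \<otimes>\<^bsub>power_group (Suc n) K\<^esub> power_class (Suc n) K (?l (boundary z))"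
    using k hom_mult [OF power_class_hom [OF K, of "Suc n"], of "theta f z" "?l (boundary z)"] by simp
  finally show ?thesis by (simp add: Theta_def Theta_htpy_def)
qed

section \<open>The comparison map\<close>

lemma hom_pointwise_mult:
  assumes "comm_group U" "f \<in> hom A U" "h \<in> hom A U"
  shows "(\<lambda>x. f x \<otimes>\<^bsub>U\<^esub> h x) \<in> hom A U"
proof -
  interpret comm_group U by fact
  show ?thesis
    using assms(2,3) by (intro homI) (auto simp: hom_in_carrier hom_mult m_ac)
qed

abbreviation chains where
  "chains G M k \<equiv> coinvariants G (tensor M (std_resolution G k))"

abbreviation chain_boundary where
  "chain_boundary G M k \<equiv> Tmap G M (std_resolution G k) (std_boundary (Suc k))"

abbreviation chain_class where
  "chain_class G M k \<equiv> coinv_tensor G M (std_resolution G k)"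

lemma homology_boundary_eq: "homology_boundary G M k = chain_boundary G M k"
  by (simp add: homology_boundary_def Tmap_def)

text \<open>The exponent n is \<open>Suc m\<close>. Then the dimension 2n is
  \<open>Suc (Suc (2 * m))\<close>, and 2n - 1 is \<open>Suc (2 * m)\<close> without any
  subtraction.\<close>

definition ThetaH where
  "ThetaH m G M K f = Tmap G M (tensor_power (Suc m) K) (Theta (Suc m) K f)"

context
  fixes G :: "('g, 'b) monoid_scheme" and M :: "('g, 'm) gmodule" and m :: nat
  assumes G: "group G" and M: "gmod G M"
begin

abbreviation (input) "TK K \<equiv> coinvariants G (tensor M (tensor_power (Suc m) K))"

lemma comm_group_chains: "comm_group (chains G M k)"
  by (rule comm_group_T [OF M gmod_std_resolution [OF G]])

lemma chain_boundary_hom: "chain_boundary G M k \<in> hom (chains G M (Suc k)) (chains G M k)"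
  by (rule Tmap_hom(1) [OF M gmod_std_resolution [OF G] gmod_std_resolution [OF G] std_boundary_equivariant [OF G]])

lemma chain_boundary_class: "x \<in> carrier M \<Longrightarrow> Poly_Mapping.keys z \<subseteq> tuples (Suc (Suc k)) (carrier G) \<Longrightarrow>
    chain_boundary G M k (chain_class G M (Suc k) x z) = chain_class G M k x (boundary z)"
  using Tmap_hom(2) [OF M gmod_std_resolution [OF G] gmod_std_resolution [OF G] std_boundary_equivariant [OF G], of x z]
  by (simp add: std_boundary_eq_boundary)

lemma chain_class_hom: "x \<in> carrier M \<Longrightarrow> chain_class G M k x \<in> hom (free_Abelian_group (tuples (Suc k) (carrier G))) (chains G M k)"
  using coinv_tensor_hom_right [OF M gmod_std_resolution [OF G], of x k] by (simp add: hom_std_resolution)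

lemma chain_class_closed: "x \<in> carrier M \<Longrightarrow> Poly_Mapping.keys z \<subseteq> tuples (Suc k) (carrier G) \<Longrightarrow>
    chain_class G M k x z \<in> carrier (chains G M k)"
  using hom_in_carrier [OF chain_class_hom] by simp

lemma chain_class_add: "x \<in> carrier M \<Longrightarrow> Poly_Mapping.keys z \<subseteq> tuples (Suc k) (carrier G) \<Longrightarrow>
    Poly_Mapping.keys w \<subseteq> tuples (Suc k) (carrier G) \<Longrightarrow>
    chain_class G M k x (z + w) = chain_class G M k x z \<otimes>\<^bsub>chains G M k\<^esub> chain_class G M k x w"
  using hom_mult [OF chain_class_hom, of x z k w] by simp

lemma chain_class_zero: "x \<in> carrier M \<Longrightarrow> chain_class G M k x 0 = \<one>\<^bsub>chains G M k\<^esub>"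
  using hom_one [OF chain_class_hom] comm_group_chains [of k] by (simp add: comm_group_def)

lemma chain_boundary_boundary:
  assumes y: "y \<in> carrier (chains G M (Suc (Suc k)))"
  shows "chain_boundary G M k (chain_boundary G M (Suc k) y) = \<one>\<^bsub>chains G M k\<^esub>"
proof -
  interpret U: comm_group "chains G M k" by (rule comm_group_chains)
  have "(chain_boundary G M k \<circ> chain_boundary G M (Suc k)) y = (\<lambda>_. \<one>\<^bsub>chains G M k\<^esub>) y"
  proof (rule T_hom_eqI [OF M gmod_std_resolution [OF G] U.is_group
        hom_compose [OF chain_boundary_hom chain_boundary_hom] _ _ y])
    fix x z assume x: "x \<in> carrier M" and "z \<in> carrier (std_resolution G (Suc (Suc k)))"
    then have z: "Poly_Mapping.keys z \<subseteq> tuples (Suc (Suc (Suc k))) (carrier G)" by simp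
    then show "(chain_boundary G M k \<circ> chain_boundary G M (Suc k)) (chain_class G M (Suc (Suc k)) x z) = \<one>\<^bsub>chains G M k\<^esub>"
      using x keys_boundary [OF z] by (simp add: chain_boundary_class chain_class_zero)
  qed (simp add: hom_def)
  then show ?thesis by simp
qed

lemma ThetaH_hom:
  assumes "gmod G K" "cocycle G K f"
  shows "ThetaH m G M K f \<in> hom (chains G M (Suc (Suc (2 * m)))) (TK K)"
    and "x \<in> carrier M \<Longrightarrow> Poly_Mapping.keys z \<subseteq> tuples (Suc (Suc (Suc (2 * m)))) (carrier G) \<Longrightarrow>
      ThetaH m G M K f (coinv_tensor G M (std_resolution G (Suc (Suc (2 * m)))) x z) =
        coinv_tensor G M (tensor_power (Suc m) K) x (Theta (Suc m) K f z)"
  unfolding ThetaH_def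
  using Tmap_hom [OF M gmod_std_resolution [OF G] gmod_tensor_power [OF assms(1)]
      Theta_equivariant [OF assms, of "Suc m"]] by simp_all

text \<open>The cup power is a cocycle, which is what makes \<open>ThetaH\<close> descend to
  homology.\<close>

lemma ThetaH_boundary:
  assumes K: "gmod G K" and f: "cocycle G K f" and y: "y \<in> carrier (chains G M (Suc (Suc (Suc (2 * m)))))"
  shows "ThetaH m G M K f (chain_boundary G M (Suc (Suc (2 * m))) y) = \<one>\<^bsub>TK K\<^esub>"
proof -
  note P = gmod_tensor_power [OF K, of "Suc m"]
  interpret U: comm_group "TK K" by (rule comm_group_T [OF M P])
  have "(ThetaH m G M K f \<circ> chain_boundary G M (Suc (Suc (2 * m)))) y = (\<lambda>_. \<one>\<^bsub>TK K\<^esub>) y"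
  proof (rule T_hom_eqI [OF M gmod_std_resolution [OF G] U.is_group
        hom_compose [OF chain_boundary_hom ThetaH_hom(1) [OF K f]] _ _ y])
    fix x z assume x: "x \<in> carrier M" and "z \<in> carrier (std_resolution G (Suc (Suc (Suc (2 * m)))))"
    then have z: "Poly_Mapping.keys z \<subseteq> tuples (Suc (Suc (Suc (Suc (2 * m))))) (carrier G)" by simp
    have "Theta (Suc m) K f (boundary z) = \<one>\<^bsub>power_group (Suc m) K\<^esub>"
      using Theta_boundary [OF gmod_comm_group [OF K] f, of z "Suc m"] z by simp
    moreover have "coinv_tensor G M (tensor_power (Suc m) K) x \<one>\<^bsub>power_group (Suc m) K\<^esub> = \<one>\<^bsub>TK K\<^esub>"
      using hom_one [OF coinv_tensor_hom_right [OF M P x]] gmod_comm_group [OF P] U.is_group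
      by (simp add: comm_group_def tensor_power_def)
    ultimately show "(ThetaH m G M K f \<circ> chain_boundary G M (Suc (Suc (2 * m)))) (coinv_tensor G M (std_resolution G (Suc (Suc (Suc (2 * m))))) x z)
        = \<one>\<^bsub>TK K\<^esub>"
      using x z keys_boundary [OF z] by (simp add: chain_boundary_class ThetaH_hom(2) [OF K f])
  qed (simp add: hom_def)
  then show ?thesis by simp
qed

text \<open>The difference of the two maps factors through the boundary of coinvariant chains, so it
  vanishes on cycles. This is the independence of \<Theta> from the section.\<close>

lemma ThetaH_cohomotopic:
  assumes K: "gmod G K" and f: "cocycle G K f" and f': "cocycle G K f'" and h: "cohomotopy G K f f' h"
    and y: "y \<in> carrier (chains G M (Suc (Suc (2 * m))))" and cyc: "chain_boundary G M (Suc (2 * m)) y = \<one>\<^bsub>chains G M (Suc (2 * m))\<^esub>"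
  shows "ThetaH m G M K f' y = ThetaH m G M K f y"
proof -
  note P = gmod_tensor_power [OF K, of "Suc m"] and C = gmod_std_resolution [OF G]
  interpret U: comm_group "TK K" by (rule comm_group_T [OF M P])
  let ?L = "Tmap G M (tensor_power (Suc m) K) (Theta_htpy (Suc m) K f f' h)"
  note L = Tmap_hom [OF M C P Theta_htpy_equivariant [OF K f f' h, of m]]
  have L1: "?L \<in> hom (chains G M (Suc (2 * m))) (TK K)" using L(1) .
  have "ThetaH m G M K f' y = (\<lambda>y. ThetaH m G M K f y \<otimes>\<^bsub>TK K\<^esub> (?L \<circ> chain_boundary G M (Suc (2 * m))) y) y"
  proof (rule T_hom_eqI [OF M C U.is_group ThetaH_hom(1) [OF K f']
        hom_pointwise_mult [OF U.comm_group_axioms ThetaH_hom(1) [OF K f] hom_compose [OF chain_boundary_hom L1]] _ y])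
    fix x z assume x: "x \<in> carrier M" and z0: "z \<in> carrier (std_resolution G (Suc (Suc (2 * m))))"
    then have z: "Poly_Mapping.keys z \<subseteq> tuples (Suc (Suc (Suc (2 * m)))) (carrier G)" by simp
    have c: "Theta (Suc m) K f z \<in> carrier (tensor_power (Suc m) K)"
      using hom_in_carrier [OF equivariant_hom [OF Theta_equivariant [OF K f, of "Suc m"]], of z] z by simp
    have b: "boundary z \<in> carrier (std_resolution G (Suc (2 * m)))" using keys_boundary [OF z] by simp
    then have c': "Theta_htpy (Suc m) K f f' h (boundary z) \<in> carrier (tensor_power (Suc m) K)"
      using hom_in_carrier [OF equivariant_hom [OF Theta_htpy_equivariant [OF K f f' h, of m]]] by blast
    have "Theta (Suc m) K f' z = Theta (Suc m) K f z \<otimes>\<^bsub>tensor_power (Suc m) K\<^esub> Theta_htpy (Suc m) K f f' h (boundary z)"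
      using Theta_cohomotopy [OF gmod_comm_group [OF K] f f' h z] by simp
    then show "ThetaH m G M K f' (coinv_tensor G M (std_resolution G (Suc (Suc (2 * m)))) x z) =
       ThetaH m G M K f (coinv_tensor G M (std_resolution G (Suc (Suc (2 * m)))) x z) \<otimes>\<^bsub>TK K\<^esub>
       (?L \<circ> chain_boundary G M (Suc (2 * m))) (coinv_tensor G M (std_resolution G (Suc (Suc (2 * m)))) x z)"
      using x z L(2) [OF x b] coinv_tensor_add_right [OF M P x c c']
      by (simp only: o_apply chain_boundary_class ThetaH_hom(2) [OF K f] ThetaH_hom(2) [OF K f'])
  qed
  moreover have "?L \<one>\<^bsub>chains G M (Suc (2 * m))\<^esub> = \<one>\<^bsub>TK K\<^esub>"
    using hom_one [OF L1] comm_group_chains U.is_group by (simp add: comm_group_def)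
  ultimately show ?thesis
    using cyc hom_in_carrier [OF ThetaH_hom(1) [OF K f] y] by simp
qed

end

section \<open>The concatenation map\<close>

fun concat_list :: "('k \<Rightarrow> ('g list \<Rightarrow>\<^sub>0 int)) \<Rightarrow> 'k list \<Rightarrow> ('g list \<Rightarrow>\<^sub>0 int)" where
  "concat_list D [] = frag_of []"
| "concat_list D (r # rs) = join (D r) (concat_list D rs)"

lemma join_eq_0_left [simp]: "join 0 z = 0" by (simp add: join_linear_left)

lemma keys_concat_list:
  assumes "\<And>r. r \<in> K \<Longrightarrow> Poly_Mapping.keys (D r) \<subseteq> tuples 2 S"
  shows "rs \<in> tuples n K \<Longrightarrow> Poly_Mapping.keys (concat_list D rs) \<subseteq> tuples (2 * n) S"
proof (induction rs arbitrary: n)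
  case (Cons r rs)
  then obtain m where n: "n = Suc m" by (auto simp: tuples_def)
  have "Poly_Mapping.keys (join (D r) (concat_list D rs)) \<subseteq> tuples (2 + 2 * m) S"
    using Cons n by (intro keys_join assms Cons.IH) (auto simp: tuples_def)
  then show ?case by (simp add: n)
qed (auto simp: tuples_def)

lemma boundary_concat_list: "(\<And>r. r \<in> set rs \<Longrightarrow> boundary (D r) = 0) \<Longrightarrow> boundary (concat_list D rs) = 0"
  by (induction rs) (simp_all add: boundary_join)

text \<open>Joins are additive in each factor, so joining factors through the tensor power;
  translation acts on vertices and hence commutes with joins. n chains of edges use 2n vertices, so
  the result has dimension 2n - 1.\<close>

lemma J_exists:
  assumes G: "group G" and K: "gmod G K" and D: "equivariant G K (std_resolution G 1) D"
  obtains J where "equivariant G (tensor_power (Suc m) K) (std_resolution G (Suc (2 * m))) J"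
    "\<And>rs. rs \<in> tuples (Suc m) (carrier K) \<Longrightarrow> J (power_class (Suc m) K (frag_of rs)) = concat_list D rs"
proof -
  have cK: "comm_group K" using K by (rule gmod_comm_group)
  have Dk: "Poly_Mapping.keys (D r) \<subseteq> tuples 2 (carrier G)" if "r \<in> carrier K" for r
    using hom_in_carrier [OF equivariant_hom [OF D] that] by (simp add: numeral_2_eq_2)
  have Dadd: "D (a \<otimes>\<^bsub>K\<^esub> b) = D a + D b" if "a \<in> carrier K" "b \<in> carrier K" for a b
    using hom_mult [OF equivariant_hom [OF D] that] by simp
  have Jadd: "concat_list D (xs @ (a \<otimes>\<^bsub>K\<^esub> b) # ys) = concat_list D (xs @ a # ys) + concat_list D (xs @ b # ys)"
    if "a \<in> carrier K" "b \<in> carrier K" for a b xs ys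
    using that by (induction xs) (simp_all add: Dadd join_linear_left join_linear_right)
  have Jc: "concat_list D rs \<in> carrier (std_resolution G (Suc (2 * m)))" if "rs \<in> tuples (Suc m) (carrier K)" for rs
    using keys_concat_list [of "carrier K" D "carrier G" rs "Suc m"] that Dk by simp
  obtain J where J: "J \<in> hom (power_group (Suc m) K) (std_resolution G (Suc (2 * m)))"
    "\<And>rs. rs \<in> tuples (Suc m) (carrier K) \<Longrightarrow> J (power_class (Suc m) K (frag_of rs)) = concat_list D rs"
  proof (rule power_group_universal [OF cK comm_group_std_resolution, of "Suc m" "concat_list D"])
    show "concat_list D xs \<in> carrier (std_resolution G (Suc (2 * m)))" if "xs \<in> tuples (Suc m) (carrier K)" for xs
      using Jc that .
    show "concat_list D (xs @ (a \<otimes>\<^bsub>K\<^esub> b) # ys) = concat_list D (xs @ a # ys) \<otimes>\<^bsub>std_resolution G (Suc (2 * m))\<^esub> concat_list D (xs @ b # ys)"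
      if "a \<in> carrier K" "b \<in> carrier K" for xs a b ys
      using Jadd that by simp
  qed (rule that)
  have "equivariant G (tensor_power (Suc m) K) (std_resolution G (Suc (2 * m))) J"
    unfolding equivariant_def
  proof (intro conjI ballI)
    show "J \<in> hom (tensor_power (Suc m) K) (std_resolution G (Suc (2 * m)))" using J(1) by simp
    fix g x assume g: "g \<in> carrier G" and "x \<in> carrier (tensor_power (Suc m) K)"
    then have x: "x \<in> carrier (power_group (Suc m) K)" by simp
    note pm = power_map_hom [OF cK cK gmod_hom [OF K g]]
    note gs = gmod_hom [OF gmod_std_resolution [OF G] g]
    have Jg: "concat_list D (map (gact K g) rs) = translate G g (concat_list D rs)" if "set rs \<subseteq> carrier K" for rs
      using that by (induction rs) (simp_all add: map_chain_join equivariant_act [OF D g])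
    have "(J \<circ> power_map (Suc m) K (gact K g)) x = (gact (std_resolution G (Suc (2 * m))) g \<circ> J) x"
    proof (rule power_group_hom_eqI [OF cK _ hom_compose [OF pm(1) J(1)] hom_compose [OF J(1) gs] _ x])
      show "group (std_resolution G (Suc (2 * m)))"
        by (rule comm_group.axioms(2) [OF comm_group_std_resolution])
      fix rs assume rs: "rs \<in> tuples (Suc m) (carrier K)"
      then have "map (gact K g) rs \<in> tuples (Suc m) (carrier K)"
        using gmod_closed [OF K g] by (auto simp: tuples_def)
      then show "(J \<circ> power_map (Suc m) K (gact K g)) (power_class (Suc m) K (frag_of rs)) =
          (gact (std_resolution G (Suc (2 * m))) g \<circ> J) (power_class (Suc m) K (frag_of rs))"
        using rs Jg by (simp add: pm(2) J(2)) (simp add: tuples_def)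
    qed
    then show "J (gact (tensor_power (Suc m) K) g x) = gact (std_resolution G (Suc (2 * m))) g (J x)"
      by simp
  qed
  then show thesis using J(2) by (rule that)
qed

lemma frag_extend_equivariant:
  assumes "\<And>c. c \<in> tuples (Suc k) (carrier G) \<Longrightarrow> Poly_Mapping.keys (\<phi> c) \<subseteq> tuples (Suc l) (carrier G)"
    and "\<And>g c. g \<in> carrier G \<Longrightarrow> c \<in> tuples (Suc k) (carrier G) \<Longrightarrow>
      \<phi> (map (\<lambda>x. g \<otimes>\<^bsub>G\<^esub> x) c) = translate G g (\<phi> c)"
  shows "equivariant G (std_resolution G k) (std_resolution G l) (frag_extend \<phi>)"
  unfolding equivariant_def
proof (intro conjI ballI)
  show "frag_extend \<phi> \<in> hom (std_resolution G k) (std_resolution G l)"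
    unfolding hom_std_resolution by (intro frag_extend_hom assms(1))
  fix g z assume g: "g \<in> carrier G" and z: "z \<in> carrier (std_resolution G k)"
  have "frag_extend \<phi> (translate G g z) = translate G g (frag_extend \<phi> z)"
    unfolding map_chain_def frag_extend_frag_extend
    by (rule frag_extend_eq) (use assms(2) [OF g] z in \<open>auto simp: map_chain_def\<close>)
  then show "frag_extend \<phi> (gact (std_resolution G k) g z) = gact (std_resolution G l) g (frag_extend \<phi> z)"
    by simp
qed

section \<open>Comparison of homology with the coinvariants of the tensor power\<close>

text \<open>What the comparison uses about the relation module of \<open>c\<close>. The clause
  \<open>retr\<close> says that coning an edge from \<open>h\<close> and then applying
  \<open>f\<close> is a left inverse of \<open>D\<close>. Every apex \<open>h\<close> is required
  because the apex moves along the join in \<open>theta_concat_list\<close>.\<close>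

locale retraction_data = group G for G :: "('g, 'b) monoid_scheme" (structure) +
  fixes M :: "('g, 'm) gmodule" and K :: "('g, 'k) gmodule"
    and f :: "'g \<Rightarrow> 'g \<Rightarrow> 'g \<Rightarrow> 'k" and D :: "'k \<Rightarrow> ('g list \<Rightarrow>\<^sub>0 int)" and m :: nat
  assumes M: "gmod G M" and K: "gmod G K" and f: "cocycle G K f"
    and D: "equivariant G K (std_resolution G 1) D"
    and boundary_D: "r \<in> carrier K \<Longrightarrow> boundary (D r) = 0"
    and Df: "a \<in> carrier G \<Longrightarrow> b \<in> carrier G \<Longrightarrow> c \<in> carrier G \<Longrightarrow> D (f a b c) = boundary_list [a, b, c]"
    and retr: "h \<in> carrier G \<Longrightarrow> \<exists>\<phi>\<in>hom (std_resolution G 1) K.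
      (\<forall>x\<in>carrier G. \<forall>y\<in>carrier G. \<phi> (frag_of [x, y]) = f h x y) \<and> (\<forall>r\<in>carrier K. \<phi> (D r) = r)"
begin

lemma cK: "comm_group K" using K by (rule gmod_comm_group)

interpretation K: comm_group K by (rule cK)

abbreviation "Ch k \<equiv> chains G M k"
abbreviation "T n \<equiv> coinvariants G (tensor M (tensor_power n K))"
abbreviation "cc k \<equiv> chain_class G M k"
abbreviation "dd k \<equiv> chain_boundary G M k"

lemmas std_gmod = gmod_std_resolution [OF is_group]
lemmas power_gmod = gmod_tensor_power [OF K]
lemmas comm_group_Ch = comm_group_chains [OF is_group M]
lemmas dd_hom = chain_boundary_hom [OF is_group M]
lemmas dd_cc = chain_boundary_class [OF is_group M]
lemmas cc_hom = chain_class_hom [OF is_group M]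
lemmas cc_closed = chain_class_closed [OF is_group M]
lemmas cc_add = chain_class_add [OF is_group M]
lemmas cc_zero = chain_class_zero [OF is_group M]

lemma D_keys: "r \<in> carrier K \<Longrightarrow> Poly_Mapping.keys (D r) \<subseteq> tuples 2 (carrier G)"
  using hom_in_carrier [OF equivariant_hom [OF D]] by (simp add: numeral_2_eq_2)

text \<open>The first cup factor of a cone over an edge \<open>[x, y]\<close> is
  \<open>f h x y\<close>, which \<open>retr\<close> sums up to the first tensor factor; the rest of
  the simplex is a cone with apex \<open>y\<close>, to which the induction hypothesis
  applies.\<close>

lemma theta_concat_list:
  "h \<in> carrier G \<Longrightarrow> rs \<in> tuples n (carrier K) \<Longrightarrow>
    theta f (prepend h (concat_list D rs)) - frag_of rs \<in> power_relations n K"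
proof (induction rs arbitrary: n h)
  case Nil
  then show ?case by (simp add: power_relations_closed(1) [OF cK])
next
  case (Cons r rs)
  note N = power_relations_closed [OF cK]
  obtain n' where n: "n = Suc n'" using Cons.prems by (auto simp: tuples_def)
  have r: "r \<in> carrier K" and rs: "rs \<in> tuples n' (carrier K)"
    using Cons.prems by (auto simp: tuples_def n)
  let ?z = "frag_of rs" and ?J = "concat_list D rs"
  have z: "Poly_Mapping.keys ?z \<subseteq> tuples n' (carrier K)" using rs by simp
  obtain \<phi> where \<phi>: "\<phi> \<in> hom (std_resolution G 1) K"
    "\<And>x y. x \<in> carrier G \<Longrightarrow> y \<in> carrier G \<Longrightarrow> \<phi> (frag_of [x, y]) = f h x y"
    "\<And>r. r \<in> carrier K \<Longrightarrow> \<phi> (D r) = r"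
    using retr [OF Cons.prems(1)] by blast
  have \<phi>c: "\<phi> d \<in> carrier K" if "Poly_Mapping.keys d \<subseteq> tuples 2 (carrier G)" for d
    using hom_in_carrier [OF \<phi>(1), of d] that by (simp add: numeral_2_eq_2)
  have \<phi>add: "\<phi> (d + e) = \<phi> d \<otimes>\<^bsub>K\<^esub> \<phi> e"
    if "Poly_Mapping.keys d \<subseteq> tuples 2 (carrier G)" "Poly_Mapping.keys e \<subseteq> tuples 2 (carrier G)" for d e
    using hom_mult [OF \<phi>(1), of d e] that by (simp add: numeral_2_eq_2)
  \<comment> \<open>The claim is made for every 1-chain \<open>d\<close>, because an induction over
    edges leaves the cycles \<open>D r\<close>.\<close>
  have "theta f (prepend h (join d ?J)) - prepend (\<phi> d) ?z \<in> power_relations (Suc n') K"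
    if "Poly_Mapping.keys d \<subseteq> tuples 2 (carrier G)" for d
    using that
  proof (induct d rule: free_Abelian_group_induct [consumes 1, case_names zero diff one])
    case zero
    have "\<phi> 0 = \<one>\<^bsub>K\<^esub>"
      using hom_one [OF \<phi>(1)] comm_group_std_resolution [of G 1] by (simp add: comm_group_def)
    \<comment> \<open>A tensor whose first factor is the unit of \<open>K\<close> is minus the
      relation that comes from the unit being its own square.\<close>
    moreover have "prepend \<one>\<^bsub>K\<^esub> ?z = - (prepend (\<one>\<^bsub>K\<^esub> \<otimes>\<^bsub>K\<^esub> \<one>\<^bsub>K\<^esub>) ?z - prepend \<one>\<^bsub>K\<^esub> ?z - prepend \<one>\<^bsub>K\<^esub> ?z)" by simp
    moreover have "\<dots> \<in> power_relations (Suc n') K"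
      by (intro N(4) prepend_add_relation [OF cK _ _ z]) auto
    ultimately show ?case using N(4) by (simp add: join_linear_left del: prepend_of)
  next
    case (diff d e)
    have "Poly_Mapping.keys (d - e) \<subseteq> tuples 2 (carrier G)"
      using diff keys_diff [of d e] by blast
    then have "prepend (\<phi> ((d - e) + e)) ?z - prepend (\<phi> (d - e)) ?z - prepend (\<phi> e) ?z \<in> power_relations (Suc n') K"
      using diff by (simp only: \<phi>add) (intro prepend_add_relation [OF cK _ _ z] \<phi>c)
    then have *: "prepend (\<phi> d) ?z - prepend (\<phi> (d - e)) ?z - prepend (\<phi> e) ?z \<in> power_relations (Suc n') K" by simp
    have "theta f (prepend h (join (d - e) ?J)) - prepend (\<phi> (d - e)) ?z =
      ((theta f (prepend h (join d ?J)) - prepend (\<phi> d) ?z) - (theta f (prepend h (join e ?J)) - prepend (\<phi> e) ?z))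
      + (prepend (\<phi> d) ?z - prepend (\<phi> (d - e)) ?z - prepend (\<phi> e) ?z)"
      by (simp add: join_linear_left prepend_linear frag_linear del: prepend_of)
    moreover have "\<dots> \<in> power_relations (Suc n') K"
      by (intro N(2,3) diff *)
    ultimately show ?case by metis
  next
    case (one p)
    then obtain x y where p: "p = [x, y]" "x \<in> carrier G" "y \<in> carrier G"
      by (auto simp: tuples_def length_Suc_conv numeral_2_eq_2)
    \<comment> \<open>Peeling off the first block leaves a cone with the new apex \<open>y\<close>;
      hence the induction hypothesis for all apexes.\<close>
    have "theta f (prepend h (join (frag_of p) ?J)) = prepend (f h x y) (theta f (prepend y ?J))"
      by (simp add: p join_Cons frag_extend_prepend) (simp add: prepend_def frag_extend_frag_extend)
    moreover have "prepend (f h x y) (theta f (prepend y ?J) - ?z) \<in> power_relations (Suc n') K"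
      using p Cons.IH [OF p(3) rs] Cons.prems by (intro prepend_power_relations [OF cK] cocycle_closed [OF f])
    ultimately show ?case using p by (simp add: \<phi>(2) prepend_linear)
  qed
  from this [OF D_keys [OF r]] show ?case by (simp add: n \<phi>(3) [OF r])
qed

text \<open>This is the map \<open>J\<close>, fixed by choice so that it can be referred to outside
  the proofs about it; its values on pure tensors determine it.\<close>

definition concat_power where
  "concat_power = (SOME J'. equivariant G (tensor_power (Suc m) K) (std_resolution G (Suc (2 * m))) J' \<and>
    (\<forall>rs\<in>tuples (Suc m) (carrier K). J' (power_class (Suc m) K (frag_of rs)) = concat_list D rs))"

lemma concat_power_equivariant: "equivariant G (tensor_power (Suc m) K) (std_resolution G (Suc (2 * m))) concat_power"
  and concat_power_power_class: "rs \<in> tuples (Suc m) (carrier K) \<Longrightarrow> concat_power (power_class (Suc m) K (frag_of rs)) = concat_list D rs"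
proof -
  have "\<exists>J'. equivariant G (tensor_power (Suc m) K) (std_resolution G (Suc (2 * m))) J' \<and>
    (\<forall>rs\<in>tuples (Suc m) (carrier K). J' (power_class (Suc m) K (frag_of rs)) = concat_list D rs)"
    by (rule J_exists [OF is_group K D, of m]) blast
  from someI_ex [OF this, folded concat_power_def]
  show "equivariant G (tensor_power (Suc m) K) (std_resolution G (Suc (2 * m))) concat_power"
    "rs \<in> tuples (Suc m) (carrier K) \<Longrightarrow> concat_power (power_class (Suc m) K (frag_of rs)) = concat_list D rs" by auto
qed

lemma concat_power_hom: "concat_power \<in> hom (power_group (Suc m) K) (free_Abelian_group (tuples (Suc (Suc (2 * m))) (carrier G)))"
  using equivariant_hom [OF concat_power_equivariant] by (simp add: hom_std_resolution)

lemma concat_power_keys: "\<rho> \<in> carrier (power_group (Suc m) K) \<Longrightarrow>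
    Poly_Mapping.keys (concat_power \<rho>) \<subseteq> tuples (Suc (Suc (2 * m))) (carrier G)"
  using hom_in_carrier [OF concat_power_hom] by simp

lemma boundary_hom: "boundary \<in> hom (free_Abelian_group (tuples (Suc k) (carrier G))) (free_Abelian_group (tuples k (carrier G)))"
  using keys_boundary by (intro homI) (simp_all add: frag_linear)

lemma prepend_hom: "h \<in> carrier G \<Longrightarrow>
    prepend h \<in> hom (free_Abelian_group (tuples k (carrier G))) (free_Abelian_group (tuples (Suc k) (carrier G)))"
  using keys_prepend by (intro homI) (simp_all add: prepend_linear)

lemma boundary_concat_power: 
  assumes \<rho>: "\<rho> \<in> carrier (power_group (Suc m) K)"
  shows "boundary (concat_power \<rho>) = 0"
proof -
  have z: "(\<lambda>_. 0) \<in> hom (power_group (Suc m) K) (free_Abelian_group (tuples (Suc (2 * m)) (carrier G)))"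
    by (intro homI) simp_all
  have "(boundary \<circ> concat_power) \<rho> = (\<lambda>_. 0) \<rho>"
  proof (rule power_group_hom_eqI [OF cK group_free_Abelian_group Group.hom_compose [OF concat_power_hom boundary_hom] z _ \<rho>])
    show "(boundary \<circ> concat_power) (power_class (Suc m) K (frag_of rs)) = 0" if "rs \<in> tuples (Suc m) (carrier K)" for rs
      using that boundary_concat_list [of rs D] boundary_D by (auto simp: concat_power_power_class tuples_def)
  qed
  then show ?thesis by simp
qed

lemma Theta_hom: "Theta n K f \<in> hom (free_Abelian_group (tuples (Suc (2 * n)) (carrier G))) (power_group n K)"
  using equivariant_hom [OF Theta_equivariant [OF K f]] by (simp add: hom_std_resolution)

lemma Theta_prepend_concat_power:
  assumes h: "h \<in> carrier G" and \<rho>: "\<rho> \<in> carrier (power_group (Suc m) K)"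
  shows "Theta (Suc m) K f (prepend h (concat_power \<rho>)) = \<rho>"
proof -
  interpret PG: comm_group "power_group (Suc m) K" by (rule comm_group_power_group [OF cK])
  have id: "(\<lambda>x. x) \<in> hom (power_group (Suc m) K) (power_group (Suc m) K)" by (simp add: hom_def)
  note hh = Group.hom_compose [OF concat_power_hom Group.hom_compose [OF prepend_hom [OF h] Theta_hom [of "Suc m", simplified]]]
  have "(Theta (Suc m) K f \<circ> prepend h \<circ> concat_power) \<rho> = (\<lambda>x. x) \<rho>"
  proof (rule power_group_hom_eqI [OF cK PG.is_group hh id _ \<rho>])
    fix rs assume rs: "rs \<in> tuples (Suc m) (carrier K)"
    have k: "Poly_Mapping.keys (prepend h (concat_list D rs)) \<subseteq> tuples (Suc (2 * Suc m)) (carrier G)"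
      using rs D_keys by (intro keys_prepend [OF h] keys_concat_list [of "carrier K"])
    then have "power_class (Suc m) K (theta f (prepend h (concat_list D rs))) = power_class (Suc m) K (frag_of rs)"
      using rs theta_concat_list [OF h rs] by (intro power_class_eqI [OF cK] keys_theta [OF f]) auto
    then show "(Theta (Suc m) K f \<circ> prepend h \<circ> concat_power) (power_class (Suc m) K (frag_of rs)) = power_class (Suc m) K (frag_of rs)"
      using rs by (simp add: concat_power_power_class Theta_def)
  qed
  then show ?thesis by simp
qed

text \<open>By \<open>Df\<close> the derivative turns each value of \<open>f\<close> into the
  boundary of its triangle, so only the tautological cocycle is left.\<close>

lemma concat_power_Theta:
  assumes c: "c \<in> tuples (Suc (Suc (Suc (2 * m)))) (carrier G)"
  shows "concat_power (Theta (Suc m) K f (frag_of c)) = triangle_join c"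
proof -
  have "concat_list D (theta_list f c) = triangle_join c" if "set c \<subseteq> carrier G" for c
    using that by (induction c rule: triangle_join.induct) (simp_all add: Df del: boundary_list.simps)
  moreover have "theta_list f c \<in> tuples (Suc m) (carrier K)" using c by (intro theta_list_tuples [OF f]) simp
  ultimately show ?thesis using c by (simp add: Theta_def concat_power_power_class tuples_def)
qed

abbreviation "k0 \<equiv> Suc (2 * m)"
abbreviation "Bd \<equiv> dd (Suc k0) ` carrier (Ch (Suc (Suc k0)))"
text \<open>Here \<open>k0\<close> is 2n - 1. The inverse of \<Theta> is first built on all of
  \<open>T (Suc m)\<close>, where the cones need not be cycles; its target is therefore chains
  modulo boundaries, which contains the homology.\<close>

abbreviation "Qt \<equiv> Ch (Suc k0) Mod Bd"
abbreviation "ThetaT \<equiv> ThetaH m G M K f"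
abbreviation "JT \<equiv> Tmap G M (std_resolution G k0) concat_power"

lemma comm_group_T': "comm_group (T n)" by (rule comm_group_T [OF M power_gmod])

lemma subgroup_Bd: "subgroup Bd (Ch (Suc k0))"
proof -
  interpret group_hom "Ch (Suc (Suc k0))" "Ch (Suc k0)" "dd (Suc k0)"
    by (intro group_homI dd_hom) (simp_all add: comm_group.axioms comm_group_Ch)
  show ?thesis by (rule img_is_subgroup)
qed

lemma normal_Bd: "Bd \<lhd> Ch (Suc k0)"
  using subgroup_Bd comm_group_Ch by (simp add: comm_group.normal_iff_subgroup)

lemma comm_group_Qt: "comm_group Qt"
  by (rule comm_group.abelian_FactGroup [OF comm_group_Ch subgroup_Bd])

lemmas ThetaT = ThetaH_hom [OF is_group M K f, where m=m]

abbreviation "q y \<equiv> Bd #>\<^bsub>Ch (Suc k0)\<^esub> y"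

lemma q_hom: "(\<lambda>y. q y) \<in> hom (Ch (Suc k0)) Qt"
  by (rule normal.r_coset_hom_Mod [OF normal_Bd])

lemma q_eqI:
  assumes "x \<in> carrier (Ch (Suc k0))" "y \<in> carrier (Ch (Suc k0))" "b \<in> Bd" "x = b \<otimes>\<^bsub>Ch (Suc k0)\<^esub> y"
  shows "q x = q y"
proof -
  interpret comm_group "Ch (Suc k0)" by (rule comm_group_Ch)
  have "x \<in> Bd #>\<^bsub>Ch (Suc k0)\<^esub> y" using assms unfolding r_coset_def by blast
  then show ?thesis using repr_independence [OF _ assms(2) subgroup_Bd] by simp
qed

lemma JT: "JT \<in> hom (T (Suc m)) (Ch k0)"
  "x \<in> carrier M \<Longrightarrow> \<rho> \<in> carrier (power_group (Suc m) K) \<Longrightarrow>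
    JT (coinv_tensor G M (tensor_power (Suc m) K) x \<rho>) = cc k0 x (concat_power \<rho>)"
  using Tmap_hom [OF M power_gmod std_gmod concat_power_equivariant] by simp_all

text \<open>The chain \<open>w\<close> coned first from \<open>a\<close> and then from
  \<open>b\<close> has the difference of the two cones as its boundary, since \<open>w\<close> is a
  cycle.\<close>

lemma prepend_change:
  assumes "x \<in> carrier M" "a \<in> carrier G" "b \<in> carrier G"
    "Poly_Mapping.keys w \<subseteq> tuples (Suc k0) (carrier G)" "boundary w = 0"
  shows "q (cc (Suc k0) x (prepend a w)) = q (cc (Suc k0) x (prepend b w))"
proof (rule q_eqI)
  have k: "Poly_Mapping.keys (prepend a w) \<subseteq> tuples (Suc (Suc k0)) (carrier G)"
    "Poly_Mapping.keys (prepend b w) \<subseteq> tuples (Suc (Suc k0)) (carrier G)"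
    "Poly_Mapping.keys (prepend b (prepend a w)) \<subseteq> tuples (Suc (Suc (Suc k0))) (carrier G)"
    using assms by (simp_all add: keys_prepend)
  show "cc (Suc k0) x (prepend a w) \<in> carrier (Ch (Suc k0))" "cc (Suc k0) x (prepend b w) \<in> carrier (Ch (Suc k0))"
    using assms k by (simp_all add: cc_closed)
  show "dd (Suc k0) (cc (Suc (Suc k0)) x (prepend b (prepend a w))) \<in> Bd"
    using assms k by (intro imageI cc_closed)
  have "prepend a w = boundary (prepend b (prepend a w)) + prepend b w"
    by (simp add: boundary_prepend assms prepend_linear)
  moreover have "cc (Suc k0) x (boundary (prepend b (prepend a w)) + prepend b w) =
      dd (Suc k0) (cc (Suc (Suc k0)) x (prepend b (prepend a w))) \<otimes>\<^bsub>Ch (Suc k0)\<^esub> cc (Suc k0) x (prepend b w)"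
    using assms k keys_boundary [OF k(3)] by (simp only: cc_add dd_cc)
  ultimately show "cc (Suc k0) x (prepend a w) =
      dd (Suc k0) (cc (Suc (Suc k0)) x (prepend b (prepend a w))) \<otimes>\<^bsub>Ch (Suc k0)\<^esub> cc (Suc k0) x (prepend b w)" by simp
qed

text \<open>The candidate inverse of \<Theta>. Translation by \<open>g\<close> moves the apex of the
  cone, so the formula is invariant only modulo boundaries, by
  \<open>prepend_change\<close>.\<close>

lemma S_exists:
  obtains S where "S \<in> hom (T (Suc m)) Qt"
    "\<And>x \<rho>. x \<in> carrier M \<Longrightarrow> \<rho> \<in> carrier (power_group (Suc m) K) \<Longrightarrow>
      S (coinv_tensor G M (tensor_power (Suc m) K) x \<rho>) = q (cc (Suc k0) x (prepend \<one> (concat_power \<rho>)))"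
proof (rule T_universal [OF M power_gmod comm_group_Qt, of "Suc m" "\<lambda>x \<rho>. q (cc (Suc k0) x (prepend \<one> (concat_power \<rho>)))"])
  note k = keys_prepend [OF one_closed concat_power_keys]
  note Jm = hom_mult [OF concat_power_hom]
  have s [simp]: "\<rho> \<in> carrier (tensor_power (Suc m) K) \<longleftrightarrow> \<rho> \<in> carrier (power_group (Suc m) K)" for \<rho> by simp
  note qc = hom_in_carrier [OF q_hom] and qm = hom_mult [OF q_hom]
  show "q (cc (Suc k0) x (prepend \<one> (concat_power \<rho>))) \<in> carrier Qt"
    if "x \<in> carrier M" "\<rho> \<in> carrier (tensor_power (Suc m) K)" for x \<rho>
    using that k by (intro qc cc_closed) auto
  show "q (cc (Suc k0) (x \<otimes>\<^bsub>M\<^esub> x') (prepend \<one> (concat_power \<rho>))) =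
      q (cc (Suc k0) x (prepend \<one> (concat_power \<rho>))) \<otimes>\<^bsub>Qt\<^esub> q (cc (Suc k0) x' (prepend \<one> (concat_power \<rho>)))"
    if "x \<in> carrier M" "x' \<in> carrier M" "\<rho> \<in> carrier (tensor_power (Suc m) K)" for x x' \<rho>
    using that k [of \<rho>] coinv_tensor_add_left [OF M std_gmod, of x x' "prepend \<one> (concat_power \<rho>)" "Suc k0"]
    by (subst qm [symmetric]) (simp_all add: cc_closed)
  show "q (cc (Suc k0) x (prepend \<one> (concat_power (\<rho> \<otimes>\<^bsub>tensor_power (Suc m) K\<^esub> \<sigma>)))) =
      q (cc (Suc k0) x (prepend \<one> (concat_power \<rho>))) \<otimes>\<^bsub>Qt\<^esub> q (cc (Suc k0) x (prepend \<one> (concat_power \<sigma>)))"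
    if "x \<in> carrier M" "\<rho> \<in> carrier (tensor_power (Suc m) K)" "\<sigma> \<in> carrier (tensor_power (Suc m) K)" for x \<rho> \<sigma>
    using that k [of \<rho>] k [of \<sigma>] cc_add [of x "prepend \<one> (concat_power \<rho>)" "Suc k0" "prepend \<one> (concat_power \<sigma>)"]
    by (subst qm [symmetric]) (simp_all add: cc_closed Jm prepend_linear)
  show "q (cc (Suc k0) (gact M g x) (prepend \<one> (concat_power (gact (tensor_power (Suc m) K) g \<rho>)))) =
      q (cc (Suc k0) x (prepend \<one> (concat_power \<rho>)))"
    if g: "g \<in> carrier G" and x: "x \<in> carrier M" and \<rho>: "\<rho> \<in> carrier (tensor_power (Suc m) K)" for g x \<rho>
  proof -
    have k': "Poly_Mapping.keys (prepend (inv g) (concat_power \<rho>)) \<subseteq> tuples (Suc (Suc k0)) (carrier G)"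
      using g \<rho> by (intro keys_prepend concat_power_keys) auto
    \<comment> \<open>Equivariance of \<open>J\<close> pulls \<open>g\<close> out of the cone and
      leaves the apex \<open>inv g\<close>.\<close>
    have "prepend \<one> (concat_power (gact (tensor_power (Suc m) K) g \<rho>)) = translate G g (prepend (inv g) (concat_power \<rho>))"
      using g equivariant_act [OF concat_power_equivariant g \<rho>] by (simp add: map_chain_prepend)
    then have "cc (Suc k0) (gact M g x) (prepend \<one> (concat_power (gact (tensor_power (Suc m) K) g \<rho>))) =
        cc (Suc k0) x (prepend (inv g) (concat_power \<rho>))"
      using coinv_tensor_act [OF M std_gmod g x, of "prepend (inv g) (concat_power \<rho>)" "Suc k0"] k' by simp
    then show ?thesis
      using prepend_change [OF x, of "inv g" \<one> "concat_power \<rho>"] g \<rho> concat_power_keys boundary_concat_power by simp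
  qed
qed (rule that, auto)

lemma q_universal:
  assumes U: "comm_group U" and F: "F \<in> hom (Ch (Suc k0)) U"
    and kill: "\<And>y. y \<in> carrier (Ch (Suc (Suc k0))) \<Longrightarrow> F (dd (Suc k0) y) = \<one>\<^bsub>U\<^esub>"
  obtains F' where "F' \<in> hom Qt U" "\<And>y. y \<in> carrier (Ch (Suc k0)) \<Longrightarrow> F' (q y) = F y"
proof -
  interpret F: group_hom "Ch (Suc k0)" U F
    using comm_group_Ch U by (intro group_homI F) (simp_all add: comm_group_def)
  have "Bd \<subseteq> kernel (Ch (Suc k0)) U F"
    using kill hom_in_carrier [OF dd_hom] by (auto simp: kernel_def)
  from F.FactGroup_universal_kernel [OF normal_Bd this] that show ?thesis by blast
qed

abbreviation "kT \<equiv> Tmap G M (std_resolution G (Suc k0)) (frag_extend collapse)"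

lemma collapse_equivariant: "equivariant G (std_resolution G k) (std_resolution G k) (frag_extend collapse)"
proof (rule frag_extend_equivariant)
  show "Poly_Mapping.keys (collapse c) \<subseteq> tuples (Suc k) (carrier G)" if "c \<in> tuples (Suc k) (carrier G)" for c
    using keys_collapse [of c "carrier G"] that by (simp add: tuples_def)
qed (simp add: map_chain_collapse)

lemma collapse_htpy_equivariant: "equivariant G (std_resolution G k) (std_resolution G (Suc k)) (frag_extend (collapse_htpy (Suc k)))"
proof (rule frag_extend_equivariant)
  show "Poly_Mapping.keys (collapse_htpy (Suc k) c) \<subseteq> tuples (Suc (Suc k)) (carrier G)" if "c \<in> tuples (Suc k) (carrier G)" for c
    using that by (intro keys_collapse_htpy) (auto simp: tuples_def)
  show "collapse_htpy (Suc k) (map (\<lambda>x. g \<otimes> x) c) = translate G g (collapse_htpy (Suc k) c)" if "c \<in> tuples (Suc k) (carrier G)" for g c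
    using that by (intro map_chain_collapse_htpy [symmetric]) (auto simp: tuples_def)
qed

text \<open>The homotopy formula has one term through the boundary of \<open>y\<close>, which
  vanishes, and one that is itself a boundary.\<close>

lemma q_kT:
  assumes y: "y \<in> carrier (Ch (Suc k0))" and cyc: "dd k0 y = \<one>\<^bsub>Ch k0\<^esub>"
  shows "q (kT y) = q y"
proof -
  interpret U: comm_group "Ch (Suc k0)" by (rule comm_group_Ch)
  let ?H = "Tmap G M (std_resolution G (Suc (Suc k0))) (frag_extend (collapse_htpy (Suc (Suc k0))))"
  let ?H' = "Tmap G M (std_resolution G (Suc k0)) (frag_extend (collapse_htpy (Suc k0)))"
  note kT = Tmap_hom [OF M std_gmod std_gmod collapse_equivariant]
  note H = Tmap_hom [OF M std_gmod std_gmod collapse_htpy_equivariant]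
  have id: "(\<lambda>y. y) \<in> hom (Ch (Suc k0)) (Ch (Suc k0))" by (simp add: hom_def)
  have "kT y = (\<lambda>y. (dd (Suc k0) \<circ> ?H) y \<otimes>\<^bsub>Ch (Suc k0)\<^esub> ((?H' \<circ> dd k0) y \<otimes>\<^bsub>Ch (Suc k0)\<^esub> y)) y"
  proof (rule T_hom_eqI [OF M std_gmod U.is_group kT(1) _ _ y])
    show "(\<lambda>y. (dd (Suc k0) \<circ> ?H) y \<otimes>\<^bsub>Ch (Suc k0)\<^esub> ((?H' \<circ> dd k0) y \<otimes>\<^bsub>Ch (Suc k0)\<^esub> y))
        \<in> hom (Ch (Suc k0)) (Ch (Suc k0))"
      by (intro hom_pointwise_mult comm_group_Ch id Group.hom_compose [OF H(1) dd_hom] Group.hom_compose [OF dd_hom H(1)])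
    fix x z assume x: "x \<in> carrier M" and z0: "z \<in> carrier (std_resolution G (Suc k0))"
    then have z: "Poly_Mapping.keys z \<subseteq> tuples (Suc (Suc k0)) (carrier G)" by simp
    let ?h = "frag_extend (collapse_htpy (Suc (Suc k0))) z" and ?h' = "frag_extend (collapse_htpy (Suc k0)) (boundary z)"
    have kh: "Poly_Mapping.keys ?h \<subseteq> tuples (Suc (Suc (Suc k0))) (carrier G)"
      using hom_in_carrier [OF equivariant_hom [OF collapse_htpy_equivariant] z0] by simp
    have kb: "Poly_Mapping.keys (boundary z) \<subseteq> tuples (Suc k0) (carrier G)" by (rule keys_boundary [OF z])
    have kh': "Poly_Mapping.keys ?h' \<subseteq> tuples (Suc (Suc k0)) (carrier G)"
      using hom_in_carrier [OF equivariant_hom [OF collapse_htpy_equivariant], of "boundary z" k0] kb by simp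
    have "frag_extend (\<lambda>c. boundary (collapse_htpy (Suc (Suc k0)) c) + frag_extend (collapse_htpy (Suc k0)) (boundary_list c)) z
        = frag_extend (\<lambda>c. collapse c - frag_of c) z"
      using collapse_htpy_homotopy [of _ "Suc (Suc k0)"] z by (intro frag_extend_eq) (auto simp: tuples_def simp del: collapse_htpy.simps)
    then have e: "frag_extend collapse z = boundary ?h + (?h' + z)"
      by (simp add: frag_extend_fun_add frag_extend_fun_diff frag_extend_frag_extend algebra_simps del: collapse_htpy.simps)
    have "kT (cc (Suc k0) x z) = cc (Suc k0) x (boundary ?h + (?h' + z))"
      using kT(2) [OF x z0] e by simp
    also have "\<dots> = cc (Suc k0) x (boundary ?h) \<otimes>\<^bsub>Ch (Suc k0)\<^esub> (cc (Suc k0) x ?h' \<otimes>\<^bsub>Ch (Suc k0)\<^esub> cc (Suc k0) x z)"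
      by (simp only: cc_add [OF x keys_boundary [OF kh] order_trans [OF keys_add Un_least [OF kh' z]]]
          cc_add [OF x kh' z])
    also have "cc (Suc k0) x (boundary ?h) = dd (Suc k0) (?H (cc (Suc k0) x z))"
      using x kh H(2) [OF x z0] by (simp add: dd_cc del: collapse_htpy.simps)
    also have "cc (Suc k0) x ?h' = ?H' (dd k0 (cc (Suc k0) x z))"
      using x z kb H(2) [OF x, of "boundary z" k0] by (simp add: dd_cc del: collapse_htpy.simps)
    finally show "kT (cc (Suc k0) x z) = (dd (Suc k0) \<circ> ?H) (cc (Suc k0) x z) \<otimes>\<^bsub>Ch (Suc k0)\<^esub>
        ((?H' \<circ> dd k0) (cc (Suc k0) x z) \<otimes>\<^bsub>Ch (Suc k0)\<^esub> cc (Suc k0) x z)" by (simp only: o_apply)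
  qed
  moreover have "?H' \<one>\<^bsub>Ch k0\<^esub> = \<one>\<^bsub>Ch (Suc k0)\<^esub>"
    using hom_one [OF H(1)] comm_group_Ch by (simp add: comm_group_def)
  ultimately have "kT y = dd (Suc k0) (?H y) \<otimes>\<^bsub>Ch (Suc k0)\<^esub> y"
    using y cyc by (simp del: collapse_htpy.simps)
  then show ?thesis
    using y hom_in_carrier [OF H(1) y] hom_in_carrier [OF kT(1) y] by (intro q_eqI) auto
qed

text \<open>On a simplex, \<Theta> followed by \<open>J\<close> is \<open>triangle_join\<close>;
  coned from the first vertex of the simplex this is \<open>collapse\<close>.\<close>

lemma S_ThetaT:
  assumes S: "S \<in> hom (T (Suc m)) Qt"
    "\<And>x \<rho>. x \<in> carrier M \<Longrightarrow> \<rho> \<in> carrier (power_group (Suc m) K) \<Longrightarrow>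
      S (coinv_tensor G M (tensor_power (Suc m) K) x \<rho>) = q (cc (Suc k0) x (prepend \<one> (concat_power \<rho>)))"
    and y: "y \<in> carrier (Ch (Suc k0))"
  shows "S (ThetaT y) = q (kT y)"
proof -
  interpret U: comm_group Qt by (rule comm_group_Qt)
  note kT = Tmap_hom [OF M std_gmod std_gmod collapse_equivariant]
  have "(S \<circ> ThetaT) y = ((\<lambda>y. q y) \<circ> kT) y"
  proof (rule T_hom_eqI [OF M std_gmod U.is_group Group.hom_compose [OF ThetaT(1) S(1)] Group.hom_compose [OF kT(1) q_hom] _ y])
    fix x z assume x: "x \<in> carrier M" and "z \<in> carrier (std_resolution G (Suc k0))"
    then have z: "Poly_Mapping.keys z \<subseteq> tuples (Suc (Suc k0)) (carrier G)" by simp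
    have "(S \<circ> (ThetaT \<circ> cc (Suc k0) x)) z = ((\<lambda>y. q y) \<circ> (kT \<circ> cc (Suc k0) x)) z"
    proof (rule free_Abelian_group_hom_eqI [OF U.is_group
          Group.hom_compose [OF Group.hom_compose [OF cc_hom [OF x] ThetaT(1)] S(1)]
          Group.hom_compose [OF Group.hom_compose [OF cc_hom [OF x] kT(1)] q_hom] _ z])
      fix c assume c: "c \<in> tuples (Suc (Suc k0)) (carrier G)"
      then obtain a c' where ac: "c = a # c'" "a \<in> carrier G" by (cases c) (auto simp: tuples_def)
      have kf: "Poly_Mapping.keys (frag_of c) \<subseteq> tuples (Suc (Suc k0)) (carrier G)" using c by simp
      have Tc: "Theta (Suc m) K f (frag_of c) \<in> carrier (power_group (Suc m) K)"
        using hom_in_carrier [OF Theta_hom [of "Suc m"], of "frag_of c"] c by simp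
      have "S (ThetaT (cc (Suc k0) x (frag_of c))) = q (cc (Suc k0) x (prepend \<one> (concat_power (Theta (Suc m) K f (frag_of c)))))"
        using x Tc S(2) ThetaT(2) [OF x kf] by simp
      \<comment> \<open>The apex 1 is replaced by the first vertex of \<open>c\<close>; this costs
        only a boundary.\<close>
      also have "\<dots> = q (cc (Suc k0) x (prepend a (concat_power (Theta (Suc m) K f (frag_of c)))))"
        using ac Tc x by (intro prepend_change concat_power_keys boundary_concat_power) auto
      also have "prepend a (concat_power (Theta (Suc m) K f (frag_of c))) = collapse c"
        using c concat_power_Theta [OF c] ac by (simp add: tuples_def)
      also have "cc (Suc k0) x (collapse c) = kT (cc (Suc k0) x (frag_of c))"
        using kT(2) [OF x, of "frag_of c" "Suc k0"] c by simp
      finally show "(S \<circ> (ThetaT \<circ> cc (Suc k0) x)) (frag_of c) = ((\<lambda>y. q y) \<circ> (kT \<circ> cc (Suc k0) x)) (frag_of c)"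
        by simp
    qed
    then show "(S \<circ> ThetaT) (cc (Suc k0) x z) = ((\<lambda>y. q y) \<circ> kT) (cc (Suc k0) x z)" by simp
  qed
  then show ?thesis by simp
qed

text \<open>On cycles \<open>S\<close> is a left inverse of \<Theta> modulo boundaries, because
  \<open>collapse\<close> is homotopic to the identity.\<close>

theorem ThetaT_injective:
  assumes y: "y \<in> carrier (Ch (Suc k0))" and cyc: "dd k0 y = \<one>\<^bsub>Ch k0\<^esub>" and 1: "ThetaT y = \<one>\<^bsub>T (Suc m)\<^esub>"
  shows "y \<in> Bd"
proof -
  interpret U: comm_group "Ch (Suc k0)" by (rule comm_group_Ch)
  obtain S where S: "S \<in> hom (T (Suc m)) Qt"
    "\<And>x \<rho>. x \<in> carrier M \<Longrightarrow> \<rho> \<in> carrier (power_group (Suc m) K) \<Longrightarrow>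
      S (coinv_tensor G M (tensor_power (Suc m) K) x \<rho>) = q (cc (Suc k0) x (prepend \<one> (concat_power \<rho>)))"
    by (rule S_exists) blast
  have "S \<one>\<^bsub>T (Suc m)\<^esub> = \<one>\<^bsub>Qt\<^esub>"
    using hom_one [OF S(1)] comm_group_T' comm_group_Qt by (simp add: comm_group_def)
  then have "q y = Bd"
    using S_ThetaT [OF S y] q_kT [OF y cyc] 1 by simp
  then show ?thesis using U.rcos_self [OF y subgroup_Bd] by simp
qed

text \<open>Any representative of \<open>S t\<close> works: \<Theta> sends it to \<open>t\<close>,
  and its boundary is \<open>JT t\<close>.\<close>

theorem ThetaT_surjective:
  assumes t: "t \<in> carrier (T (Suc m))" and Jt: "JT t = \<one>\<^bsub>Ch k0\<^esub>"
  obtains y where "y \<in> carrier (Ch (Suc k0))" "dd k0 y = \<one>\<^bsub>Ch k0\<^esub>" "ThetaT y = t"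
proof -
  obtain S where S: "S \<in> hom (T (Suc m)) Qt"
    "\<And>x \<rho>. x \<in> carrier M \<Longrightarrow> \<rho> \<in> carrier (power_group (Suc m) K) \<Longrightarrow>
      S (coinv_tensor G M (tensor_power (Suc m) K) x \<rho>) = q (cc (Suc k0) x (prepend \<one> (concat_power \<rho>)))"
    by (rule S_exists) blast
  obtain d where d: "d \<in> hom Qt (Ch k0)" "\<And>y. y \<in> carrier (Ch (Suc k0)) \<Longrightarrow> d (q y) = dd k0 y"
    by (rule q_universal [OF comm_group_Ch dd_hom chain_boundary_boundary [OF is_group M]]) blast+
  obtain t' where t': "t' \<in> hom Qt (T (Suc m))" "\<And>y. y \<in> carrier (Ch (Suc k0)) \<Longrightarrow> t' (q y) = ThetaT y"
    by (rule q_universal [OF comm_group_T' ThetaT(1) ThetaH_boundary [OF is_group M K f]]) blast+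
  interpret V: comm_group "T (Suc m)" by (rule comm_group_T')
  interpret U: comm_group "Ch k0" by (rule comm_group_Ch)
  have s [simp]: "\<rho> \<in> carrier (tensor_power (Suc m) K) \<longleftrightarrow> \<rho> \<in> carrier (power_group (Suc m) K)" for \<rho> by simp
  note k = keys_prepend [OF one_closed concat_power_keys]
  \<comment> \<open>The boundary of a cone over the cycle \<open>J \<rho>\<close> is
    \<open>J \<rho>\<close> itself.\<close>
  have "(d \<circ> S) t = JT t"
  proof (rule T_hom_eqI [OF M power_gmod U.is_group Group.hom_compose [OF S(1) d(1)] JT(1) _ t])
    show "(d \<circ> S) (coinv_tensor G M (tensor_power (Suc m) K) x \<rho>) = JT (coinv_tensor G M (tensor_power (Suc m) K) x \<rho>)"
      if "x \<in> carrier M" "\<rho> \<in> carrier (tensor_power (Suc m) K)" for x \<rho>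
      using that k [of \<rho>] by (simp add: S(2) d(2) cc_closed dd_cc JT(2) boundary_prepend boundary_concat_power)
  qed
  moreover have id: "(\<lambda>x. x) \<in> hom (T (Suc m)) (T (Suc m))" by (simp add: hom_def)
  have "(t' \<circ> S) t = (\<lambda>x. x) t"
  proof (rule T_hom_eqI [OF M power_gmod V.is_group Group.hom_compose [OF S(1) t'(1)] id _ t])
    show "(t' \<circ> S) (coinv_tensor G M (tensor_power (Suc m) K) x \<rho>) = coinv_tensor G M (tensor_power (Suc m) K) x \<rho>"
      if "x \<in> carrier M" "\<rho> \<in> carrier (tensor_power (Suc m) K)" for x \<rho>
      using that k [of \<rho>] by (simp add: S(2) t'(2) cc_closed ThetaT(2) Theta_prepend_concat_power)
  qed
  moreover obtain y where "y \<in> carrier (Ch (Suc k0))" "S t = q y"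
    using hom_in_carrier [OF S(1) t] by (auto simp: carrier_Mod)
  ultimately show thesis using that [of y] d(2) t'(2) Jt by simp
qed

end

section \<open>Relation modules\<close>

lemma (in group) inv_cancel_left:
  "x \<in> carrier G \<Longrightarrow> y \<in> carrier G \<Longrightarrow> inv x \<otimes> (x \<otimes> y) = y"
  "x \<in> carrier G \<Longrightarrow> y \<in> carrier G \<Longrightarrow> x \<otimes> (inv x \<otimes> y) = y"
  by (simp_all add: m_assoc [symmetric])

text \<open>The argument called \<open>power_gmod\<close> is a presentation
  \<open>(F, \<pi>)\<close>, and the value is the class of \<open>r\<close> in its relation module.
  The coset may be formed in \<open>F\<close>, since it is the same set as in
  \<open>R\<close>.\<close>

definition relation_class where
  "relation_class G power_gmod r = derived (fst power_gmod) (kernel (fst power_gmod) G (snd power_gmod)) #>\<^bsub>fst power_gmod\<^esub> r"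

text \<open>Relation modules and the cocycles of sections are developed for an arbitrary surjection
  onto \<open>G\<close>; freeness enters with the Fox derivatives.\<close>

locale group_extension = G: group G + F: group F
  for G :: "('g, 'b) monoid_scheme" and F :: "'u monoid" +
  fixes \<pi> :: "'u \<Rightarrow> 'g"
  assumes \<pi>_hom: "\<pi> \<in> hom F G" and \<pi>_surj: "\<pi> ` carrier F = carrier G"
begin

sublocale \<pi>: group_hom F G \<pi>
  by (simp add: group_hom_def group_hom_axioms_def G.group_axioms F.group_axioms \<pi>_hom)

abbreviation "R \<equiv> kernel F G \<pi>"
abbreviation "K \<equiv> relation_module G (F, \<pi>)"
abbreviation "cls \<equiv> relation_class G (F, \<pi>)"

lemma R_normal: "R \<lhd> F" by (rule \<pi>.normal_kernel)
lemma R_subgroup: "subgroup R F" by (rule \<pi>.subgroup_kernel)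
lemma R_subset: "R \<subseteq> carrier F" by (auto simp: kernel_def)

lemma R_iff: "r \<in> R \<longleftrightarrow> r \<in> carrier F \<and> \<pi> r = \<one>\<^bsub>G\<^esub>" by (auto simp: kernel_def)

lemma derived_R_normal: "derived F R \<lhd> F"
  by (rule F.derived_is_normal [OF R_normal])

lemma derived_R_normal': "derived F R \<lhd> F\<lparr>carrier := R\<rparr>"
  by (rule F.derived_subgroup_is_normal [OF R_subgroup])

interpretation RG: group "F\<lparr>carrier := R\<rparr>"
  by (rule F.subgroup_imp_group [OF R_subgroup])

lemma cls_eq: "cls r = derived F R #>\<^bsub>F\<lparr>carrier := R\<rparr>\<^esub> r"
  by (simp add: relation_class_def r_coset_def)

lemma carrier_relation_module: "X \<in> carrier K \<longleftrightarrow> (\<exists>r\<in>R. X = cls r)"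
  by (simp add: relation_module_def relation_group_def carrier_Mod cls_eq)

lemma cls_closed: "r \<in> R \<Longrightarrow> cls r \<in> carrier K"
  using carrier_relation_module by blast

lemma mult_relation_module: "X \<otimes>\<^bsub>K\<^esub> Y = X <#>\<^bsub>F\<lparr>carrier := R\<rparr>\<^esub> Y"
  by (simp add: relation_module_def relation_group_def)

lemma cls_mult:
  assumes "r \<in> R" "s \<in> R"
  shows "cls r \<otimes>\<^bsub>K\<^esub> cls s = cls (r \<otimes>\<^bsub>F\<^esub> s)"
  using normal.rcos_sum [OF derived_R_normal', of r s] assms
  by (simp add: mult_relation_module cls_eq)

lemma cls_mult_eq:
  assumes "r \<in> R" "s \<in> R" "r \<otimes>\<^bsub>F\<^esub> s = t"
  shows "cls r \<otimes>\<^bsub>K\<^esub> cls s = cls t"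
  using assms cls_mult by simp

lemma cls_eqI:
  assumes "r \<in> carrier F" "s \<in> carrier F" "d \<in> derived F R" "r = d \<otimes>\<^bsub>F\<^esub> s"
  shows "cls r = cls s"
proof -
  have "subgroup (derived F R) F" using derived_R_normal by (simp add: normal_def)
  moreover have "r \<in> derived F R #>\<^bsub>F\<^esub> s" using assms by (auto simp: r_coset_def)
  ultimately show ?thesis
    using F.repr_independence [of r "derived F R" s] assms by (simp add: relation_class_def)
qed

lemma comm_group_relation_module: "comm_group K"
proof -
  have grp: "group (F\<lparr>carrier := R\<rparr> Mod derived F R)"
    by (rule normal.factorgroup_is_group [OF derived_R_normal'])
  have "comm_group (relation_group G (F, \<pi>))"
  proof (rule group.group_comm_groupI)
    show "group (relation_group G (F, \<pi>))" using grp by (simp add: relation_group_def)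
    fix X Y assume "X \<in> carrier (relation_group G (F, \<pi>))" "Y \<in> carrier (relation_group G (F, \<pi>))"
    then obtain r s where rs: "r \<in> R" "X = cls r" "s \<in> R" "Y = cls s"
      by (auto simp: relation_group_def carrier_Mod cls_eq)
    have c: "r \<in> carrier F" "s \<in> carrier F" using rs R_subset by auto
    have "r \<otimes>\<^bsub>F\<^esub> s \<otimes>\<^bsub>F\<^esub> inv\<^bsub>F\<^esub> r \<otimes>\<^bsub>F\<^esub> inv\<^bsub>F\<^esub> s \<in> derived F R"
      unfolding derived_def using rs by (intro generate.incl) blast
    moreover have "r \<otimes>\<^bsub>F\<^esub> s = (r \<otimes>\<^bsub>F\<^esub> s \<otimes>\<^bsub>F\<^esub> inv\<^bsub>F\<^esub> r \<otimes>\<^bsub>F\<^esub> inv\<^bsub>F\<^esub> s) \<otimes>\<^bsub>F\<^esub> (s \<otimes>\<^bsub>F\<^esub> r)"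
      using c by (simp add: F.m_assoc F.inv_cancel_left)
    ultimately have "cls (r \<otimes>\<^bsub>F\<^esub> s) = cls (s \<otimes>\<^bsub>F\<^esub> r)"
      using c by (intro cls_eqI) auto
    then have "X \<otimes>\<^bsub>K\<^esub> Y = Y \<otimes>\<^bsub>K\<^esub> X"
      using rs by (simp add: cls_mult)
    then show "X \<otimes>\<^bsub>relation_group G (F, \<pi>)\<^esub> Y = Y \<otimes>\<^bsub>relation_group G (F, \<pi>)\<^esub> X"
      by (simp add: relation_module_def)
  qed
  then show ?thesis by (simp add: relation_module_def)
qed

lemma conj_R: "w \<in> carrier F \<Longrightarrow> r \<in> R \<Longrightarrow> w \<otimes>\<^bsub>F\<^esub> r \<otimes>\<^bsub>F\<^esub> inv\<^bsub>F\<^esub> w \<in> R"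
  by (rule normal.inv_op_closed2 [OF R_normal])

lemma cls_one: "cls \<one>\<^bsub>F\<^esub> = \<one>\<^bsub>K\<^esub>"
  using derived_R_normal F.derived_in_carrier [OF R_subset]
  by (simp add: relation_class_def relation_module_def relation_group_def)

lemma cls_inv: "r \<in> R \<Longrightarrow> inv\<^bsub>K\<^esub> (cls r) = cls (inv\<^bsub>F\<^esub> r)"
proof -
  assume r: "r \<in> R"
  interpret K: comm_group K by (rule comm_group_relation_module)
  have ir: "inv\<^bsub>F\<^esub> r \<in> R" using r by (simp add: R_iff)
  have "cls (inv\<^bsub>F\<^esub> r) \<otimes>\<^bsub>K\<^esub> cls r = \<one>\<^bsub>K\<^esub>"
    using r ir R_subset by (subst cls_mult) (auto simp: cls_one)
  then show ?thesis using r ir by (intro K.inv_equality cls_closed)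
qed

lemma conj_coset:
  assumes w: "w \<in> carrier F" and r: "r \<in> R"
  shows "w <#\<^bsub>F\<^esub> cls r #>\<^bsub>F\<^esub> inv\<^bsub>F\<^esub> w = cls (w \<otimes>\<^bsub>F\<^esub> r \<otimes>\<^bsub>F\<^esub> inv\<^bsub>F\<^esub> w)"
proof -
  interpret N: normal "derived F R" F by (rule derived_R_normal)
  have rc: "r \<in> carrier F" using r R_subset by auto
  have "w <#\<^bsub>F\<^esub> (derived F R #>\<^bsub>F\<^esub> r) = (w <#\<^bsub>F\<^esub> derived F R) #>\<^bsub>F\<^esub> r"
    using F.coset_assoc [OF w rc N.subset] by simp
  also have "\<dots> = (derived F R #>\<^bsub>F\<^esub> w) #>\<^bsub>F\<^esub> r" using N.coset_eq w by simp
  finally show ?thesis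
    using w rc by (simp add: relation_class_def F.coset_mult_assoc N.subset F.m_assoc)
qed

text \<open>Two preimages of \<open>g\<close> differ by an element of \<open>R\<close>, and
  conjugation by elements of \<open>R\<close> is trivial on the abelianisation.\<close>

lemma gact_cls:
  assumes w: "w \<in> carrier F" and r: "r \<in> R" and g: "g = \<pi> w"
  shows "gact K g (cls r) = cls (w \<otimes>\<^bsub>F\<^esub> r \<otimes>\<^bsub>F\<^esub> inv\<^bsub>F\<^esub> w)"
proof -
  have "v <#\<^bsub>F\<^esub> cls r #>\<^bsub>F\<^esub> inv\<^bsub>F\<^esub> v = cls (w \<otimes>\<^bsub>F\<^esub> r \<otimes>\<^bsub>F\<^esub> inv\<^bsub>F\<^esub> w)"
    if v: "v \<in> carrier F" "\<pi> v = g" for v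
  proof -
    interpret K: comm_group K by (rule comm_group_relation_module)
    define u where "u = inv\<^bsub>F\<^esub> w \<otimes>\<^bsub>F\<^esub> v"
    have u: "u \<in> R" using v w g by (simp add: u_def R_iff)
    then have uc: "u \<in> carrier F" using R_subset by auto
    have vu: "v = w \<otimes>\<^bsub>F\<^esub> u" using v w by (simp add: u_def F.inv_cancel_left)
    have rc: "r \<in> carrier F" using r R_subset by auto
    have cu: "w \<otimes>\<^bsub>F\<^esub> u \<otimes>\<^bsub>F\<^esub> inv\<^bsub>F\<^esub> w \<in> R" and cr: "w \<otimes>\<^bsub>F\<^esub> r \<otimes>\<^bsub>F\<^esub> inv\<^bsub>F\<^esub> w \<in> R"
      and cui: "w \<otimes>\<^bsub>F\<^esub> inv\<^bsub>F\<^esub> u \<otimes>\<^bsub>F\<^esub> inv\<^bsub>F\<^esub> w \<in> R"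
      using w u r by (auto intro!: conj_R simp: R_iff)
    \<comment> \<open>The conjugate by \<open>v = w u\<close> is written as a product of three
      elements of \<open>R\<close>; in the commutative group \<open>K\<close> the outer two
      cancel.\<close>
    have "cls (v \<otimes>\<^bsub>F\<^esub> r \<otimes>\<^bsub>F\<^esub> inv\<^bsub>F\<^esub> v) =
      cls ((w \<otimes>\<^bsub>F\<^esub> u \<otimes>\<^bsub>F\<^esub> inv\<^bsub>F\<^esub> w) \<otimes>\<^bsub>F\<^esub> (w \<otimes>\<^bsub>F\<^esub> r \<otimes>\<^bsub>F\<^esub> inv\<^bsub>F\<^esub> w) \<otimes>\<^bsub>F\<^esub> (w \<otimes>\<^bsub>F\<^esub> inv\<^bsub>F\<^esub> u \<otimes>\<^bsub>F\<^esub> inv\<^bsub>F\<^esub> w))"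
      using w uc rc by (simp add: vu F.m_assoc F.inv_cancel_left F.inv_mult_group)
    also have "\<dots> = cls (w \<otimes>\<^bsub>F\<^esub> u \<otimes>\<^bsub>F\<^esub> inv\<^bsub>F\<^esub> w) \<otimes>\<^bsub>K\<^esub> cls (w \<otimes>\<^bsub>F\<^esub> r \<otimes>\<^bsub>F\<^esub> inv\<^bsub>F\<^esub> w)
        \<otimes>\<^bsub>K\<^esub> cls (w \<otimes>\<^bsub>F\<^esub> inv\<^bsub>F\<^esub> u \<otimes>\<^bsub>F\<^esub> inv\<^bsub>F\<^esub> w)"
      using cu cr cui by (simp add: cls_mult subgroup.m_closed [OF R_subgroup])
    also have "\<dots> = cls (w \<otimes>\<^bsub>F\<^esub> r \<otimes>\<^bsub>F\<^esub> inv\<^bsub>F\<^esub> w) \<otimes>\<^bsub>K\<^esub>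
        (cls (w \<otimes>\<^bsub>F\<^esub> u \<otimes>\<^bsub>F\<^esub> inv\<^bsub>F\<^esub> w) \<otimes>\<^bsub>K\<^esub> cls (w \<otimes>\<^bsub>F\<^esub> inv\<^bsub>F\<^esub> u \<otimes>\<^bsub>F\<^esub> inv\<^bsub>F\<^esub> w))"
      using cu cr cui by (simp add: K.m_ac cls_closed)
    also have "cls (w \<otimes>\<^bsub>F\<^esub> u \<otimes>\<^bsub>F\<^esub> inv\<^bsub>F\<^esub> w) \<otimes>\<^bsub>K\<^esub> cls (w \<otimes>\<^bsub>F\<^esub> inv\<^bsub>F\<^esub> u \<otimes>\<^bsub>F\<^esub> inv\<^bsub>F\<^esub> w) = \<one>\<^bsub>K\<^esub>"
    proof -
      have "(w \<otimes>\<^bsub>F\<^esub> u \<otimes>\<^bsub>F\<^esub> inv\<^bsub>F\<^esub> w) \<otimes>\<^bsub>F\<^esub> (w \<otimes>\<^bsub>F\<^esub> inv\<^bsub>F\<^esub> u \<otimes>\<^bsub>F\<^esub> inv\<^bsub>F\<^esub> w) = \<one>\<^bsub>F\<^esub>"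
        using w uc by (simp add: F.m_assoc F.inv_cancel_left)
      from cls_mult_eq [OF cu cui this] show ?thesis by (simp only: cls_one)
    qed
    finally show ?thesis
      using conj_coset [OF v(1) r] cr by (simp add: cls_closed)
  qed
  then have "{v <#\<^bsub>F\<^esub> cls r #>\<^bsub>F\<^esub> inv\<^bsub>F\<^esub> v | v. v \<in> carrier F \<and> \<pi> v = g} =
      {cls (w \<otimes>\<^bsub>F\<^esub> r \<otimes>\<^bsub>F\<^esub> inv\<^bsub>F\<^esub> w)}"
    using w g by blast
  then show ?thesis by (simp add: relation_module_def)
qed

lemma gmod_relation_module: "gmod G K"
  unfolding gmod_def
proof (intro conjI ballI homI)
  show "comm_group K" by (rule comm_group_relation_module)
  fix g assume "g \<in> carrier G"
  then obtain w where w: "w \<in> carrier F" "g = \<pi> w" using \<pi>_surj by blast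
  show "gact K g X \<in> carrier K" if "X \<in> carrier K" for X
    using that w by (auto simp: carrier_relation_module gact_cls intro!: bexI conj_R)
  show "gact K g (X \<otimes>\<^bsub>K\<^esub> Y) = gact K g X \<otimes>\<^bsub>K\<^esub> gact K g Y"
    if "X \<in> carrier K" "Y \<in> carrier K" for X Y
  proof -
    obtain r s where rs: "r \<in> R" "X = cls r" "s \<in> R" "Y = cls s"
      using \<open>X \<in> carrier K\<close> \<open>Y \<in> carrier K\<close> by (auto simp: carrier_relation_module)
    moreover have "r \<in> carrier F" "s \<in> carrier F" using rs R_subset by auto
    moreover have "r \<otimes>\<^bsub>F\<^esub> s \<in> R" using rs by (simp add: subgroup.m_closed [OF R_subgroup])
    moreover have "cls (w \<otimes>\<^bsub>F\<^esub> r \<otimes>\<^bsub>F\<^esub> inv\<^bsub>F\<^esub> w) \<otimes>\<^bsub>K\<^esub> cls (w \<otimes>\<^bsub>F\<^esub> s \<otimes>\<^bsub>F\<^esub> inv\<^bsub>F\<^esub> w)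
        = cls (w \<otimes>\<^bsub>F\<^esub> (r \<otimes>\<^bsub>F\<^esub> s) \<otimes>\<^bsub>F\<^esub> inv\<^bsub>F\<^esub> w)"
      by (rule cls_mult_eq [OF conj_R conj_R])
        (use calculation w in \<open>simp_all add: F.m_assoc F.inv_cancel_left\<close>)
    ultimately show ?thesis
      using w by (simp add: cls_mult gact_cls)
  qed
qed

section \<open>The cocycle of a set-theoretic section\<close>

definition is_section :: "('g \<Rightarrow> 'u) \<Rightarrow> bool" where
  "is_section s \<longleftrightarrow> (\<forall>g\<in>carrier G. s g \<in> carrier F \<and> \<pi> (s g) = g)"

text \<open>The factor set of the extension \<open>F / [R, R]\<close> of \<open>G\<close> by the
  relation module, for the section \<open>s\<close>, in homogeneous form.\<close>

definition sec2 where
  "sec2 s a b c = gact K a (cls (s (inv\<^bsub>G\<^esub> a \<otimes>\<^bsub>G\<^esub> b) \<otimes>\<^bsub>F\<^esub> s (inv\<^bsub>G\<^esub> b \<otimes>\<^bsub>G\<^esub> c) \<otimes>\<^bsub>F\<^esub> inv\<^bsub>F\<^esub> (s (inv\<^bsub>G\<^esub> a \<otimes>\<^bsub>G\<^esub> c))))"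

text \<open>The quotient of two sections, in homogeneous form. It is the 1-cochain whose coboundary
  is the difference of their factor sets.\<close>

definition sec1 where
  "sec1 s s' a b = gact K a (cls (s' (inv\<^bsub>G\<^esub> a \<otimes>\<^bsub>G\<^esub> b) \<otimes>\<^bsub>F\<^esub> inv\<^bsub>F\<^esub> (s (inv\<^bsub>G\<^esub> a \<otimes>\<^bsub>G\<^esub> b))))"

lemma inv_mult_translate:
  assumes "g \<in> carrier G" "a \<in> carrier G" "b \<in> carrier G"
  shows "inv\<^bsub>G\<^esub> (g \<otimes>\<^bsub>G\<^esub> a) \<otimes>\<^bsub>G\<^esub> (g \<otimes>\<^bsub>G\<^esub> b) = inv\<^bsub>G\<^esub> a \<otimes>\<^bsub>G\<^esub> b"
  using assms by (simp add: G.inv_mult_group G.m_assoc G.inv_cancel_left)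

lemma inv_mult_chain:
  assumes "a \<in> carrier G" "b \<in> carrier G" "c \<in> carrier G"
  shows "inv\<^bsub>G\<^esub> a \<otimes>\<^bsub>G\<^esub> b \<otimes>\<^bsub>G\<^esub> (inv\<^bsub>G\<^esub> b \<otimes>\<^bsub>G\<^esub> c) = inv\<^bsub>G\<^esub> a \<otimes>\<^bsub>G\<^esub> c"
  using assms by (simp add: G.m_assoc G.inv_cancel_left)

lemma gact_mult_cls:
  assumes "g \<in> carrier G" "a \<in> carrier G" "X \<in> carrier K"
  shows "gact K (g \<otimes>\<^bsub>G\<^esub> a) X = gact K g (gact K a X)"
proof -
  obtain v w r where vwr: "v \<in> carrier F" "g = \<pi> v" "w \<in> carrier F" "a = \<pi> w" "r \<in> R" "X = cls r"
    using assms \<pi>_surj by (metis carrier_relation_module imageE)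
  then have "r \<in> carrier F" using R_subset by auto
  then have "v \<otimes>\<^bsub>F\<^esub> w \<otimes>\<^bsub>F\<^esub> r \<otimes>\<^bsub>F\<^esub> inv\<^bsub>F\<^esub> (v \<otimes>\<^bsub>F\<^esub> w) = v \<otimes>\<^bsub>F\<^esub> (w \<otimes>\<^bsub>F\<^esub> r \<otimes>\<^bsub>F\<^esub> inv\<^bsub>F\<^esub> w) \<otimes>\<^bsub>F\<^esub> inv\<^bsub>F\<^esub> v"
    using vwr by (simp add: F.m_assoc F.inv_mult_group)
  then show ?thesis
    using vwr gact_cls [of "v \<otimes>\<^bsub>F\<^esub> w" r "g \<otimes>\<^bsub>G\<^esub> a"] gact_cls [of w r a]
      gact_cls [OF vwr(1) conj_R [OF vwr(3,5)] vwr(2)]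
    by simp
qed

lemma sec2_R:
  assumes "is_section s" "a \<in> carrier G" "b \<in> carrier G" "c \<in> carrier G"
  shows "s (inv\<^bsub>G\<^esub> a \<otimes>\<^bsub>G\<^esub> b) \<otimes>\<^bsub>F\<^esub> s (inv\<^bsub>G\<^esub> b \<otimes>\<^bsub>G\<^esub> c) \<otimes>\<^bsub>F\<^esub> inv\<^bsub>F\<^esub> (s (inv\<^bsub>G\<^esub> a \<otimes>\<^bsub>G\<^esub> c)) \<in> R"
  using assms by (simp add: R_iff is_section_def inv_mult_chain)

lemma sec1_R:
  assumes "is_section s" "is_section s'" "g \<in> carrier G"
  shows "s' g \<otimes>\<^bsub>F\<^esub> inv\<^bsub>F\<^esub> (s g) \<in> R"
  using assms by (simp add: R_iff is_section_def)

lemma sec2_cocycle: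
  assumes s: "is_section s"
  shows "cocycle G K (sec2 s)"
  unfolding cocycle_def
proof (intro conjI ballI)
  have sc: "s g \<in> carrier F" "\<pi> (s g) = g" if "g \<in> carrier G" for g
    using s that by (auto simp: is_section_def)
  show "sec2 s a b c \<in> carrier K" if "a \<in> carrier G" "b \<in> carrier G" "c \<in> carrier G" for a b c
    unfolding sec2_def using that
    by (intro gmod_closed [OF gmod_relation_module] cls_closed sec2_R [OF s])
  show "sec2 s (g \<otimes>\<^bsub>G\<^esub> a) (g \<otimes>\<^bsub>G\<^esub> b) (g \<otimes>\<^bsub>G\<^esub> c) = gact K g (sec2 s a b c)"
    if "g \<in> carrier G" "a \<in> carrier G" "b \<in> carrier G" "c \<in> carrier G" for g a b c
    using that by (simp add: sec2_def inv_mult_translate gact_mult_cls cls_closed sec2_R [OF s])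
  fix a b c d assume G: "a \<in> carrier G" "b \<in> carrier G" "c \<in> carrier G" "d \<in> carrier G"
  interpret K: comm_group K by (rule comm_group_relation_module)
  define A where "A = s a"
  define u v w uv vw uvw where "u = s (inv\<^bsub>G\<^esub> a \<otimes>\<^bsub>G\<^esub> b)" and "v = s (inv\<^bsub>G\<^esub> b \<otimes>\<^bsub>G\<^esub> c)" and "w = s (inv\<^bsub>G\<^esub> c \<otimes>\<^bsub>G\<^esub> d)"
    and "uv = s (inv\<^bsub>G\<^esub> a \<otimes>\<^bsub>G\<^esub> c)" and "vw = s (inv\<^bsub>G\<^esub> b \<otimes>\<^bsub>G\<^esub> d)" and "uvw = s (inv\<^bsub>G\<^esub> a \<otimes>\<^bsub>G\<^esub> d)"
  note defs = this
  have cF: "A \<in> carrier F" "u \<in> carrier F" "v \<in> carrier F" "w \<in> carrier F" "uv \<in> carrier F" "vw \<in> carrier F" "uvw \<in> carrier F"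
    using G by (auto simp: defs A_def sc)
  \<comment> \<open>Any lift computes the action, so \<open>A u\<close> is taken as the lift of
    \<open>b\<close> in place of \<open>s b\<close>. With this choice both sides of the cocycle
    identity telescope to the class of \<open>A u v w uvw^-1 A^-1\<close>.\<close>
  have p: "\<pi> A = a" "\<pi> (A \<otimes>\<^bsub>F\<^esub> u) = b"
    using G cF by (auto simp: A_def defs sc G.inv_cancel_left)
  have r: "u \<otimes>\<^bsub>F\<^esub> v \<otimes>\<^bsub>F\<^esub> inv\<^bsub>F\<^esub> uv \<in> R" "u \<otimes>\<^bsub>F\<^esub> vw \<otimes>\<^bsub>F\<^esub> inv\<^bsub>F\<^esub> uvw \<in> R"
    "v \<otimes>\<^bsub>F\<^esub> w \<otimes>\<^bsub>F\<^esub> inv\<^bsub>F\<^esub> vw \<in> R" "uv \<otimes>\<^bsub>F\<^esub> w \<otimes>\<^bsub>F\<^esub> inv\<^bsub>F\<^esub> uvw \<in> R"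
    unfolding defs using G by (auto intro: sec2_R [OF s])
  have "sec2 s b c d \<otimes>\<^bsub>K\<^esub> sec2 s a b d =
      cls (A \<otimes>\<^bsub>F\<^esub> u \<otimes>\<^bsub>F\<^esub> (v \<otimes>\<^bsub>F\<^esub> w \<otimes>\<^bsub>F\<^esub> inv\<^bsub>F\<^esub> vw) \<otimes>\<^bsub>F\<^esub> inv\<^bsub>F\<^esub> (A \<otimes>\<^bsub>F\<^esub> u)) \<otimes>\<^bsub>K\<^esub>
      cls (A \<otimes>\<^bsub>F\<^esub> (u \<otimes>\<^bsub>F\<^esub> vw \<otimes>\<^bsub>F\<^esub> inv\<^bsub>F\<^esub> uvw) \<otimes>\<^bsub>F\<^esub> inv\<^bsub>F\<^esub> A)"
    using r p cF by (simp add: sec2_def defs [symmetric] gact_cls [of "A \<otimes>\<^bsub>F\<^esub> u" _ b] gact_cls [of A _ a])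
  also have "\<dots> = cls (A \<otimes>\<^bsub>F\<^esub> u \<otimes>\<^bsub>F\<^esub> v \<otimes>\<^bsub>F\<^esub> w \<otimes>\<^bsub>F\<^esub> inv\<^bsub>F\<^esub> uvw \<otimes>\<^bsub>F\<^esub> inv\<^bsub>F\<^esub> A)"
    by (rule cls_mult_eq [OF conj_R conj_R])
      (use cF r in \<open>simp_all add: F.m_assoc F.inv_mult_group F.inv_cancel_left\<close>)
  also have "\<dots> = cls (A \<otimes>\<^bsub>F\<^esub> (u \<otimes>\<^bsub>F\<^esub> v \<otimes>\<^bsub>F\<^esub> inv\<^bsub>F\<^esub> uv) \<otimes>\<^bsub>F\<^esub> inv\<^bsub>F\<^esub> A) \<otimes>\<^bsub>K\<^esub>
      cls (A \<otimes>\<^bsub>F\<^esub> (uv \<otimes>\<^bsub>F\<^esub> w \<otimes>\<^bsub>F\<^esub> inv\<^bsub>F\<^esub> uvw) \<otimes>\<^bsub>F\<^esub> inv\<^bsub>F\<^esub> A)"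
    by (rule cls_mult_eq [OF conj_R conj_R, symmetric])
      (use cF r in \<open>simp_all add: F.m_assoc F.inv_mult_group F.inv_cancel_left\<close>)
  also have "\<dots> = sec2 s a b c \<otimes>\<^bsub>K\<^esub> sec2 s a c d"
    using r p cF by (simp add: sec2_def defs [symmetric] gact_cls [of A _ a])
  also have "\<dots> = sec2 s a c d \<otimes>\<^bsub>K\<^esub> sec2 s a b c"
    unfolding sec2_def using G
    by (intro K.m_comm gmod_closed [OF gmod_relation_module] cls_closed sec2_R [OF s])
  finally show "sec2 s b c d \<otimes>\<^bsub>K\<^esub> sec2 s a b d = sec2 s a c d \<otimes>\<^bsub>K\<^esub> sec2 s a b c" .
qed

lemma sec1_cohomotopy:
  assumes s: "is_section s" and s': "is_section s'"
  shows "cohomotopy G K (sec2 s) (sec2 s') (sec1 s s')"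
  unfolding cohomotopy_def
proof (intro conjI ballI)
  interpret K: comm_group K by (rule comm_group_relation_module)
  have sc: "s g \<in> carrier F" "\<pi> (s g) = g" "s' g \<in> carrier F" "\<pi> (s' g) = g" if "g \<in> carrier G" for g
    using s s' that by (auto simp: is_section_def)
  show c1: "sec1 s s' a b \<in> carrier K" if "a \<in> carrier G" "b \<in> carrier G" for a b
    unfolding sec1_def using that
    by (intro gmod_closed [OF gmod_relation_module] cls_closed sec1_R [OF s s']) auto
  show "sec1 s s' (g \<otimes>\<^bsub>G\<^esub> a) (g \<otimes>\<^bsub>G\<^esub> b) = gact K g (sec1 s s' a b)"
    if "g \<in> carrier G" "a \<in> carrier G" "b \<in> carrier G" for g a b
    using that by (simp add: sec1_def inv_mult_translate gact_mult_cls cls_closed sec1_R [OF s s'])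
  fix a b c assume G: "a \<in> carrier G" "b \<in> carrier G" "c \<in> carrier G"
  define A where "A = s a"
  define u v uv where "u = s (inv\<^bsub>G\<^esub> a \<otimes>\<^bsub>G\<^esub> b)" and "v = s (inv\<^bsub>G\<^esub> b \<otimes>\<^bsub>G\<^esub> c)"
    and "uv = s (inv\<^bsub>G\<^esub> a \<otimes>\<^bsub>G\<^esub> c)"
  note defs = this
  define u' v' uv' where "u' = s' (inv\<^bsub>G\<^esub> a \<otimes>\<^bsub>G\<^esub> b)" and "v' = s' (inv\<^bsub>G\<^esub> b \<otimes>\<^bsub>G\<^esub> c)"
    and "uv' = s' (inv\<^bsub>G\<^esub> a \<otimes>\<^bsub>G\<^esub> c)"
  note defs' = this
  have cF: "A \<in> carrier F" "u \<in> carrier F" "v \<in> carrier F" "uv \<in> carrier F"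
    "u' \<in> carrier F" "v' \<in> carrier F" "uv' \<in> carrier F"
    using G by (auto simp: defs defs' A_def sc)
  have p: "\<pi> A = a" "\<pi> (A \<otimes>\<^bsub>F\<^esub> u) = b"
    using G cF by (auto simp: A_def defs sc G.inv_cancel_left)
  have r: "u \<otimes>\<^bsub>F\<^esub> v \<otimes>\<^bsub>F\<^esub> inv\<^bsub>F\<^esub> uv \<in> R" "u' \<otimes>\<^bsub>F\<^esub> v' \<otimes>\<^bsub>F\<^esub> inv\<^bsub>F\<^esub> uv' \<in> R"
    "u' \<otimes>\<^bsub>F\<^esub> inv\<^bsub>F\<^esub> u \<in> R" "v' \<otimes>\<^bsub>F\<^esub> inv\<^bsub>F\<^esub> v \<in> R" "uv' \<otimes>\<^bsub>F\<^esub> inv\<^bsub>F\<^esub> uv \<in> R"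
    unfolding defs defs' using G by (auto intro: sec2_R [OF s] sec2_R [OF s'] sec1_R [OF s s'])
  have "sec2 s' a b c \<otimes>\<^bsub>K\<^esub> sec1 s s' a c =
      cls (A \<otimes>\<^bsub>F\<^esub> (u' \<otimes>\<^bsub>F\<^esub> v' \<otimes>\<^bsub>F\<^esub> inv\<^bsub>F\<^esub> uv') \<otimes>\<^bsub>F\<^esub> inv\<^bsub>F\<^esub> A) \<otimes>\<^bsub>K\<^esub>
      cls (A \<otimes>\<^bsub>F\<^esub> (uv' \<otimes>\<^bsub>F\<^esub> inv\<^bsub>F\<^esub> uv) \<otimes>\<^bsub>F\<^esub> inv\<^bsub>F\<^esub> A)"
    using r p cF by (simp add: sec2_def sec1_def defs [symmetric] defs' [symmetric] gact_cls [of A _ a])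
  \<comment> \<open>The element in which both sides of the cohomotopy equation meet, with the same
    lifts \<open>A\<close> and \<open>A u\<close> as in \<open>sec2_cocycle\<close>.\<close>
  also have "\<dots> = cls (A \<otimes>\<^bsub>F\<^esub> u' \<otimes>\<^bsub>F\<^esub> v' \<otimes>\<^bsub>F\<^esub> inv\<^bsub>F\<^esub> uv \<otimes>\<^bsub>F\<^esub> inv\<^bsub>F\<^esub> A)"
    by (rule cls_mult_eq [OF conj_R conj_R])
      (use cF r in \<open>simp_all add: F.m_assoc F.inv_mult_group F.inv_cancel_left\<close>)
  also have "\<dots> = cls (A \<otimes>\<^bsub>F\<^esub> (u' \<otimes>\<^bsub>F\<^esub> inv\<^bsub>F\<^esub> u) \<otimes>\<^bsub>F\<^esub> inv\<^bsub>F\<^esub> A) \<otimes>\<^bsub>K\<^esub>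
      (cls (A \<otimes>\<^bsub>F\<^esub> u \<otimes>\<^bsub>F\<^esub> (v' \<otimes>\<^bsub>F\<^esub> inv\<^bsub>F\<^esub> v) \<otimes>\<^bsub>F\<^esub> inv\<^bsub>F\<^esub> (A \<otimes>\<^bsub>F\<^esub> u)) \<otimes>\<^bsub>K\<^esub>
      cls (A \<otimes>\<^bsub>F\<^esub> (u \<otimes>\<^bsub>F\<^esub> v \<otimes>\<^bsub>F\<^esub> inv\<^bsub>F\<^esub> uv) \<otimes>\<^bsub>F\<^esub> inv\<^bsub>F\<^esub> A))"
    (is "_ = cls ?x \<otimes>\<^bsub>K\<^esub> (cls ?y \<otimes>\<^bsub>K\<^esub> cls ?z)")
  proof -
    have xyz: "?x \<in> R" "?y \<in> R" "?z \<in> R" using cF r by (auto intro!: conj_R)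
    then have "cls ?x \<otimes>\<^bsub>K\<^esub> (cls ?y \<otimes>\<^bsub>K\<^esub> cls ?z) = cls (?x \<otimes>\<^bsub>F\<^esub> (?y \<otimes>\<^bsub>F\<^esub> ?z))"
      by (simp add: cls_mult subgroup.m_closed [OF R_subgroup])
    also have "?x \<otimes>\<^bsub>F\<^esub> (?y \<otimes>\<^bsub>F\<^esub> ?z) = A \<otimes>\<^bsub>F\<^esub> u' \<otimes>\<^bsub>F\<^esub> v' \<otimes>\<^bsub>F\<^esub> inv\<^bsub>F\<^esub> uv \<otimes>\<^bsub>F\<^esub> inv\<^bsub>F\<^esub> A"
      using cF by (simp add: F.m_assoc F.inv_mult_group F.inv_cancel_left)
    finally show ?thesis ..
  qed
  also have "\<dots> = sec1 s s' a b \<otimes>\<^bsub>K\<^esub> (sec1 s s' b c \<otimes>\<^bsub>K\<^esub> sec2 s a b c)"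
    using r p cF by (simp add: sec2_def sec1_def defs [symmetric] defs' [symmetric]
        gact_cls [of "A \<otimes>\<^bsub>F\<^esub> u" _ b] gact_cls [of A _ a])
  also have "\<dots> = sec2 s a b c \<otimes>\<^bsub>K\<^esub> (sec1 s s' b c \<otimes>\<^bsub>K\<^esub> sec1 s s' a b)"
    using c1 G cocycle_closed [OF sec2_cocycle [OF s]] by (simp add: K.m_ac)
  finally show "sec2 s' a b c \<otimes>\<^bsub>K\<^esub> sec1 s s' a c =
      sec2 s a b c \<otimes>\<^bsub>K\<^esub> (sec1 s s' b c \<otimes>\<^bsub>K\<^esub> sec1 s s' a b)" .
qed

end

section \<open>Morphisms of presentations\<close>

locale extension_morphism =
  P: group_extension G F \<pi> + P': group_extension G F' \<pi>'
  for G :: "('g, 'b) monoid_scheme" and F :: "'u monoid" and \<pi> and F' :: "'u monoid" and \<pi>' +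
  fixes \<phi> :: "'u \<Rightarrow> 'u"
  assumes \<phi>_hom: "\<phi> \<in> hom F F'" and \<phi>_over: "x \<in> carrier F \<Longrightarrow> \<pi>' (\<phi> x) = \<pi> x"
begin

sublocale \<phi>: group_hom F F' \<phi>
  by (simp add: group_hom_def group_hom_axioms_def P.F.group_axioms P'.F.group_axioms \<phi>_hom)

lemma \<phi>_R: "r \<in> P.R \<Longrightarrow> \<phi> r \<in> P'.R"
  by (auto simp: P.R_iff P'.R_iff \<phi>_over)

lemma relation_map_cls:
  assumes "r \<in> P.R"
  shows "relation_map G (F', \<pi>') \<phi> (P.cls r) = P'.cls (\<phi> r)"
proof -
  have "\<phi> ` derived F P.R = derived F' (\<phi> ` P.R)"
    using P.R_subset by (rule \<phi>.derived_img [symmetric])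
  also have "\<dots> \<subseteq> derived F' P'.R"
    using \<phi>_R by (intro P'.F.mono_derived) auto
  finally have "\<phi> ` derived F P.R \<subseteq> derived F' P'.R" .
  moreover have "\<phi> \<in> hom (F\<lparr>carrier := P.R\<rparr>) (F'\<lparr>carrier := P'.R\<rparr>)"
    using \<phi>_R subsetD [OF P.R_subset] by (intro homI) auto
  ultimately show ?thesis
    using induced_map_coset [of "F\<lparr>carrier := P.R\<rparr>" "derived F P.R" "derived F' P'.R" "F'\<lparr>carrier := P'.R\<rparr>" \<phi> r]
      assms P.derived_R_normal' P'.derived_R_normal' P.F.subgroup_imp_group [OF P.R_subgroup]
    by (simp add: relation_map_def P.cls_eq P'.cls_eq normal_def)
qed

lemma relation_map_equivariant: "equivariant G P.K P'.K (relation_map G (F', \<pi>') \<phi>)"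
  unfolding equivariant_def
proof (intro conjI ballI homI)
  show "relation_map G (F', \<pi>') \<phi> X \<in> carrier P'.K" if "X \<in> carrier P.K" for X
    using that \<phi>_R by (auto simp: P.carrier_relation_module relation_map_cls P'.cls_closed)
  show "relation_map G (F', \<pi>') \<phi> (X \<otimes>\<^bsub>P.K\<^esub> Y) =
      relation_map G (F', \<pi>') \<phi> X \<otimes>\<^bsub>P'.K\<^esub> relation_map G (F', \<pi>') \<phi> Y"
    if X: "X \<in> carrier P.K" and Y: "Y \<in> carrier P.K" for X Y
  proof -
    obtain r s where rs: "r \<in> P.R" "X = P.cls r" "s \<in> P.R" "Y = P.cls s"
      using X Y by (auto simp: P.carrier_relation_module)
    moreover have "r \<in> carrier F" "s \<in> carrier F" using rs P.R_subset by auto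
    moreover have "r \<otimes>\<^bsub>F\<^esub> s \<in> P.R" using rs by (simp add: subgroup.m_closed [OF P.R_subgroup])
    ultimately show ?thesis
      by (simp add: P.cls_mult relation_map_cls \<phi>_R P'.cls_mult)
  qed
  fix g X assume "g \<in> carrier G" "X \<in> carrier P.K"
  then obtain w r where w: "w \<in> carrier F" "g = \<pi> w" "r \<in> P.R" "X = P.cls r"
    using P.\<pi>_surj by (metis P.carrier_relation_module imageE)
  moreover have "r \<in> carrier F" using w P.R_subset by auto
  ultimately show "relation_map G (F', \<pi>') \<phi> (gact P.K g X) = gact P'.K g (relation_map G (F', \<pi>') \<phi> X)"
    by (simp add: P.gact_cls relation_map_cls P.conj_R \<phi>_R
        P'.gact_cls [of "\<phi> w"] \<phi>_over)
qed

lemma is_section_compose: "P.is_section s \<Longrightarrow> P'.is_section (\<lambda>g. \<phi> (s g))"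
  by (simp add: P.is_section_def P'.is_section_def \<phi>_over)

lemma relation_map_sec2:
  assumes s: "P.is_section s" and G: "a \<in> carrier G" "b \<in> carrier G" "c \<in> carrier G"
  shows "relation_map G (F', \<pi>') \<phi> (P.sec2 s a b c) = P'.sec2 (\<lambda>g. \<phi> (s g)) a b c"
proof -
  have "s (inv\<^bsub>G\<^esub> x \<otimes>\<^bsub>G\<^esub> y) \<in> carrier F" if "x \<in> carrier G" "y \<in> carrier G" for x y
    using s that by (simp add: P.is_section_def)
  then show ?thesis
    using G P.sec2_R [OF s G]
    by (simp add: P.sec2_def P'.sec2_def equivariant_act [OF relation_map_equivariant] P.cls_closed relation_map_cls)
qed

lemma power_map_Theta:
  assumes s: "P.is_section s" and z: "Poly_Mapping.keys z \<subseteq> tuples (Suc (2 * n)) (carrier G)"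
  shows "power_map n P'.K (relation_map G (F', \<pi>') \<phi>) (Theta n P.K (P.sec2 s) z) =
    Theta n P'.K (P'.sec2 (\<lambda>g. \<phi> (s g))) z"
proof -
  have "theta_list (P'.sec2 (\<lambda>g. \<phi> (s g))) c = map (relation_map G (F', \<pi>') \<phi>) (theta_list (P.sec2 s) c)"
    if "set c \<subseteq> carrier G" for c
    using that by (induction "P.sec2 s" c rule: theta_list.induct) (simp_all add: relation_map_sec2 [OF s])
  then have "map_chain (relation_map G (F', \<pi>') \<phi>) (theta (P.sec2 s) z) = theta (P'.sec2 (\<lambda>g. \<phi> (s g))) z"
    unfolding map_chain_def frag_extend_frag_extend using z
    by (intro frag_extend_eq) (auto simp: tuples_def subset_iff)
  then show ?thesis
    using keys_theta [OF P.sec2_cocycle [OF s] z]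
    by (simp add: Theta_def power_map_hom(2) [OF P.comm_group_relation_module P'.comm_group_relation_module
          equivariant_hom [OF relation_map_equivariant]])
qed

end

text \<open>If the section is transported along the morphism, naturality holds exactly, without a
  homotopy. The transported section need not be the chosen one of the target; that discrepancy is
  dealt with by \<open>ThetaH_cohomotopic\<close>.\<close>

lemma ThetaH_natural:
  fixes G :: "('g, 'b) monoid_scheme" and M :: "('g, 'm) gmodule"
  assumes G: "group G" and M: "gmod G M"
    and mor: "extension_morphism G F \<pi> F' \<pi>' \<phi>" and s: "group_extension.is_section G F \<pi> s"
    and y: "y \<in> carrier (chains G M (Suc (Suc (2 * m))))"
  defines "K \<equiv> relation_module G (F, \<pi>)" and "K' \<equiv> relation_module G (F', \<pi>')"
  shows "Tmap G M (tensor_power (Suc m) K') (power_map (Suc m) K' (relation_map G (F', \<pi>') \<phi>))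
      (ThetaH m G M K (group_extension.sec2 G F \<pi> s) y) =
    ThetaH m G M K' (group_extension.sec2 G F' \<pi>' (\<lambda>g. \<phi> (s g))) y"
proof -
  interpret mor: extension_morphism G F \<pi> F' \<pi>' \<phi> by (rule mor)
  have K: "gmod G K" and K': "gmod G K'"
    by (simp_all add: K_def K'_def mor.P.gmod_relation_module mor.P'.gmod_relation_module)
  have f: "cocycle G K (mor.P.sec2 s)" unfolding K_def by (rule mor.P.sec2_cocycle [OF s])
  have f': "cocycle G K' (mor.P'.sec2 (\<lambda>g. \<phi> (s g)))"
    unfolding K'_def by (rule mor.P'.sec2_cocycle [OF mor.is_section_compose [OF s]])
  have eq: "equivariant G (tensor_power (Suc m) K) (tensor_power (Suc m) K')
      (power_map (Suc m) K' (relation_map G (F', \<pi>') \<phi>))"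
    by (rule power_map_equivariant [OF K K']) (simp add: K_def K'_def mor.relation_map_equivariant)
  note T = Tmap_hom [OF M gmod_tensor_power [OF K] gmod_tensor_power [OF K'] eq]
  interpret U: comm_group "coinvariants G (tensor M (tensor_power (Suc m) K'))" by (rule comm_group_T [OF M gmod_tensor_power [OF K']])
  have "(Tmap G M (tensor_power (Suc m) K') (power_map (Suc m) K' (relation_map G (F', \<pi>') \<phi>)) \<circ>
      ThetaH m G M K (mor.P.sec2 s)) y = ThetaH m G M K' (mor.P'.sec2 (\<lambda>g. \<phi> (s g))) y"
  proof (rule T_hom_eqI [OF M gmod_std_resolution [OF G] U.is_group
        hom_compose [OF ThetaH_hom(1) [OF G M K f] T(1)]
        ThetaH_hom(1) [OF G M K' f'] _ y])
    fix x z assume x: "x \<in> carrier M" and "z \<in> carrier (std_resolution G (Suc (Suc (2 * m))))"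
    then have z: "Poly_Mapping.keys z \<subseteq> tuples (Suc (Suc (Suc (2 * m)))) (carrier G)" by simp
    have c: "Theta (Suc m) K (mor.P.sec2 s) z \<in> carrier (tensor_power (Suc m) K)"
      using hom_in_carrier [OF equivariant_hom [OF Theta_equivariant [OF K f, of "Suc m"]], of z] z by simp
    have "power_map (Suc m) K' (relation_map G (F', \<pi>') \<phi>) (Theta (Suc m) K (mor.P.sec2 s) z) =
        Theta (Suc m) K' (mor.P'.sec2 (\<lambda>g. \<phi> (s g))) z"
      using mor.power_map_Theta [OF s, of z "Suc m"] z by (simp add: K_def K'_def)
    then show "(Tmap G M (tensor_power (Suc m) K') (power_map (Suc m) K' (relation_map G (F', \<pi>') \<phi>)) \<circ>
        ThetaH m G M K (mor.P.sec2 s)) (coinv_tensor G M (std_resolution G (Suc (Suc (2 * m)))) x z) =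
        ThetaH m G M K' (mor.P'.sec2 (\<lambda>g. \<phi> (s g))) (coinv_tensor G M (std_resolution G (Suc (Suc (2 * m)))) x z)"
      using x z T(2) [OF x c] by (simp only: o_apply ThetaH_hom(2) [OF G M K f] ThetaH_hom(2) [OF G M K' f'])
  qed
  then show ?thesis by simp
qed

section \<open>The free group of reduced words\<close>

definition letter_inv :: "'x \<times> bool \<Rightarrow> 'x \<times> bool" where
  "letter_inv l = (fst l, \<not> snd l)"

definition letter_mult :: "'x \<times> bool \<Rightarrow> ('x \<times> bool) list \<Rightarrow> ('x \<times> bool) list" where
  "letter_mult l w = (if w \<noteq> [] \<and> hd w = letter_inv l then tl w else l # w)"

lemma letter_inv_simps [simp]: "letter_inv (letter_inv l) = l" "fst (letter_inv l) = fst l" "letter_inv l \<noteq> l" "l \<noteq> letter_inv l"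
  by (auto simp: letter_inv_def prod_eq_iff)

lemma reduced_words_Nil [simp]: "[] \<in> reduced_words X"
  by (simp add: reduced_words_def)

lemma reduced_words_Cons: "l # w \<in> reduced_words X \<longleftrightarrow>
    fst l \<in> X \<and> w \<in> reduced_words X \<and> (w \<noteq> [] \<longrightarrow> hd w \<noteq> letter_inv l)"
  by (cases w) (auto simp: reduced_words_def letter_inv_def)

lemma letter_mult_closed: "fst l \<in> X \<Longrightarrow> w \<in> reduced_words X \<Longrightarrow> letter_mult l w \<in> reduced_words X"
  by (cases w) (auto simp: letter_mult_def reduced_words_Cons)

text \<open>Reducedness is essential: once a leading \<open>l\<close> has been cancelled, the next
  letter is not \<open>letter_inv l\<close>, so multiplying by \<open>l\<close> puts it
  back.\<close>

lemma letter_mult_letter_inv: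
  assumes "w \<in> reduced_words X"
  shows "letter_mult l (letter_mult (letter_inv l) w) = w"
proof (cases w)
  case (Cons l' w')
  with assms show ?thesis by (cases w') (auto simp: letter_mult_def reduced_words_Cons)
qed (simp add: letter_mult_def)

lemma letter_mult_reduced: "l # w \<in> reduced_words X \<Longrightarrow> letter_mult l w = l # w"
  by (auto simp: letter_mult_def reduced_words_Cons)

lemma foldr_letter_mult_closed: "fst ` set w \<subseteq> X \<Longrightarrow> v \<in> reduced_words X \<Longrightarrow> foldr letter_mult w v \<in> reduced_words X"
  by (induction w) (auto simp: letter_mult_closed)

lemma reduced_words_fst: "w \<in> reduced_words X \<Longrightarrow> fst ` set w \<subseteq> X"
  by (simp add: reduced_words_def)

lemma foldr_letter_mult_Nil: "w \<in> reduced_words X \<Longrightarrow> foldr letter_mult w [] = w"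
  by (induction w) (auto simp: letter_mult_reduced reduced_words_Cons)

text \<open>A cancellation inside the left factor is harmless, because a letter and its formal
  inverse act on reduced words by inverse operations. Associativity follows by induction.\<close>

lemma foldr_letter_mult_letter_mult:
  assumes "w \<in> reduced_words X" "u \<in> reduced_words X"
  shows "foldr letter_mult (letter_mult l w) u = letter_mult l (foldr letter_mult w u)"
proof (cases "w \<noteq> [] \<and> hd w = letter_inv l")
  case True
  then obtain w' where w: "w = letter_inv l # w'" by (cases w) auto
  have "foldr letter_mult w' u \<in> reduced_words X"
    using assms w by (intro foldr_letter_mult_closed) (auto simp: reduced_words_def)
  then show ?thesis by (simp add: w letter_mult_def [of l "letter_inv l # w'"] letter_mult_letter_inv)
next
  case False
  then show ?thesis by (auto simp: letter_mult_def [of l w])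
qed

lemma foldr_letter_mult_assoc:
  assumes "fst ` set w \<subseteq> X" "v \<in> reduced_words X" "u \<in> reduced_words X"
  shows "foldr letter_mult (foldr letter_mult w v) u = foldr letter_mult w (foldr letter_mult v u)"
  using assms(1)
proof (induction w)
  case (Cons l w)
  then show ?case
    using foldr_letter_mult_letter_mult [OF foldr_letter_mult_closed [OF _ assms(2)] assms(3), of w l] by simp
qed simp

lemma foldr_letter_mult_inverse:
  "w \<in> reduced_words X \<Longrightarrow> foldr letter_mult (rev (map letter_inv w)) w = []"
proof (induction w)
  case (Cons l w)
  then have "w \<in> reduced_words X" by (simp add: reduced_words_Cons)
  then have "letter_mult (letter_inv l) (l # w) = w" by (simp add: letter_mult_def)
  then show ?case using Cons by (simp add: reduced_words_Cons)
qed simp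

text \<open>Left multiplication by a letter is an invertible operation on reduced words, which gives
  associativity without confluence of cancellation.\<close>

definition word_group :: "'x set \<Rightarrow> ('x \<times> bool) list monoid" where
  "word_group X = \<lparr>carrier = reduced_words X, monoid.mult = (\<lambda>w v. foldr letter_mult w v), one = []\<rparr>"

lemma word_group_simps [simp]:
  "carrier (word_group X) = reduced_words X" "w \<otimes>\<^bsub>word_group X\<^esub> v = foldr letter_mult w v"
  "\<one>\<^bsub>word_group X\<^esub> = []"
  by (simp_all add: word_group_def)

lemma group_word_group: "group (word_group X)"
proof (rule groupI; simp)
  fix w v :: "('a \<times> bool) list" assume w: "w \<in> reduced_words X"
  show "v \<in> reduced_words X \<Longrightarrow> foldr letter_mult w v \<in> reduced_words X"
    using w by (intro foldr_letter_mult_closed) (simp_all add: reduced_words_fst)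
  show "foldr letter_mult (foldr letter_mult w v) u = foldr letter_mult w (foldr letter_mult v u)"
    if "v \<in> reduced_words X" "u \<in> reduced_words X" for u
    using w that by (intro foldr_letter_mult_assoc) (simp_all add: reduced_words_fst)
  let ?L = "rev (map letter_inv w)"
  have L: "fst ` set ?L \<subseteq> X" using reduced_words_fst [OF w] by auto
  show "\<exists>y\<in>reduced_words X. foldr letter_mult y w = []"
  proof (rule bexI)
    show "foldr letter_mult (foldr letter_mult ?L []) w = []"
      using foldr_letter_mult_assoc [OF L _ w, of "[]"] foldr_letter_mult_inverse [OF w] by simp
    show "foldr letter_mult ?L [] \<in> reduced_words X" by (rule foldr_letter_mult_closed [OF L]) simp
  qed
qed

section \<open>Evaluation of words and the universal property of free groups\<close>

definition letter_value :: "('h, 'z) monoid_scheme \<Rightarrow> 'h \<times> bool \<Rightarrow> 'h" where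
  "letter_value H l = (if snd l then fst l else inv\<^bsub>H\<^esub> (fst l))"

lemma word_value_simps [simp]:
  "word_value H [] = \<one>\<^bsub>H\<^esub>" "word_value H (l # w) = letter_value H l \<otimes>\<^bsub>H\<^esub> word_value H w"
  by (simp_all add: word_value_def letter_value_def split: prod.split)

context group
begin

lemma letter_value_closed: "fst l \<in> carrier G \<Longrightarrow> letter_value G l \<in> carrier G"
  by (simp add: letter_value_def)

lemma word_value_closed: "fst ` set w \<subseteq> carrier G \<Longrightarrow> word_value G w \<in> carrier G"
  by (induction w) (auto simp: letter_value_closed)

lemma letter_value_letter_inv: "fst l \<in> carrier G \<Longrightarrow> letter_value G (letter_inv l) = inv (letter_value G l)"
  by (simp add: letter_value_def letter_inv_def)

abbreviation "relabel u \<equiv> map (\<lambda>l. (u (fst l), snd l))"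

lemma word_value_relabel_closed:
  assumes "u ` X \<subseteq> carrier G" "fst ` set w \<subseteq> X"
  shows "word_value G (relabel u w) \<in> carrier G"
  using assms by (intro word_value_closed) fastforce

lemma word_value_letter_mult:
  assumes "u ` X \<subseteq> carrier G" "fst l \<in> X" "w \<in> reduced_words X"
  shows "word_value G (relabel u (letter_mult l w)) = letter_value G (u (fst l), snd l) \<otimes> word_value G (relabel u w)"
proof (cases "w \<noteq> [] \<and> hd w = letter_inv l")
  case True
  then obtain w' where w: "w = letter_inv l # w'" by (cases w) auto
  have c: "u (fst l) \<in> carrier G" "word_value G (relabel u w') \<in> carrier G"
    using assms reduced_words_fst [OF assms(3)] w by (auto intro!: word_value_relabel_closed [OF assms(1)])
  have "letter_value G (u (fst l), \<not> snd l) = inv (letter_value G (u (fst l), snd l))"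
    using letter_value_letter_inv [of "(u (fst l), snd l)"] c by (simp add: letter_inv_def)
  then show ?thesis
    using c letter_value_closed [of "(u (fst l), snd l)"]
    by (simp add: w letter_mult_def letter_inv_def inv_cancel_left)
next
  case False
  then have "letter_mult l w = l # w" by (auto simp: letter_mult_def)
  then show ?thesis by simp
qed

lemma word_value_hom:
  assumes "u ` X \<subseteq> carrier G"
  shows "(\<lambda>w. word_value G (relabel u w)) \<in> hom (word_group X) G"
proof (rule homI; simp)
  have c: "word_value G (relabel u w) \<in> carrier G" if "fst ` set w \<subseteq> X" for w
    using assms that by (rule word_value_relabel_closed)
  then show "word_value G (relabel u w) \<in> carrier G" if "w \<in> reduced_words X" for w
    using that by (simp add: reduced_words_fst)
  show "word_value G (relabel u (foldr letter_mult w v)) = word_value G (relabel u w) \<otimes> word_value G (relabel u v)"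
    if "w \<in> reduced_words X" and v: "v \<in> reduced_words X" for w v
    using reduced_words_fst [OF that(1)]
  proof (induction w)
    case Nil
    then show ?case using c reduced_words_fst [OF v] by simp
  next
    case (Cons l w)
    then have "u (fst l) \<in> carrier G" using assms by auto
    then show ?case
      using Cons c reduced_words_fst [OF v] foldr_letter_mult_closed [of w X v] v
      by (simp add: word_value_letter_mult [OF assms] m_assoc letter_value_closed)
  qed
qed

end

text \<open>Evaluation in \<open>F\<close> is an isomorphism from the group of reduced words; its
  inverse followed by evaluation in \<open>H\<close> is the extension.\<close>

lemma free_basis_universal:
  assumes F: "group F" and b: "free_basis F X" and H: "group H" and u: "u ` X \<subseteq> carrier H"
  obtains \<phi> where "\<phi> \<in> hom F H" "\<And>x. x \<in> X \<Longrightarrow> \<phi> x = u x"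
proof -
  have X: "X \<subseteq> carrier F" and bij: "bij_betw (word_value F) (reduced_words X) (carrier F)"
    using b by (auto simp: free_basis_def)
  have "word_value F \<in> iso (word_group X) F"
    using group.word_value_hom [OF F, of "\<lambda>x. x" X] X bij by (simp add: iso_def)
  then have "inv_into (reduced_words X) (word_value F) \<in> iso F (word_group X)"
    using group.iso_set_sym [OF group_word_group, of "word_value F" X F] by simp
  then have "inv_into (reduced_words X) (word_value F) \<in> hom F (word_group X)" by (simp add: iso_def)
  note hom = hom_compose [OF this group.word_value_hom [OF H u]]
  show thesis
  proof (rule that [OF hom])
    fix x assume x: "x \<in> X"
    then have "[(x, True)] \<in> reduced_words X" by (simp add: reduced_words_Cons)
    moreover have "word_value F [(x, True)] = x"
      using x X F by (auto simp: letter_value_def group.is_monoid monoid.r_one)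
    ultimately have "inv_into (reduced_words X) (word_value F) x = [(x, True)]"
      using bij by (metis bij_betw_inv_into_left)
    then show "((\<lambda>w. word_value H (map (\<lambda>l. (u (fst l), snd l)) w)) \<circ>
        inv_into (reduced_words X) (word_value F)) x = u x"
      using x u H by (auto simp: letter_value_def group.is_monoid monoid.r_one)
  qed
qed

lemma free_basis_generate:
  assumes F: "group F" and b: "free_basis F X"
  shows "carrier F = generate F X"
proof
  have X: "X \<subseteq> carrier F" and bij: "bij_betw (word_value F) (reduced_words X) (carrier F)"
    using b by (auto simp: free_basis_def)
  have *: "word_value F w \<in> generate F X" if "fst ` set w \<subseteq> X" for w
    using that
  proof (induction w)
    case (Cons l w)
    then have "letter_value F l \<in> generate F X"
      by (auto simp: letter_value_def intro: generate.incl generate.inv)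
    then show ?case using Cons by (simp add: generate.eng)
  qed (simp add: generate.one)
  show "carrier F \<subseteq> generate F X"
  proof
    fix x assume "x \<in> carrier F"
    then obtain w where "w \<in> reduced_words X" "x = word_value F w" using bij by (auto simp: bij_betw_def)
    then show "x \<in> generate F X" using * [of w] reduced_words_fst [of w X] by simp
  qed
  show "generate F X \<subseteq> carrier F" using X by (rule group.generate_incl [OF F])
qed

section \<open>Free groups inside an infinite type\<close>

lemma word_encoding:
  assumes "infinite (UNIV :: 'u set)"
  obtains enc :: "('u \<times> bool) list \<Rightarrow> 'u" where "inj enc"
proof -
  obtain h :: "'u list \<Rightarrow> 'u" where h: "bij h"
    using lists_infinite_bij_betw_types [OF assms] by blast
  \<comment> \<open>A letter is coded by a list of length one or two, and the length records the
    sign.\<close>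
  define k :: "'u \<times> bool \<Rightarrow> 'u" where "k = (\<lambda>(x, b). h (if b then [x] else [x, x]))"
  have "inj k"
    using h by (auto simp: k_def inj_def bij_def split: if_splits)
  then have "inj (h \<circ> map k)"
    using h by (simp add: bij_def inj_compose)
  then show thesis by (rule that)
qed

text \<open>The group of reduced words has the wrong type and is carried along the encoding. Its
  basis consists of the encoded one-letter words, hence the renaming \<open>e\<close> of
  \<open>X\<close>.\<close>

lemma free_group_exists:
  assumes inf: "infinite (UNIV :: 'u set)"
  obtains F :: "'u monoid" and e where "group F" "inj_on e X" "free_basis F (e ` (X :: 'u set))"
proof -
  obtain enc :: "('u \<times> bool) list \<Rightarrow> 'u" where enc: "inj enc" using word_encoding [OF inf] .
  define dec where "dec = the_inv enc"
  have dec [simp]: "dec (enc w) = w" for w using enc by (simp add: dec_def the_inv_f_f)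
  define F :: "'u monoid" where
    "F = \<lparr>carrier = enc ` reduced_words X, monoid.mult = (\<lambda>a b. enc (foldr letter_mult (dec a) (dec b))), one = enc []\<rparr>"
  interpret W: group "word_group X" by (rule group_word_group)
  have F_simps [simp]: "carrier F = enc ` reduced_words X" "a \<otimes>\<^bsub>F\<^esub> b = enc (foldr letter_mult (dec a) (dec b))"
    "\<one>\<^bsub>F\<^esub> = enc []" for a b
    by (simp_all add: F_def)
  have F: "group F"
  proof (rule groupI)
    fix a b c assume "a \<in> carrier F" "b \<in> carrier F" "c \<in> carrier F"
    then show "a \<otimes>\<^bsub>F\<^esub> b \<in> carrier F" "a \<otimes>\<^bsub>F\<^esub> b \<otimes>\<^bsub>F\<^esub> c = a \<otimes>\<^bsub>F\<^esub> (b \<otimes>\<^bsub>F\<^esub> c)"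
      using W.m_closed W.m_assoc by auto
  next
    fix a assume "a \<in> carrier F"
    then obtain w where w: "w \<in> reduced_words X" "a = enc w" by auto
    then show "\<one>\<^bsub>F\<^esub> \<otimes>\<^bsub>F\<^esub> a = a" by simp
    obtain v where "v \<in> reduced_words X" "foldr letter_mult v w = []"
      using W.l_inv_ex [of w] w by auto
    then show "\<exists>b\<in>carrier F. b \<otimes>\<^bsub>F\<^esub> a = \<one>\<^bsub>F\<^esub>"
      using w by (intro bexI [of _ "enc v"]) auto
  qed simp
  interpret F: group F by (rule F)
  define e where "e x = enc [(x, True)]" for x
  have inj_e: "inj e" using enc by (auto simp: e_def inj_def)
  have eF: "e x \<in> carrier F" if "x \<in> X" for x using that by (simp add: e_def reduced_words_Cons)
  have inv_e: "inv\<^bsub>F\<^esub> (e x) = enc [(x, False)]" if "x \<in> X" for x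
    using that by (intro F.inv_equality) (auto simp: e_def letter_mult_def letter_inv_def reduced_words_Cons)
  have val: "word_value F (map (\<lambda>l. (e (fst l), snd l)) w) = enc (foldr letter_mult w [])" if "fst ` set w \<subseteq> X" for w
    using that
  proof (induction w)
    case (Cons l w)
    have "letter_value F (e (fst l), snd l) = enc [l]"
      using Cons.prems inv_e [of "fst l"] by (cases l) (auto simp: letter_value_def e_def)
    then show ?case using Cons by simp
  qed simp
  have red: "reduced_words (e ` X) = map (\<lambda>l. (e (fst l), snd l)) ` reduced_words X" (is "_ = ?m ` _")
  proof -
    have succ: "?m w \<in> reduced_words (e ` X) \<longleftrightarrow> w \<in> reduced_words X" for w
      using inj_e by (induction w) (auto simp: reduced_words_Cons letter_inv_def hd_map inj_image_mem_iff inj_eq prod_eq_iff)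
    have "\<exists>w. v = ?m w" if "fst ` set v \<subseteq> e ` X" for v
      using that
    proof (induction v)
      case (Cons l v)
      then obtain w x where "v = ?m w" "fst l = e x" by auto
      then have "l # v = ?m ((x, snd l) # w)" by (simp add: prod_eq_iff)
      then show ?case by (rule exI)
    qed simp
    then show ?thesis using succ reduced_words_fst by (metis (no_types, lifting) image_iff subsetI subset_antisym)
  qed
  have "bij_betw (word_value F) (reduced_words (e ` X)) (carrier F)"
    unfolding bij_betw_def
  proof
    have v: "word_value F (?m w) = enc w" if "w \<in> reduced_words X" for w
      using val [OF reduced_words_fst [OF that]] foldr_letter_mult_Nil [OF that] by simp
    show "inj_on (word_value F) (reduced_words (e ` X))"
      unfolding red using v enc by (auto simp: inj_on_def inj_def)
    show "word_value F ` reduced_words (e ` X) = carrier F"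
      unfolding red image_image using v by simp
  qed
  then have "free_basis F (e ` X)" using eF by (auto simp: free_basis_def)
  moreover have "inj_on e X" using inj_e by (rule inj_on_subset) simp
  ultimately show thesis using that F by blast
qed

section \<open>Fox derivatives\<close>

lemma (in group) translate_one:
  "Poly_Mapping.keys z \<subseteq> tuples k (carrier G) \<Longrightarrow> translate G \<one> z = z"
proof -
  assume z: "Poly_Mapping.keys z \<subseteq> tuples k (carrier G)"
  have "map (\<lambda>x. \<one> \<otimes> x) c = c" if "set c \<subseteq> carrier G" for c
    using that by (induction c) auto
  then have "map_chain (\<lambda>x. \<one> \<otimes> x) z = frag_extend frag_of z"
    unfolding map_chain_def using z by (intro frag_extend_eq) (auto simp: tuples_def subset_iff)
  then show ?thesis by simp
qed

lemma (in group) translate_mult: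
  assumes z: "Poly_Mapping.keys z \<subseteq> tuples k (carrier G)" and g: "g \<in> carrier G" "h \<in> carrier G"
  shows "translate G (g \<otimes> h) z = translate G g (translate G h z)"
proof -
  have "map_chain (\<lambda>x. g \<otimes> h \<otimes> x) z = map_chain ((\<lambda>x. g \<otimes> x) \<circ> (\<lambda>x. h \<otimes> x)) z"
    unfolding map_chain_def using z g
    by (intro frag_extend_eq) (auto simp: tuples_def subset_iff m_assoc intro!: arg_cong [where f=frag_of])
  then show ?thesis by (simp add: map_chain_map_chain)
qed

lemma (in group) translate_keys:
  "Poly_Mapping.keys z \<subseteq> tuples k (carrier G) \<Longrightarrow> g \<in> carrier G \<Longrightarrow>
    Poly_Mapping.keys (translate G g z) \<subseteq> tuples k (carrier G)"
  by (erule keys_map_chain) auto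

text \<open>Crossed homomorphisms \<open>F \<rightarrow> C\<^sub>1\<close> over \<open>\<pi>\<close> are the homomorphisms into the semidirect product of \<open>C\<^sub>1\<close> and
  \<open>G\<close> that lift \<open>\<pi>\<close>.\<close>

definition semidirect :: "('g, 'b) monoid_scheme \<Rightarrow> (('g list \<Rightarrow>\<^sub>0 int) \<times> 'g) monoid" where
  "semidirect G = \<lparr>carrier = {z. Poly_Mapping.keys z \<subseteq> tuples 2 (carrier G)} \<times> carrier G,
    monoid.mult = (\<lambda>(z, g) (w, h). (z + translate G g w, g \<otimes>\<^bsub>G\<^esub> h)), one = (0, \<one>\<^bsub>G\<^esub>)\<rparr>"

lemma (in group) group_semidirect: "group (semidirect G)"
proof (rule groupI)
  show "\<one>\<^bsub>semidirect G\<^esub> \<in> carrier (semidirect G)" by (simp add: semidirect_def)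
  fix p q r assume "p \<in> carrier (semidirect G)" "q \<in> carrier (semidirect G)" "r \<in> carrier (semidirect G)"
  then obtain z g w h v k where p: "p = (z, g)" "Poly_Mapping.keys z \<subseteq> tuples 2 (carrier G)" "g \<in> carrier G"
    and q: "q = (w, h)" "Poly_Mapping.keys w \<subseteq> tuples 2 (carrier G)" "h \<in> carrier G"
    and r: "r = (v, k)" "Poly_Mapping.keys v \<subseteq> tuples 2 (carrier G)" "k \<in> carrier G"
    by (auto simp: semidirect_def)
  show "p \<otimes>\<^bsub>semidirect G\<^esub> q \<in> carrier (semidirect G)"
    using p q order_trans [OF keys_add Un_least [OF p(2) translate_keys [OF q(2) p(3)]]]
    by (simp add: semidirect_def)
  show "p \<otimes>\<^bsub>semidirect G\<^esub> q \<otimes>\<^bsub>semidirect G\<^esub> r = p \<otimes>\<^bsub>semidirect G\<^esub> (q \<otimes>\<^bsub>semidirect G\<^esub> r)"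
    using p q r by (simp add: semidirect_def m_assoc translate_mult map_chain_linear add.assoc)
next
  fix p assume "p \<in> carrier (semidirect G)"
  then obtain z g where p: "p = (z, g)" "Poly_Mapping.keys z \<subseteq> tuples 2 (carrier G)" "g \<in> carrier G"
    by (auto simp: semidirect_def)
  show "\<one>\<^bsub>semidirect G\<^esub> \<otimes>\<^bsub>semidirect G\<^esub> p = p"
    using p by (simp add: semidirect_def translate_one)
  show "\<exists>q\<in>carrier (semidirect G). q \<otimes>\<^bsub>semidirect G\<^esub> p = \<one>\<^bsub>semidirect G\<^esub>"
    using p translate_keys [OF p(2), of "inv g"]
    by (intro bexI [of _ "(- translate G (inv g) z, inv g)"]) (auto simp: semidirect_def)
qed

lemma generate_hom_eqI:
  assumes "group F" "group H" "f \<in> hom F H" "h \<in> hom F H" "X \<subseteq> carrier F"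
    "\<And>x. x \<in> X \<Longrightarrow> f x = h x" "w \<in> generate F X"
  shows "f w = h w"
proof -
  interpret f: group_hom F H f using assms by (intro group_homI)
  interpret h: group_hom F H h using assms by (intro group_homI)
  show ?thesis
    using assms(7)
  proof (induction rule: generate.induct)
    case (eng x y)
    moreover have "x \<in> carrier F" "y \<in> carrier F" using eng f.G.generate_incl [OF assms(5)] by auto
    ultimately show ?case by simp
  next
    case (inv x)
    then have "x \<in> carrier F" using assms(5) by auto
    then show ?case using inv assms(6) by simp
  qed (use assms(6) in auto)
qed

context group_extension
begin

definition crossed :: "('u \<Rightarrow> ('g list \<Rightarrow>\<^sub>0 int)) \<Rightarrow> bool" where
  "crossed D \<longleftrightarrow> (\<forall>w\<in>carrier F. Poly_Mapping.keys (D w) \<subseteq> tuples 2 (carrier G)) \<and>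
    (\<forall>w\<in>carrier F. \<forall>v\<in>carrier F. D (w \<otimes>\<^bsub>F\<^esub> v) = D w + translate G (\<pi> w) (D v))"

lemma crossed_keys: "crossed D \<Longrightarrow> w \<in> carrier F \<Longrightarrow> Poly_Mapping.keys (D w) \<subseteq> tuples 2 (carrier G)"
  and crossed_mult: "crossed D \<Longrightarrow> w \<in> carrier F \<Longrightarrow> v \<in> carrier F \<Longrightarrow>
    D (w \<otimes>\<^bsub>F\<^esub> v) = D w + translate G (\<pi> w) (D v)"
  by (auto simp: crossed_def)

lemma fox_exists:
  assumes b: "free_basis F X" and d: "\<And>x. x \<in> X \<Longrightarrow> Poly_Mapping.keys (d x) \<subseteq> tuples 2 (carrier G)"
  obtains D where "crossed D" "\<And>x. x \<in> X \<Longrightarrow> D x = d x"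
proof -
  have X: "X \<subseteq> carrier F" using b by (simp add: free_basis_def)
  obtain \<phi> where \<phi>: "\<phi> \<in> hom F (semidirect G)" "\<And>x. x \<in> X \<Longrightarrow> \<phi> x = (d x, \<pi> x)"
    by (rule free_basis_universal [OF F.group_axioms b G.group_semidirect, of "\<lambda>x. (d x, \<pi> x)"])
      (use X d in \<open>auto simp: semidirect_def\<close>)
  have snd: "(\<lambda>p. snd p) \<in> hom (semidirect G) G"
    by (auto simp: hom_def semidirect_def)
  \<comment> \<open>The first component is crossed with respect to the second one, which therefore
    has to be identified with \<open>\<pi>\<close>.\<close>
  have s: "snd (\<phi> w) = \<pi> w" if w: "w \<in> carrier F" for w
  proof -
    have "((\<lambda>p. snd p) \<circ> \<phi>) w = \<pi> w"
      by (rule generate_hom_eqI [OF F.group_axioms G.group_axioms hom_compose [OF \<phi>(1) snd] \<pi>_hom X])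
        (use w free_basis_generate [OF F.group_axioms b] \<phi>(2) in auto)
    then show ?thesis by simp
  qed
  have "crossed (fst \<circ> \<phi>)"
    unfolding crossed_def
  proof (intro conjI ballI)
    show "Poly_Mapping.keys ((fst \<circ> \<phi>) w) \<subseteq> tuples 2 (carrier G)" if "w \<in> carrier F" for w
      using hom_in_carrier [OF \<phi>(1) that] by (auto simp: semidirect_def)
    show "(fst \<circ> \<phi>) (w \<otimes>\<^bsub>F\<^esub> v) = (fst \<circ> \<phi>) w + translate G (\<pi> w) ((fst \<circ> \<phi>) v)"
      if "w \<in> carrier F" "v \<in> carrier F" for w v
      using hom_mult [OF \<phi>(1) that] s [OF that(1)] by (simp add: semidirect_def split: prod.splits)
  qed
  then show thesis using \<phi>(2) that [of "fst \<circ> \<phi>"] by simp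
qed

lemma crossed_one:
  assumes "crossed D"
  shows "D \<one>\<^bsub>F\<^esub> = 0"
  using crossed_mult [OF assms, of "\<one>\<^bsub>F\<^esub>" "\<one>\<^bsub>F\<^esub>"] crossed_keys [OF assms, of "\<one>\<^bsub>F\<^esub>"]
  by (simp add: G.translate_one [of _ 2])

lemma crossed_inv:
  assumes D: "crossed D" and w: "w \<in> carrier F"
  shows "D (inv\<^bsub>F\<^esub> w) = - translate G (inv\<^bsub>G\<^esub> (\<pi> w)) (D w)"
  using crossed_mult [OF D, of "inv\<^bsub>F\<^esub> w" w] w crossed_one [OF D]
  by (simp add: eq_neg_iff_add_eq_0)

lemma crossed_conj:
  assumes D: "crossed D" and w: "w \<in> carrier F" and r: "r \<in> R"
  shows "D (w \<otimes>\<^bsub>F\<^esub> r \<otimes>\<^bsub>F\<^esub> inv\<^bsub>F\<^esub> w) = translate G (\<pi> w) (D r)"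
proof -
  have r': "r \<in> carrier F" "\<pi> r = \<one>\<^bsub>G\<^esub>" using r by (auto simp: R_iff)
  have "translate G (\<pi> w) (translate G (inv\<^bsub>G\<^esub> (\<pi> w)) (D w)) = D w"
    using w crossed_keys [OF D w] by (simp add: G.translate_mult [of _ 2, symmetric] G.translate_one [of _ 2])
  then show ?thesis
    using w r' crossed_inv [OF D w] by (simp add: crossed_mult [OF D] map_chain_linear)
qed

text \<open>Elements of \<open>R\<close> act trivially on chains, so on \<open>R\<close> a crossed
  homomorphism is an ordinary one with abelian target and kills commutators. Conjugation becomes
  translation by \<open>crossed_conj\<close>.\<close>

lemma crossed_induced:
  assumes D: "crossed D"
  obtains Db where "equivariant G K (std_resolution G 1) Db" "\<And>r. r \<in> R \<Longrightarrow> Db (cls r) = D r"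
proof -
  let ?R = "F\<lparr>carrier := R\<rparr>"
  have Rg: "group ?R" by (rule F.subgroup_imp_group [OF R_subgroup])
  have DR: "D (r \<otimes>\<^bsub>F\<^esub> s) = D r + D s" if "r \<in> R" "s \<in> R" for r s
    using that crossed_mult [OF D] crossed_keys [OF D] by (simp add: R_iff G.translate_one [of _ 2])
  have hom: "D \<in> hom ?R (std_resolution G 1)"
    using DR crossed_keys [OF D] by (intro homI) (simp_all add: R_iff numeral_2_eq_2)
  interpret D: group_hom ?R "std_resolution G 1" D
    by (rule group_homI [OF Rg comm_group.axioms(2) [OF comm_group_std_resolution] hom])
  have sub: "derived_set F R \<subseteq> R" by (rule F.derived_set_incl [OF order_refl R_subgroup])
  have "D s = 0" if s: "s \<in> derived_set F R" for s
  proof -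
    obtain a b where ab: "a \<in> R" "b \<in> R" "s = a \<otimes>\<^bsub>F\<^esub> b \<otimes>\<^bsub>F\<^esub> inv\<^bsub>F\<^esub> a \<otimes>\<^bsub>F\<^esub> inv\<^bsub>F\<^esub> b"
      using s by auto
    have c: "a \<in> carrier F" "b \<in> carrier F" "\<pi> a = \<one>\<^bsub>G\<^esub>" "\<pi> b = \<one>\<^bsub>G\<^esub>" using ab by (auto simp: R_iff)
    then have "D (inv\<^bsub>F\<^esub> a) = - D a" "D (inv\<^bsub>F\<^esub> b) = - D b"
      using crossed_inv [OF D] crossed_keys [OF D] by (simp_all add: G.translate_one [of _ 2])
    then show ?thesis
      using c crossed_keys [OF D, of a] crossed_keys [OF D, of b]
      by (simp add: ab(3) crossed_mult [OF D] G.translate_one [of _ 2] map_chain_linear)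
  qed
  then have "generate ?R (derived_set F R) \<subseteq> kernel ?R (std_resolution G 1) D"
    using sub by (intro hom_kills_generate Rg comm_group.axioms(2) [OF comm_group_std_resolution] hom) auto
  also have "generate ?R (derived_set F R) = derived F R"
    using F.generate_consistent [OF sub R_subgroup] by (simp add: derived_def)
  finally have "derived F R \<subseteq> kernel ?R (std_resolution G 1) D" .
  from D.FactGroup_universal_kernel [OF derived_R_normal' this]
  obtain Db where Db: "Db \<in> hom (?R Mod derived F R) (std_resolution G 1)"
    "\<And>r. r \<in> carrier ?R \<Longrightarrow> Db (derived F R #>\<^bsub>?R\<^esub> r) = D r" by blast
  have Dc: "Db (cls r) = D r" if "r \<in> R" for r
    using Db(2) [of r] that by (simp add: cls_eq)
  have "equivariant G K (std_resolution G 1) Db"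
    unfolding equivariant_def
  proof (intro conjI ballI)
    show "Db \<in> hom K (std_resolution G 1)"
      using Db(1) by (simp add: relation_module_def relation_group_def)
    fix g X assume "g \<in> carrier G" "X \<in> carrier K"
    then obtain w r where w: "w \<in> carrier F" "g = \<pi> w" "r \<in> R" "X = cls r"
      using \<pi>_surj by (metis carrier_relation_module imageE)
    then show "Db (gact K g X) = gact (std_resolution G 1) g (Db X)"
      by (simp add: gact_cls Dc conj_R crossed_conj [OF D])
  qed
  then show thesis using Dc by (rule that)
qed

lemma crossed_eq_on_generators:
  assumes D: "crossed D" and E: "crossed E" and X: "X \<subseteq> carrier F" "\<And>x. x \<in> X \<Longrightarrow> D x = E x"
    and w: "w \<in> generate F X"
  shows "D w = E w"
  using w
proof (induction rule: generate.induct)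
  case (eng x y)
  moreover have "x \<in> carrier F" "y \<in> carrier F" using eng F.generate_incl [OF X(1)] by auto
  ultimately show ?case by (simp add: crossed_mult [OF D] crossed_mult [OF E])
next
  case (inv x)
  then have "x \<in> carrier F" using X by auto
  then show ?case using inv X(2) by (simp add: crossed_inv [OF D] crossed_inv [OF E])
qed (use X in \<open>auto simp: crossed_one [OF D] crossed_one [OF E]\<close>)

end

section \<open>The presentation on all elements of the group\<close>

text \<open>The value \<open>D w\<close> is the path that the word \<open>w\<close> traces from 1 to
  \<open>\<pi> w\<close> in the complete graph on \<open>G\<close>; the generator \<open>e g\<close>
  runs along the edge from 1 to \<open>g\<close>.\<close>

locale standard_presentation = group_extension G F \<pi>
  for G :: "('g, 'b) monoid_scheme" and F :: "'u monoid" and \<pi> +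
  fixes e :: "'g \<Rightarrow> 'u" and D :: "'u \<Rightarrow> ('g list \<Rightarrow>\<^sub>0 int)"
  assumes e: "is_section e" and gen: "carrier F = generate F (e ` carrier G)"
    and D: "crossed D" and De: "g \<in> carrier G \<Longrightarrow> D (e g) = frag_of [\<one>\<^bsub>G\<^esub>, g]"
begin

lemma ec: "g \<in> carrier G \<Longrightarrow> e g \<in> carrier F" "g \<in> carrier G \<Longrightarrow> \<pi> (e g) = g"
  using e by (auto simp: is_section_def)

text \<open>A path has its end minus its start as boundary. In particular relations trace
  cycles.\<close>

lemma boundary_D:
  assumes "w \<in> carrier F"
  shows "boundary (D w) = frag_of [\<pi> w] - frag_of [\<one>\<^bsub>G\<^esub>]"
proof -
  have "w \<in> generate F (e ` carrier G)" using assms gen by simp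
  then show ?thesis
  proof (induction rule: generate.induct)
    case one
    then show ?case by (simp add: crossed_one [OF D])
  next
    case (incl x)
    then show ?case by (auto simp: De ec)
  next
    case (inv x)
    then obtain g where g: "g \<in> carrier G" "x = e g" by auto
    then show ?case
      by (simp add: crossed_inv [OF D] ec De frag_linear)
  next
    case (eng x y)
    then have "x \<in> carrier F" "y \<in> carrier F" using gen by auto
    then show ?case
      using eng by (simp add: crossed_mult [OF D] frag_linear map_chain_boundary [symmetric] map_chain_linear)
  qed
qed

text \<open>The word runs from a to b, on to c and back to a.\<close>

lemma D_sec2:
  assumes "a \<in> carrier G" "b \<in> carrier G" "c \<in> carrier G"
  shows "translate G a (D (e (inv\<^bsub>G\<^esub> a \<otimes>\<^bsub>G\<^esub> b) \<otimes>\<^bsub>F\<^esub> e (inv\<^bsub>G\<^esub> b \<otimes>\<^bsub>G\<^esub> c) \<otimes>\<^bsub>F\<^esub> inv\<^bsub>F\<^esub> (e (inv\<^bsub>G\<^esub> a \<otimes>\<^bsub>G\<^esub> c)))) = boundary_list [a, b, c]"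
  using assms
  by (simp add: crossed_mult [OF D] crossed_inv [OF D] De ec map_chain_linear inv_mult_chain G.inv_cancel_left G.m_assoc
      prepend_linear)

text \<open>The lift of \<open>x\<close> that passes through \<open>h\<close>. It is chosen so that
  the conjugation by \<open>e h\<close> hidden in \<open>sec2 e h x y\<close> is absorbed, as
  \<open>sec2_\<tau>\<close> shows.\<close>

definition \<tau> where "\<tau> h x = e h \<otimes>\<^bsub>F\<^esub> e (inv\<^bsub>G\<^esub> h \<otimes>\<^bsub>G\<^esub> x)"

lemma \<tau>: "h \<in> carrier G \<Longrightarrow> x \<in> carrier G \<Longrightarrow> \<tau> h x \<in> carrier F"
  "h \<in> carrier G \<Longrightarrow> x \<in> carrier G \<Longrightarrow> \<pi> (\<tau> h x) = x"
  by (simp_all add: \<tau>_def ec G.inv_cancel_left)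

lemma sec2_\<tau>:
  assumes "h \<in> carrier G" "x \<in> carrier G" "y \<in> carrier G"
  shows "sec2 e h x y = cls (\<tau> h x \<otimes>\<^bsub>F\<^esub> e (inv\<^bsub>G\<^esub> x \<otimes>\<^bsub>G\<^esub> y) \<otimes>\<^bsub>F\<^esub> inv\<^bsub>F\<^esub> (\<tau> h y))"
  using gact_cls [OF ec(1) sec2_R [OF e assms] ec(2) [symmetric]] assms
  by (simp add: sec2_def ec(1) \<tau>_def F.m_assoc F.inv_mult_group)

text \<open>The path in the Cayley graph that starts at \<open>g\<close> and spells the word \<open>w\<close> is sent to the loop
  \<open>\<tau>(g) w \<tau>(g w)\<^sup>-\<^sup>1\<close> closed up with the transversal \<open>\<tau>\<close>.\<close>

lemma retraction:
  assumes h: "h \<in> carrier G"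
  obtains \<phi> where "\<phi> \<in> hom (std_resolution G 1) K"
    "\<And>x y. x \<in> carrier G \<Longrightarrow> y \<in> carrier G \<Longrightarrow> \<phi> (frag_of [x, y]) = sec2 e h x y"
    "\<And>r. r \<in> R \<Longrightarrow> \<phi> (D r) = cls r"
proof -
  interpret K: comm_group K by (rule comm_group_relation_module)
  define f where "f c = sec2 e h (c ! 0) (c ! 1)" for c
  have two: "\<exists>x\<in>carrier G. \<exists>y\<in>carrier G. c = [x, y]" if "c \<in> tuples 2 (carrier G)" for c
    using that by (auto simp: tuples_def length_Suc_conv numeral_2_eq_2)
  have "f ` tuples 2 (carrier G) \<subseteq> carrier K"
    using two h cocycle_closed [OF sec2_cocycle [OF e]] by (force simp: f_def)
  then obtain \<phi> where \<phi>: "\<phi> \<in> hom (free_Abelian_group (tuples 2 (carrier G))) K"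
    "\<And>c. c \<in> tuples 2 (carrier G) \<Longrightarrow> \<phi> (frag_of c) = f c"
    by (rule K.free_Abelian_group_universal) (rule that)
  interpret \<phi>: group_hom "free_Abelian_group (tuples 2 (carrier G))" K \<phi>
    by (intro group_homI \<phi> K.group_axioms group_free_Abelian_group)
  have \<phi>2: "\<phi> (frag_of [x, y]) = sec2 e h x y" if "x \<in> carrier G" "y \<in> carrier G" for x y
    using that \<phi>(2) [of "[x, y]"] by (simp add: tuples_def f_def)
  \<comment> \<open>Arbitrary starting points \<open>g\<close> are needed, since the second part of
    a product of words starts where the first part ends.\<close>
  have main: "\<phi> (translate G g (D w)) = cls (\<tau> h g \<otimes>\<^bsub>F\<^esub> w \<otimes>\<^bsub>F\<^esub> inv\<^bsub>F\<^esub> (\<tau> h (g \<otimes>\<^bsub>G\<^esub> \<pi> w)))"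
    if "w \<in> generate F (e ` carrier G)" "g \<in> carrier G" for w g
    using that
  proof (induction arbitrary: g rule: generate.induct)
    case one
    then show ?case
      using h \<phi>.hom_one by (simp add: crossed_one [OF D] map_chain_linear \<tau> cls_one)
  next
    case (incl x)
    then obtain y where y: "y \<in> carrier G" "x = e y" by auto
    then show ?case
      using incl h by (simp add: De \<phi>2 sec2_\<tau> ec G.inv_cancel_left)
  next
    case (inv x)
    then obtain y where y: "y \<in> carrier G" "x = e y" by auto
    \<comment> \<open>The inverse of a generator runs backwards along the edge from
      \<open>?g\<close> to \<open>g\<close>.\<close>
    let ?g = "g \<otimes>\<^bsub>G\<^esub> inv\<^bsub>G\<^esub> y"
    have g': "?g \<in> carrier G" using inv y by simp
    have cl: "\<tau> h ?g \<otimes>\<^bsub>F\<^esub> e y \<otimes>\<^bsub>F\<^esub> inv\<^bsub>F\<^esub> (\<tau> h g) \<in> R"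
      using h y inv g' by (simp add: R_iff \<tau> ec G.m_assoc)
    have "translate G g (D (inv\<^bsub>F\<^esub> x)) = - frag_of [?g, g]"
      using y inv by (simp add: crossed_inv [OF D] ec De map_chain_linear G.m_assoc)
    then have "\<phi> (translate G g (D (inv\<^bsub>F\<^esub> x))) = inv\<^bsub>K\<^esub> (\<phi> (frag_of [?g, g]))"
      using \<phi>.hom_inv [of "frag_of [?g, g]"] g' inv by (simp add: tuples_def)
    also have "\<phi> (frag_of [?g, g]) = cls (\<tau> h ?g \<otimes>\<^bsub>F\<^esub> e y \<otimes>\<^bsub>F\<^esub> inv\<^bsub>F\<^esub> (\<tau> h g))"
      using g' inv h y by (simp add: \<phi>2 sec2_\<tau> G.inv_mult_group G.m_assoc)
    also have "inv\<^bsub>K\<^esub> \<dots> = cls (inv\<^bsub>F\<^esub> (\<tau> h ?g \<otimes>\<^bsub>F\<^esub> e y \<otimes>\<^bsub>F\<^esub> inv\<^bsub>F\<^esub> (\<tau> h g)))"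
      by (rule cls_inv [OF cl])
    also have "inv\<^bsub>F\<^esub> (\<tau> h ?g \<otimes>\<^bsub>F\<^esub> e y \<otimes>\<^bsub>F\<^esub> inv\<^bsub>F\<^esub> (\<tau> h g)) = \<tau> h g \<otimes>\<^bsub>F\<^esub> inv\<^bsub>F\<^esub> x \<otimes>\<^bsub>F\<^esub> inv\<^bsub>F\<^esub> (\<tau> h ?g)"
      using g' inv h y by (simp add: \<tau> ec F.inv_mult_group F.m_assoc)
    finally show ?case using y by (simp add: ec)
  next
    case (eng v w)
    have c: "v \<in> carrier F" "w \<in> carrier F" using eng gen by auto
    have gv: "g \<otimes>\<^bsub>G\<^esub> \<pi> v \<in> carrier G" using eng c by simp
    have Rvw: "\<tau> h g \<otimes>\<^bsub>F\<^esub> v \<otimes>\<^bsub>F\<^esub> inv\<^bsub>F\<^esub> (\<tau> h (g \<otimes>\<^bsub>G\<^esub> \<pi> v)) \<in> R"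
      "\<tau> h (g \<otimes>\<^bsub>G\<^esub> \<pi> v) \<otimes>\<^bsub>F\<^esub> w \<otimes>\<^bsub>F\<^esub> inv\<^bsub>F\<^esub> (\<tau> h (g \<otimes>\<^bsub>G\<^esub> \<pi> v \<otimes>\<^bsub>G\<^esub> \<pi> w)) \<in> R"
      using h eng c by (simp_all add: R_iff \<tau>)
    have "\<phi> (translate G g (D (v \<otimes>\<^bsub>F\<^esub> w))) = \<phi> (translate G g (D v) + translate G (g \<otimes>\<^bsub>G\<^esub> \<pi> v) (D w))"
      using c eng crossed_keys [OF D] by (simp add: crossed_mult [OF D] map_chain_linear G.translate_mult [of _ 2])
    also have "\<dots> = \<phi> (translate G g (D v)) \<otimes>\<^bsub>K\<^esub> \<phi> (translate G (g \<otimes>\<^bsub>G\<^esub> \<pi> v) (D w))"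
      using \<phi>.hom_mult [of "translate G g (D v)" "translate G (g \<otimes>\<^bsub>G\<^esub> \<pi> v) (D w)"] c gv eng(5)
        G.translate_keys [OF crossed_keys [OF D]] by simp
    also have "\<dots> = cls (\<tau> h g \<otimes>\<^bsub>F\<^esub> v \<otimes>\<^bsub>F\<^esub> inv\<^bsub>F\<^esub> (\<tau> h (g \<otimes>\<^bsub>G\<^esub> \<pi> v))) \<otimes>\<^bsub>K\<^esub>
        cls (\<tau> h (g \<otimes>\<^bsub>G\<^esub> \<pi> v) \<otimes>\<^bsub>F\<^esub> w \<otimes>\<^bsub>F\<^esub> inv\<^bsub>F\<^esub> (\<tau> h (g \<otimes>\<^bsub>G\<^esub> \<pi> v \<otimes>\<^bsub>G\<^esub> \<pi> w)))"
      using eng gv by simp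
    also have "\<dots> = cls (\<tau> h g \<otimes>\<^bsub>F\<^esub> (v \<otimes>\<^bsub>F\<^esub> w) \<otimes>\<^bsub>F\<^esub> inv\<^bsub>F\<^esub> (\<tau> h (g \<otimes>\<^bsub>G\<^esub> \<pi> (v \<otimes>\<^bsub>F\<^esub> w))))"
      by (rule cls_mult_eq [OF Rvw]) (use h eng(5) c gv in \<open>simp add: \<tau> F.m_assoc F.inv_cancel_left G.m_assoc\<close>)
    finally show ?case .
  qed
  have "\<phi> (D r) = cls r" if r: "r \<in> R" for r
  proof -
    have rc: "r \<in> carrier F" "\<pi> r = \<one>\<^bsub>G\<^esub>" using r by (auto simp: R_iff)
    \<comment> \<open>The loop comes out conjugated by \<open>\<tau> h 1\<close>. This lies over 1,
      so it acts on \<open>K\<close> like the unit of \<open>F\<close>.\<close>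
    have "\<phi> (translate G \<one>\<^bsub>G\<^esub> (D r)) = cls (\<tau> h \<one>\<^bsub>G\<^esub> \<otimes>\<^bsub>F\<^esub> r \<otimes>\<^bsub>F\<^esub> inv\<^bsub>F\<^esub> (\<tau> h \<one>\<^bsub>G\<^esub>))"
      using main [of r "\<one>\<^bsub>G\<^esub>"] rc gen by simp
    also have "\<dots> = gact K \<one>\<^bsub>G\<^esub> (cls r)"
      by (rule gact_cls [symmetric]) (use h r in \<open>auto simp: \<tau>\<close>)
    also have "\<dots> = cls (\<one>\<^bsub>F\<^esub> \<otimes>\<^bsub>F\<^esub> r \<otimes>\<^bsub>F\<^esub> inv\<^bsub>F\<^esub> \<one>\<^bsub>F\<^esub>)"
      by (rule gact_cls) (use r in auto)
    finally show ?thesis using rc crossed_keys [OF D] by (simp add: G.translate_one [of _ 2])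
  qed
  moreover have "\<phi> \<in> hom (std_resolution G 1) K"
    using \<phi>(1) by (simp add: hom_std_resolution numeral_2_eq_2)
  ultimately show thesis using \<phi>2 that by blast
qed

lemma retraction_data_exists:
  assumes M: "gmod G M"
  obtains Db where "retraction_data G M K (sec2 e) Db" "\<And>r. r \<in> R \<Longrightarrow> Db (cls r) = D r"
proof -
  obtain Db where Db: "equivariant G K (std_resolution G 1) Db" "\<And>r. r \<in> R \<Longrightarrow> Db (cls r) = D r"
    by (rule crossed_induced [OF D]) (rule that)
  have "retraction_data G M K (sec2 e) Db"
  proof
    show "boundary (Db X) = 0" if "X \<in> carrier K" for X
      using that boundary_D by (auto simp: carrier_relation_module Db(2) R_iff)
    show "Db (sec2 e a b c) = boundary_list [a, b, c]" if "a \<in> carrier G" "b \<in> carrier G" "c \<in> carrier G" for a b c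
      using that D_sec2 [OF that] equivariant_act [OF Db(1)] sec2_R [OF e that]
      by (simp add: sec2_def cls_closed Db(2) del: boundary_list.simps)
    fix h assume "h \<in> carrier G"
    then obtain \<phi> where "\<phi> \<in> hom (std_resolution G 1) K"
      "\<And>x y. x \<in> carrier G \<Longrightarrow> y \<in> carrier G \<Longrightarrow> \<phi> (frag_of [x, y]) = sec2 e h x y"
      "\<And>r. r \<in> R \<Longrightarrow> \<phi> (D r) = cls r"
      by (rule retraction) blast
    then show "\<exists>\<phi>\<in>hom (std_resolution G 1) K.
        (\<forall>x\<in>carrier G. \<forall>y\<in>carrier G. \<phi> (frag_of [x, y]) = sec2 e h x y) \<and> (\<forall>X\<in>carrier K. \<phi> (Db X) = X)"
      by (intro bexI [of _ \<phi>]) (auto simp: carrier_relation_module Db(2))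
  qed (fact M gmod_relation_module sec2_cocycle [OF e] Db(1))+
  then show thesis using Db(2) by (rule that)
qed

end

section \<open>Free presentations\<close>

lemma presentation_extension:
  assumes "group G" "(F, \<pi>) \<in> presentations G"
  shows "group_extension G F \<pi>"
  using assms by (simp add: presentations_def free_group_def group_extension_def group_extension_axioms_def)

text \<open>The generators are labelled by a set \<open>Y\<close> that maps onto \<open>G\<close>:
  \<open>G\<close> itself for the presentation \<open>c\<close>, and two copies of it for
  \<open>c'\<close>.\<close>

lemma free_presentation_exists:
  fixes \<iota> :: "'y \<Rightarrow> 'u" and l :: "'y \<Rightarrow> 'g"
  assumes G: "group G" and inf: "infinite (UNIV :: 'u set)" and \<iota>: "inj_on \<iota> Y" and l: "l ` Y = carrier G"
  obtains F :: "'u monoid" and \<pi> e where "(F, \<pi>) \<in> presentations G" "free_basis F (e ` Y)"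
    "inj_on e Y" "\<And>y. y \<in> Y \<Longrightarrow> \<pi> (e y) = l y"
proof -
  obtain F :: "'u monoid" and b where F: "group F" "inj_on b (\<iota> ` Y)" "free_basis F (b ` (\<iota> ` Y))"
    using free_group_exists [OF inf] .
  define e where "e = b \<circ> \<iota>"
  have inj: "inj_on e Y" using F(2) \<iota> by (simp add: e_def comp_inj_on)
  have basis: "free_basis F (e ` Y)" using F(3) by (simp add: e_def image_comp)
  have u: "(\<lambda>x. l (inv_into Y e x)) ` (e ` Y) \<subseteq> carrier G"
    using l inj by auto
  obtain \<pi> where \<pi>: "\<pi> \<in> hom F G" "\<And>x. x \<in> e ` Y \<Longrightarrow> \<pi> x = l (inv_into Y e x)"
    by (rule free_basis_universal [OF F(1) basis G u]) (rule that)
  have \<pi>e: "\<pi> (e y) = l y" if "y \<in> Y" for y using \<pi>(2) [of "e y"] that inj by simp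
  have "e ` Y \<subseteq> carrier F" using basis by (simp add: free_basis_def)
  then have "carrier G \<subseteq> \<pi> ` carrier F"
    unfolding l [symmetric] using \<pi>e by (metis image_eqI image_subset_iff subsetI)
  moreover have "\<pi> ` carrier F \<subseteq> carrier G" using hom_in_carrier [OF \<pi>(1)] by auto
  ultimately have "(F, \<pi>) \<in> presentations G"
    using F(1) basis \<pi>(1) by (auto simp: presentations_def free_group_def)
  then show thesis using basis inj \<pi>e by (rule that)
qed

lemma extension_morphism_exists:
  assumes P: "group_extension G F \<pi>" and P': "group_extension G F' \<pi>'" and basis: "free_basis F X"
    and u: "\<And>x. x \<in> X \<Longrightarrow> u x \<in> carrier F' \<and> \<pi>' (u x) = \<pi> x"
  obtains \<phi> where "extension_morphism G F \<pi> F' \<pi>' \<phi>" "\<And>x. x \<in> X \<Longrightarrow> \<phi> x = u x"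
proof -
  interpret P: group_extension G F \<pi> by fact
  interpret P': group_extension G F' \<pi>' by fact
  have X: "X \<subseteq> carrier F" using basis by (simp add: free_basis_def)
  obtain \<phi> where \<phi>: "\<phi> \<in> hom F F'" "\<And>x. x \<in> X \<Longrightarrow> \<phi> x = u x"
    by (rule free_basis_universal [OF P.F.group_axioms basis P'.F.group_axioms, of u]) (use u in blast)+
  have "extension_morphism G F \<pi> F' \<pi>' \<phi>"
  proof
    show "\<pi>' (\<phi> w) = \<pi> w" if "w \<in> carrier F" for w
    proof -
      have "(\<pi>' \<circ> \<phi>) w = \<pi> w"
        by (rule generate_hom_eqI [OF P.F.group_axioms P.G.group_axioms hom_compose [OF \<phi>(1) P'.\<pi>_hom] P.\<pi>_hom X])
          (use that \<phi>(2) u free_basis_generate [OF P.F.group_axioms basis] in auto)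
      then show ?thesis by simp
    qed
  qed (rule \<phi>(1))
  then show thesis using \<phi>(2) by (rule that)
qed

lemma presentation_homs_morphism:
  assumes "group G" "(F, \<pi>) \<in> presentations G" "(F', \<pi>') \<in> presentations G"
  shows "\<phi> \<in> presentation_homs (F, \<pi>) (F', \<pi>') \<longleftrightarrow> extension_morphism G F \<pi> F' \<pi>' \<phi>"
  using presentation_extension [OF assms(1,2)] presentation_extension [OF assms(1,3)]
  by (auto simp: presentation_homs_def extension_morphism_def extension_morphism_axioms_def)

section \<open>Transition maps of the limit\<close>

definition limit_map where
  "limit_map m G M P' \<phi> = Tmap G M (tensor_power (Suc m) (relation_module G P'))
    (power_map (Suc m) (relation_module G P') (relation_map G P' \<phi>))"

lemma (in extension_morphism) limit_map_hom:
  assumes M: "gmod G M"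
  shows "limit_map m G M (F', \<pi>') \<phi> \<in> hom (coinvariants G (tensor M (tensor_power (Suc m) P.K)))
      (coinvariants G (tensor M (tensor_power (Suc m) P'.K)))"
    and "x \<in> carrier M \<Longrightarrow> \<rho> \<in> carrier (power_group (Suc m) P.K) \<Longrightarrow>
      limit_map m G M (F', \<pi>') \<phi> (coinv_tensor G M (tensor_power (Suc m) P.K) x \<rho>) =
      coinv_tensor G M (tensor_power (Suc m) P'.K) x (power_map (Suc m) P'.K (relation_map G (F', \<pi>') \<phi>) \<rho>)"
  unfolding limit_map_def
  using Tmap_hom [OF M gmod_tensor_power [OF P.gmod_relation_module] gmod_tensor_power [OF P'.gmod_relation_module]
      power_map_equivariant [OF P.gmod_relation_module P'.gmod_relation_module relation_map_equivariant]]
  by simp_all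

lemma (in extension_morphism) J_power_map:
  assumes J': "J' \<in> hom (power_group (Suc m) P'.K) (std_resolution G k)"
    "\<And>rs. rs \<in> tuples (Suc m) (carrier P'.K) \<Longrightarrow> J' (power_class (Suc m) P'.K (frag_of rs)) = concat_list D' rs"
    and J: "J \<in> hom (power_group (Suc m) P.K) (std_resolution G k)"
    "\<And>rs. rs \<in> tuples (Suc m) (carrier P.K) \<Longrightarrow> J (power_class (Suc m) P.K (frag_of rs)) = concat_list D rs"
    and D: "\<And>X. X \<in> carrier P.K \<Longrightarrow> D' (relation_map G (F', \<pi>') \<phi> X) = D X"
    and \<rho>: "\<rho> \<in> carrier (power_group (Suc m) P.K)"
  shows "J' (power_map (Suc m) P'.K (relation_map G (F', \<pi>') \<phi>) \<rho>) = J \<rho>"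
proof -
  note pm = power_map_hom [OF P.comm_group_relation_module P'.comm_group_relation_module
      equivariant_hom [OF relation_map_equivariant]]
  have "(J' \<circ> power_map (Suc m) P'.K (relation_map G (F', \<pi>') \<phi>)) \<rho> = J \<rho>"
  proof (rule power_group_hom_eqI [OF P.comm_group_relation_module comm_group.axioms(2) [OF comm_group_std_resolution]
        hom_compose [OF pm(1) J'(1)] J(1) _ \<rho>])
    fix rs assume rs: "rs \<in> tuples (Suc m) (carrier P.K)"
    then have "map (relation_map G (F', \<pi>') \<phi>) rs \<in> tuples (Suc m) (carrier P'.K)"
      using hom_in_carrier [OF equivariant_hom [OF relation_map_equivariant]] by (auto simp: tuples_def)
    moreover have "concat_list D' (map (relation_map G (F', \<pi>') \<phi>) rs) = concat_list D rs" if "set rs \<subseteq> carrier P.K" for rs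
      using that by (induction rs) (simp_all add: D)
    ultimately show "(J' \<circ> power_map (Suc m) P'.K (relation_map G (F', \<pi>') \<phi>)) (power_class (Suc m) P.K (frag_of rs)) =
        J (power_class (Suc m) P.K (frag_of rs))"
      using rs by (simp add: pm(2) J'(2) J(2)) (simp add: tuples_def)
  qed
  then show ?thesis by simp
qed

lemma (in extension_morphism) crossed_pullback:
  assumes "P'.crossed D"
  shows "P.crossed (\<lambda>w. D (\<phi> w))"
  using assms by (auto simp: P.crossed_def P'.crossed_def \<phi>_over)

text \<open>Both equal images of \<open>t\<close> are sent on by the same map, built from
  \<open>D'\<close>. Pulled back along \<open>i1\<close> it becomes \<open>J\<close> for
  \<open>D\<close>, along \<open>i2\<close> it becomes the join of zero derivatives.\<close>

lemma equaliser_vanishes: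
  assumes rd: "retraction_data G M (relation_module G (F, \<pi>)) (group_extension.sec2 G F \<pi> e) Db"
    and Db: "\<And>r. r \<in> kernel F G \<pi> \<Longrightarrow> Db (relation_class G (F, \<pi>) r) = D r"
    and i1: "extension_morphism G F \<pi> F' \<pi>' i1" and i2: "extension_morphism G F \<pi> F' \<pi>' i2"
    and D': "group_extension.crossed G F' \<pi>' D'"
    and D1: "\<And>w. w \<in> carrier F \<Longrightarrow> D' (i1 w) = D w" and D2: "\<And>w. w \<in> carrier F \<Longrightarrow> D' (i2 w) = 0"
    and t: "t \<in> carrier (coinvariants G (tensor M (tensor_power (Suc m) (relation_module G (F, \<pi>)))))"
    and eq: "limit_map m G M (F', \<pi>') i1 t = limit_map m G M (F', \<pi>') i2 t"
  shows "Tmap G M (std_resolution G (Suc (2 * m))) (retraction_data.concat_power G (relation_module G (F, \<pi>)) Db m) t =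
    \<one>\<^bsub>coinvariants G (tensor M (std_resolution G (Suc (2 * m))))\<^esub>"
proof -
  interpret rd: retraction_data G M "relation_module G (F, \<pi>)" "group_extension.sec2 G F \<pi> e" Db m by (rule rd)
  interpret i1: extension_morphism G F \<pi> F' \<pi>' i1 by (rule i1)
  interpret i2: extension_morphism G F \<pi> F' \<pi>' i2 by (rule i2)
  let ?K = "relation_module G (F, \<pi>)" and ?K' = "relation_module G (F', \<pi>')"
  let ?C = "std_resolution G (Suc (2 * m))"
  interpret U: comm_group "coinvariants G (tensor M ?C)" by (rule rd.comm_group_Ch)
  obtain Db' where Db': "equivariant G ?K' (std_resolution G 1) Db'"
    "\<And>r. r \<in> i1.P'.R \<Longrightarrow> Db' (i1.P'.cls r) = D' r"
    by (rule i1.P'.crossed_induced [OF D']) (rule that)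
  obtain J' where J': "equivariant G (tensor_power (Suc m) ?K') ?C J'"
    "\<And>rs. rs \<in> tuples (Suc m) (carrier ?K') \<Longrightarrow> J' (power_class (Suc m) ?K' (frag_of rs)) = concat_list Db' rs"
    by (rule J_exists [OF rd.is_group i1.P'.gmod_relation_module Db'(1), of m]) (rule that)
  have J'h: "J' \<in> hom (power_group (Suc m) ?K') ?C" using equivariant_hom [OF J'(1)] by simp
  have Jh: "rd.concat_power \<in> hom (power_group (Suc m) ?K) ?C" using equivariant_hom [OF rd.concat_power_equivariant] by simp
  have zh: "(\<lambda>_. 0) \<in> hom (power_group (Suc m) ?K) ?C" by (simp add: hom_def)
  have J1: "J' (power_map (Suc m) ?K' (relation_map G (F', \<pi>') i1) \<rho>) = rd.concat_power \<rho>"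
    if \<rho>: "\<rho> \<in> carrier (power_group (Suc m) ?K)" for \<rho>
  proof (rule i1.J_power_map [OF J'h J'(2) Jh rd.concat_power_power_class _ \<rho>])
    fix X assume "X \<in> carrier ?K"
    then obtain r where r: "r \<in> i1.P.R" "X = i1.P.cls r" by (auto simp: i1.P.carrier_relation_module)
    then have "r \<in> carrier F" using i1.P.R_subset by auto
    then show "Db' (relation_map G (F', \<pi>') i1 X) = Db X"
      using r by (simp add: i1.relation_map_cls Db'(2) i1.\<phi>_R D1 Db)
  qed
  have J2: "J' (power_map (Suc m) ?K' (relation_map G (F', \<pi>') i2) \<rho>) = 0"
    if \<rho>: "\<rho> \<in> carrier (power_group (Suc m) ?K)" for \<rho>
  proof (rule i2.J_power_map [OF J'h J'(2) zh _ _ \<rho>])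
    \<comment> \<open>The empty join would be the empty simplex and not 0, so at least one tensor
      factor is needed; here n >= 1 matters.\<close>
    show "0 = concat_list (\<lambda>_. 0) rs" if "rs \<in> tuples (Suc m) (carrier ?K)" for rs
      using that by (cases rs) (auto simp: tuples_def)
    fix X assume "X \<in> carrier ?K"
    then obtain r where r: "r \<in> i1.P.R" "X = i1.P.cls r" by (auto simp: i1.P.carrier_relation_module)
    then have "r \<in> carrier F" using i1.P.R_subset by auto
    then show "Db' (relation_map G (F', \<pi>') i2 X) = 0"
      using r by (simp add: i2.relation_map_cls Db'(2) i2.\<phi>_R D2)
  qed
  note P = gmod_tensor_power [OF i1.P.gmod_relation_module, of "Suc m"]
  note T' = Tmap_hom [OF rd.M gmod_tensor_power [OF i1.P'.gmod_relation_module] gmod_std_resolution [OF rd.is_group] J'(1)]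
  have pm: "power_map (Suc m) ?K' (relation_map G (F', \<pi>') i) \<rho> \<in> carrier (tensor_power (Suc m) ?K')"
    if "\<rho> \<in> carrier (power_group (Suc m) ?K)" "extension_morphism G F \<pi> F' \<pi>' i" for i \<rho>
  proof -
    interpret i: extension_morphism G F \<pi> F' \<pi>' i by (rule that(2))
    show ?thesis
      using hom_in_carrier [OF power_map_hom(1) [OF i1.P.comm_group_relation_module i1.P'.comm_group_relation_module
            equivariant_hom [OF i.relation_map_equivariant]] that(1)] by simp
  qed
  have e1: "(Tmap G M ?C J' \<circ> limit_map m G M (F', \<pi>') i1) t = Tmap G M ?C rd.concat_power t"
  proof (rule T_hom_eqI [OF rd.M P U.is_group hom_compose [OF i1.limit_map_hom(1) [OF rd.M] T'(1)] rd.JT(1) _ t])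
    fix x \<rho> assume "x \<in> carrier M" "\<rho> \<in> carrier (tensor_power (Suc m) ?K)"
    then show "(Tmap G M ?C J' \<circ> limit_map m G M (F', \<pi>') i1) (coinv_tensor G M (tensor_power (Suc m) ?K) x \<rho>) =
        Tmap G M ?C rd.concat_power (coinv_tensor G M (tensor_power (Suc m) ?K) x \<rho>)"
      using pm [OF _ i1] T'(2) by (simp add: i1.limit_map_hom(2) [OF rd.M] rd.JT(2) J1 del: tensor_power_simps(1))
        (simp add: i1.limit_map_hom(2) [OF rd.M] rd.JT(2) J1)
  qed
  have one: "(\<lambda>_. \<one>\<^bsub>coinvariants G (tensor M ?C)\<^esub>) \<in> hom (coinvariants G (tensor M (tensor_power (Suc m) ?K)))
      (coinvariants G (tensor M ?C))" by (simp add: hom_def)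
  have e2: "(Tmap G M ?C J' \<circ> limit_map m G M (F', \<pi>') i2) t = (\<lambda>_. \<one>\<^bsub>coinvariants G (tensor M ?C)\<^esub>) t"
  proof (rule T_hom_eqI [OF rd.M P U.is_group hom_compose [OF i2.limit_map_hom(1) [OF rd.M] T'(1)] one _ t])
    fix x \<rho> assume x: "x \<in> carrier M" "\<rho> \<in> carrier (tensor_power (Suc m) ?K)"
    then show "(Tmap G M ?C J' \<circ> limit_map m G M (F', \<pi>') i2) (coinv_tensor G M (tensor_power (Suc m) ?K) x \<rho>) =
        \<one>\<^bsub>coinvariants G (tensor M ?C)\<^esub>"
      using pm [OF _ i2, of \<rho>] T'(2) [OF x(1), of "power_map (Suc m) ?K' (relation_map G (F', \<pi>') i2) \<rho>"]
      by (simp add: i2.limit_map_hom(2) [OF rd.M] J2 rd.cc_zero)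
  qed
  show ?thesis using e1 e2 eq by simp
qed

text \<open>After this lemma neither joins nor Fox calculus occur: the limit is computed from the
  existence of morphisms out of \<open>c\<close>, the injectivity of \<Theta> there and the
  description of its image.\<close>

lemma standard_presentation_exists:
  fixes \<iota> :: "'g \<Rightarrow> 'u" and G :: "('g, 'b) monoid_scheme" and M :: "('g, 'm) gmodule"
  assumes G: "group G" and M: "gmod G M" and inf: "infinite (UNIV :: 'u set)" and \<iota>: "inj_on \<iota> (carrier G)"
  obtains F :: "'u monoid" and \<pi> e where
    "(F, \<pi>) \<in> presentations G" "group_extension.is_section G F \<pi> e"
    "\<And>P'. P' \<in> (presentations G :: ('u, 'g) presentation set) \<Longrightarrow> presentation_homs (F, \<pi>) P' \<noteq> {}"
    "\<And>y. y \<in> carrier (chains G M (Suc (Suc (2 * m)))) \<Longrightarrow>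
      chain_boundary G M (Suc (2 * m)) y = \<one>\<^bsub>chains G M (Suc (2 * m))\<^esub> \<Longrightarrow>
      ThetaH m G M (relation_module G (F, \<pi>)) (group_extension.sec2 G F \<pi> e) y =
        \<one>\<^bsub>coinvariants G (tensor M (tensor_power (Suc m) (relation_module G (F, \<pi>))))\<^esub> \<Longrightarrow>
      y \<in> chain_boundary G M (Suc (Suc (2 * m))) ` carrier (chains G M (Suc (Suc (Suc (2 * m)))))"
    "\<And>t. t \<in> carrier (coinvariants G (tensor M (tensor_power (Suc m) (relation_module G (F, \<pi>))))) \<Longrightarrow>
      \<forall>P'\<in>presentations G. \<forall>\<phi>\<in>presentation_homs (F, \<pi>) P'. \<forall>\<psi>\<in>presentation_homs (F, \<pi>) P'.
        limit_map m G M P' \<phi> t = limit_map m G M P' \<psi> t \<Longrightarrow>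
      \<exists>y\<in>carrier (chains G M (Suc (Suc (2 * m)))).
        chain_boundary G M (Suc (2 * m)) y = \<one>\<^bsub>chains G M (Suc (2 * m))\<^esub> \<and>
        ThetaH m G M (relation_module G (F, \<pi>)) (group_extension.sec2 G F \<pi> e) y = t"
proof -
  interpret G: group G by (rule G)
  obtain F :: "'u monoid" and \<pi> e where F: "(F, \<pi>) \<in> presentations G" "free_basis F (e ` carrier G)"
    "inj_on e (carrier G)" "\<And>g. g \<in> carrier G \<Longrightarrow> \<pi> (e g) = g"
    by (rule free_presentation_exists [OF G inf \<iota>, where l="\<lambda>g. g"]) auto
  interpret P: group_extension G F \<pi> by (rule presentation_extension [OF G F(1)])
  have eF: "e ` carrier G \<subseteq> carrier F" using F(2) by (simp add: free_basis_def)
  obtain D where D: "P.crossed D" "\<And>x. x \<in> e ` carrier G \<Longrightarrow> D x = frag_of [\<one>\<^bsub>G\<^esub>, \<pi> x]"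
    by (rule P.fox_exists [OF F(2), of "\<lambda>x. frag_of [\<one>\<^bsub>G\<^esub>, \<pi> x]"]) (use F(4) in \<open>auto simp: tuples_def\<close>)
  interpret S: standard_presentation G F \<pi> e D
    by unfold_locales
      (use eF F(4) D free_basis_generate [OF P.F.group_axioms F(2)] in \<open>auto simp: P.is_section_def\<close>)
  obtain Db where rd: "retraction_data G M P.K (P.sec2 e) Db" and Db: "\<And>r. r \<in> P.R \<Longrightarrow> Db (P.cls r) = D r"
    by (rule S.retraction_data_exists [OF M]) (rule that)
  interpret rd: retraction_data G M P.K "P.sec2 e" Db m by (rule rd)
  obtain enc :: "('u \<times> bool) list \<Rightarrow> 'u" where enc: "inj enc" using word_encoding [OF inf] .
  \<comment> \<open>The two copies of \<open>G\<close> are told apart by the sign of a one-letter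
    word.\<close>
  define \<iota>' where "\<iota>' = (\<lambda>(g, b). enc [(\<iota> g, b)])"
  have \<iota>': "inj_on \<iota>' (carrier G \<times> UNIV)"
    using enc \<iota> by (auto simp: \<iota>'_def inj_on_def inj_def)
  obtain F' :: "'u monoid" and \<pi>' e' where F': "(F', \<pi>') \<in> presentations G" "free_basis F' (e' ` (carrier G \<times> UNIV))"
    "inj_on e' (carrier G \<times> UNIV)" "\<And>p. p \<in> carrier G \<times> (UNIV :: bool set) \<Longrightarrow> \<pi>' (e' p) = fst p"
    by (rule free_presentation_exists [OF G inf \<iota>', where l=fst]) auto
  interpret P': group_extension G F' \<pi>' by (rule presentation_extension [OF G F'(1)])
  have e'F: "e' ` (carrier G \<times> UNIV) \<subseteq> carrier F'" using F'(2) by (simp add: free_basis_def)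
  \<comment> \<open>The derivative that sees only the copy labelled \<open>True\<close>.\<close>
  define d where "d x = (if snd (inv_into (carrier G \<times> UNIV) e' x) then frag_of [\<one>\<^bsub>G\<^esub>, \<pi>' x] else 0)" for x
  have de: "d (e' (g, b)) = (if b then frag_of [\<one>\<^bsub>G\<^esub>, g] else 0)" if "g \<in> carrier G" for g b
    using that F'(3,4) by (simp add: d_def)
  obtain D' where D': "P'.crossed D'" "\<And>x. x \<in> e' ` (carrier G \<times> UNIV) \<Longrightarrow> D' x = d x"
    by (rule P'.fox_exists [OF F'(2), of d]) (use de in \<open>auto simp: tuples_def split: if_splits\<close>)
  have copy: "\<exists>i. extension_morphism G F \<pi> F' \<pi>' i \<and> (\<forall>g\<in>carrier G. i (e g) = e' (g, b))" for b
  proof -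
    obtain i where "extension_morphism G F \<pi> F' \<pi>' i" "\<And>x. x \<in> e ` carrier G \<Longrightarrow> i x = e' (\<pi> x, b)"
      by (rule extension_morphism_exists [OF P.group_extension_axioms P'.group_extension_axioms F(2), of "\<lambda>x. e' (\<pi> x, b)"])
        (use F(4) F'(4) e'F in auto)
    then show ?thesis using F(4) by auto
  qed
  obtain i1 where i1: "extension_morphism G F \<pi> F' \<pi>' i1" "\<And>g. g \<in> carrier G \<Longrightarrow> i1 (e g) = e' (g, True)"
    using copy by blast
  obtain i2 where i2: "extension_morphism G F \<pi> F' \<pi>' i2" "\<And>g. g \<in> carrier G \<Longrightarrow> i2 (e g) = e' (g, False)"
    using copy by blast
  interpret i1: extension_morphism G F \<pi> F' \<pi>' i1 by (rule i1)
  interpret i2: extension_morphism G F \<pi> F' \<pi>' i2 by (rule i2)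
  have D1: "D' (i1 w) = D w" if "w \<in> carrier F" for w
  proof (rule P.crossed_eq_on_generators [OF i1.crossed_pullback [OF D'(1)] D(1) eF])
    show "D' (i1 x) = D x" if "x \<in> e ` carrier G" for x
      using that D(2) D'(2) de F(4) i1(2) by auto
  qed (use that S.gen in simp)
  have zero: "P.crossed (\<lambda>_. 0)" by (simp add: P.crossed_def map_chain_linear)
  have D2: "D' (i2 w) = 0" if "w \<in> carrier F" for w
  proof (rule P.crossed_eq_on_generators [OF i2.crossed_pullback [OF D'(1)] zero eF])
    show "D' (i2 x) = 0" if "x \<in> e ` carrier G" for x
      using that D'(2) de i2(2) by auto
  qed (use that S.gen in simp)
  show thesis
  proof (rule that [OF F(1) S.e])
    fix P' :: "('u, 'g) presentation" assume P': "P' \<in> presentations G"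
    obtain F'' \<pi>'' where P'': "P' = (F'', \<pi>'')" by (cases P')
    interpret Q: group_extension G F'' \<pi>'' using P' unfolding P'' by (rule presentation_extension [OF G])
    have "\<forall>x\<in>e ` carrier G. \<exists>u. u \<in> carrier F'' \<and> \<pi>'' u = \<pi> x"
    proof
      fix x assume "x \<in> e ` carrier G"
      then have "\<pi> x \<in> \<pi>'' ` carrier F''" using F(4) by (auto simp only: Q.\<pi>_surj)
      then obtain u where "\<pi> x = \<pi>'' u" "u \<in> carrier F''" by (rule imageE)
      then show "\<exists>u. u \<in> carrier F'' \<and> \<pi>'' u = \<pi> x" by (intro exI [of _ u]) simp
    qed
    from bchoice [OF this] obtain u where
      u: "\<forall>x\<in>e ` carrier G. u x \<in> carrier F'' \<and> \<pi>'' (u x) = \<pi> x" ..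
    obtain \<phi> where "extension_morphism G F \<pi> F'' \<pi>'' \<phi>"
      by (rule extension_morphism_exists [OF P.group_extension_axioms Q.group_extension_axioms F(2), of u])
        (use u in blast)+
    then show "presentation_homs (F, \<pi>) P' \<noteq> {}"
      using presentation_homs_morphism [OF G F(1), of F'' \<pi>''] P' P'' by blast
  next
    fix y assume "y \<in> carrier (chains G M (Suc (Suc (2 * m))))"
      "chain_boundary G M (Suc (2 * m)) y = \<one>\<^bsub>chains G M (Suc (2 * m))\<^esub>"
      "ThetaH m G M (relation_module G (F, \<pi>)) (group_extension.sec2 G F \<pi> e) y =
        \<one>\<^bsub>coinvariants G (tensor M (tensor_power (Suc m) (relation_module G (F, \<pi>))))\<^esub>"
    then show "y \<in> chain_boundary G M (Suc (Suc (2 * m))) ` carrier (chains G M (Suc (Suc (Suc (2 * m)))))"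
      using rd.ThetaT_injective [of y] by blast
  next
    fix t assume t: "t \<in> carrier (coinvariants G (tensor M (tensor_power (Suc m) (relation_module G (F, \<pi>)))))"
      and eq: "\<forall>P'\<in>presentations G. \<forall>\<phi>\<in>presentation_homs (F, \<pi>) P'. \<forall>\<psi>\<in>presentation_homs (F, \<pi>) P'.
        limit_map m G M P' \<phi> t = limit_map m G M P' \<psi> t"
    have "limit_map m G M (F', \<pi>') i1 t = limit_map m G M (F', \<pi>') i2 t"
      using bspec [OF eq F'(1)] presentation_homs_morphism [OF G F(1) F'(1)] i1(1) i2(1) by blast
    from equaliser_vanishes [OF rd Db i1(1) i2(1) D'(1) D1 D2 t this]
    show "\<exists>y\<in>carrier (chains G M (Suc (Suc (2 * m)))).
        chain_boundary G M (Suc (2 * m)) y = \<one>\<^bsub>chains G M (Suc (2 * m))\<^esub> \<and>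
        ThetaH m G M (relation_module G (F, \<pi>)) (group_extension.sec2 G F \<pi> e) y = t"
      using rd.ThetaT_surjective [OF t] by blast
  qed
qed

section \<open>Limits\<close>

text \<open>A map into the limit needs one section for each presentation. The choices need not be
  compatible, since \<Theta> does not depend on them on cycles.\<close>

definition chosen_section :: "('g, 'b) monoid_scheme \<Rightarrow> ('u, 'g) presentation \<Rightarrow> 'g \<Rightarrow> 'u" where
  "chosen_section G P g = (SOME w. w \<in> carrier (fst P) \<and> snd P w = g)"

lemma chosen_section:
  assumes "group G" "(F, \<pi>) \<in> presentations G"
  shows "group_extension.is_section G F \<pi> (chosen_section G (F, \<pi>))"
proof -
  interpret group_extension G F \<pi> by (rule presentation_extension [OF assms])
  have "\<exists>w. w \<in> carrier F \<and> \<pi> w = g" if "g \<in> carrier G" for g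
    using that \<pi>_surj by (metis imageE)
  then show ?thesis
    unfolding is_section_def chosen_section_def by (metis (mono_tags, lifting) fst_conv snd_conv someI_ex)
qed

definition chosen_cocycle where
  "chosen_cocycle G P = group_extension.sec2 G (fst P) (snd P) (chosen_section G P)"

lemma limit_group_simps:
  "limit_group Obj Hom A A_map = (product_group Obj A)\<lparr>carrier := carrier (limit_group Obj Hom A A_map)\<rparr>"
  "x \<in> carrier (limit_group Obj Hom A A_map) \<longleftrightarrow> x \<in> (\<Pi>\<^sub>E c\<in>Obj. carrier (A c)) \<and>
    (\<forall>c\<in>Obj. \<forall>c'\<in>Obj. \<forall>a\<in>Hom c c'. A_map c c' a (x c) = x c')"
  by (simp_all add: limit_group_def)

lemma mult_limit_group:
  "x \<otimes>\<^bsub>limit_group Obj Hom A A_map\<^esub> y = (\<lambda>c\<in>Obj. x c \<otimes>\<^bsub>A c\<^esub> y c)"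
  by (simp add: limit_group_def)

lemma is_iso_Mod_image:
  assumes "group A" "group B" "h \<in> hom A B" "N = kernel A B h" "h ` carrier A = L"
  shows "A Mod N \<cong> B\<lparr>carrier := L\<rparr>"
proof -
  interpret h: group_hom A B h using assms by (intro group_homI)
  have L: "subgroup L B" using h.img_is_subgroup assms(5) by simp
  have "h \<in> hom A (B\<lparr>carrier := L\<rparr>)"
    using assms(5) by (intro homI) auto
  then have "group_hom A (B\<lparr>carrier := L\<rparr>) h"
    using h.H.subgroup_imp_group [OF L] by (intro group_homI assms(1))
  then have "A Mod kernel A (B\<lparr>carrier := L\<rparr>) h \<cong> B\<lparr>carrier := L\<rparr>"
    by (rule group_hom.FactGroup_iso) (simp add: assms(5))
  then show ?thesis by (simp add: assms(4) kernel_def)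
qed

theorem homology_limit_iso:
  fixes G :: "('g, 'b) monoid_scheme" and M :: "('g, 'm) gmodule" and \<iota> :: "'g \<Rightarrow> 'u"
  assumes G: "group G" and M: "gmod G M" and inf: "infinite (UNIV :: 'u set)" and \<iota>: "inj_on \<iota> (carrier G)"
  shows "group_homology G M (Suc (Suc (2 * m))) \<cong>
    limit_group (presentations G :: ('u, 'g) presentation set) presentation_homs
      (\<lambda>P. coinvariants G (tensor M (tensor_power (Suc m) (relation_module G P))))
      (\<lambda>P P' \<phi>. limit_map m G M P' \<phi>)"
proof -
  let ?Obj = "presentations G :: ('u, 'g) presentation set"
  let ?A = "\<lambda>P. coinvariants G (tensor M (tensor_power (Suc m) (relation_module G P)))"
  let ?L = "limit_group ?Obj presentation_homs ?A (\<lambda>P P' \<phi>. limit_map m G M P' \<phi>)"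
  let ?C = "chains G M (Suc (Suc (2 * m)))" and ?d = "chain_boundary G M (Suc (2 * m))"
  let ?Z = "homology_cycles G M (Suc (Suc (2 * m)))"
  let ?B = "chain_boundary G M (Suc (Suc (2 * m))) ` carrier (chains G M (Suc (Suc (Suc (2 * m)))))"
  let ?th = "\<lambda>P. ThetaH m G M (relation_module G P) (chosen_cocycle G P)"
  define h where "h y = (\<lambda>P\<in>?Obj. ?th P y)" for y
  have Z: "y \<in> ?Z \<longleftrightarrow> y \<in> carrier ?C \<and> ?d y = \<one>\<^bsub>chains G M (Suc (2 * m))\<^esub>" for y
    by (simp add: homology_cycles_def kernel_def homology_chains_def homology_boundary_eq)
  interpret C: comm_group ?C by (rule comm_group_chains [OF G M])
  interpret C': comm_group "chains G M (Suc (2 * m))" by (rule comm_group_chains [OF G M])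
  interpret d: group_hom ?C "chains G M (Suc (2 * m))" ?d
    by (intro group_homI C.is_group C'.is_group chain_boundary_hom [OF G M])
  have subZ: "subgroup ?Z ?C"
    using d.subgroup_kernel by (simp add: homology_cycles_def homology_chains_def homology_boundary_eq)
  have ext: "group_extension G F \<pi>" if "(F, \<pi>) \<in> ?Obj" for F \<pi>
    using presentation_extension [OF G that] .
  have gm: "gmod G (relation_module G P)" and co: "cocycle G (relation_module G P) (chosen_cocycle G P)"
    if "P \<in> ?Obj" for P
  proof -
    obtain F \<pi> where P: "P = (F, \<pi>)" by (cases P)
    interpret group_extension G F \<pi> using that ext P by simp
    show "gmod G (relation_module G P)" using gmod_relation_module by (simp add: P)
    show "cocycle G (relation_module G P) (chosen_cocycle G P)"
      using sec2_cocycle [OF chosen_section [OF G]] that by (simp add: P chosen_cocycle_def)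
  qed
  have grpA: "comm_group (?A P)" if "P \<in> ?Obj" for P
    using comm_group_T [OF M gmod_tensor_power [OF gm [OF that]]] .
  have prod: "group (product_group ?Obj ?A)"
    using grpA by (simp add: comm_group.axioms)
  have th: "?th P \<in> hom ?C (?A P)" if "P \<in> ?Obj" for P
    using ThetaH_hom(1) [OF G M gm [OF that] co [OF that]] .
  \<comment> \<open>On cycles any section may replace the chosen one. This is used for transported
    sections and for the section \<open>e\<close> of \<open>c\<close>.\<close>
  have section_change: "ThetaH m G M (relation_module G (F, \<pi>)) (group_extension.sec2 G F \<pi> s) y = ?th (F, \<pi>) y"
    if P: "(F, \<pi>) \<in> ?Obj" and s: "group_extension.is_section G F \<pi> s" and y: "y \<in> ?Z" for F \<pi> s y
  proof -
    interpret group_extension G F \<pi> by (rule ext [OF P])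
    note c = chosen_section [OF G P]
    show ?thesis
      using ThetaH_cohomotopic [OF G M gmod_relation_module sec2_cocycle [OF c] sec2_cocycle [OF s] sec1_cohomotopy [OF c s]]
        y by (simp add: Z chosen_cocycle_def)
  qed
  have natural: "limit_map m G M P' \<phi> (?th P y) = ?th P' y"
    if P: "P \<in> ?Obj" and P': "P' \<in> ?Obj" and \<phi>: "\<phi> \<in> presentation_homs P P'" and y: "y \<in> ?Z" for P P' \<phi> y
  proof -
    obtain F \<pi> F' \<pi>' where PP: "P = (F, \<pi>)" "P' = (F', \<pi>')" by (cases P, cases P')
    have mor: "extension_morphism G F \<pi> F' \<pi>' \<phi>"
      using presentation_homs_morphism [OF G] P P' \<phi> unfolding PP by blast
    interpret mor: extension_morphism G F \<pi> F' \<pi>' \<phi> by (rule mor)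
    have s: "mor.P.is_section (chosen_section G (F, \<pi>))" using chosen_section [OF G] P PP by blast
    have "limit_map m G M P' \<phi> (?th P y) =
        ThetaH m G M (relation_module G P') (mor.P'.sec2 (\<lambda>g. \<phi> (chosen_section G P g))) y"
      unfolding limit_map_def chosen_cocycle_def PP fst_conv snd_conv
      by (rule ThetaH_natural [OF G M mor s]) (use y Z in blast)
    also have "\<dots> = ?th P' y"
      using section_change [OF _ mor.is_section_compose [OF s] y] P' by (simp add: PP)
    finally show ?thesis .
  qed
  have hom: "h \<in> hom (?C\<lparr>carrier := ?Z\<rparr>) (product_group ?Obj ?A)"
  proof (rule homI)
    show "h y \<in> carrier (product_group ?Obj ?A)" if "y \<in> carrier (?C\<lparr>carrier := ?Z\<rparr>)" for y
      using that th by (auto simp: h_def Z dest: hom_in_carrier)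
    show "h (x \<otimes>\<^bsub>?C\<lparr>carrier := ?Z\<rparr>\<^esub> y) = h x \<otimes>\<^bsub>product_group ?Obj ?A\<^esub> h y"
      if "x \<in> carrier (?C\<lparr>carrier := ?Z\<rparr>)" "y \<in> carrier (?C\<lparr>carrier := ?Z\<rparr>)" for x y
      unfolding h_def mult_product_group
    proof (rule restrict_ext)
      fix P assume P: "P \<in> ?Obj"
      show "?th P (x \<otimes>\<^bsub>?C\<lparr>carrier := ?Z\<rparr>\<^esub> y) = (\<lambda>P\<in>?Obj. ?th P x) P \<otimes>\<^bsub>?A P\<^esub> (\<lambda>P\<in>?Obj. ?th P y) P"
        using that hom_mult [OF th [OF P], of x y] P by (simp add: Z)
    qed
  qed
  obtain F :: "'u monoid" and \<pi> e where std: "(F, \<pi>) \<in> ?Obj" "group_extension.is_section G F \<pi> e"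
    "\<And>P'. P' \<in> ?Obj \<Longrightarrow> presentation_homs (F, \<pi>) P' \<noteq> {}"
    "\<And>y. y \<in> carrier ?C \<Longrightarrow> ?d y = \<one>\<^bsub>chains G M (Suc (2 * m))\<^esub> \<Longrightarrow>
      ThetaH m G M (relation_module G (F, \<pi>)) (group_extension.sec2 G F \<pi> e) y = \<one>\<^bsub>?A (F, \<pi>)\<^esub> \<Longrightarrow> y \<in> ?B"
    "\<And>t. t \<in> carrier (?A (F, \<pi>)) \<Longrightarrow>
      \<forall>P'\<in>?Obj. \<forall>\<phi>\<in>presentation_homs (F, \<pi>) P'. \<forall>\<psi>\<in>presentation_homs (F, \<pi>) P'.
        limit_map m G M P' \<phi> t = limit_map m G M P' \<psi> t \<Longrightarrow>
      \<exists>y\<in>carrier ?C. ?d y = \<one>\<^bsub>chains G M (Suc (2 * m))\<^esub> \<and>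
        ThetaH m G M (relation_module G (F, \<pi>)) (group_extension.sec2 G F \<pi> e) y = t"
    by (rule standard_presentation_exists [OF G M inf \<iota>, of m]) (rule that)
  \<comment> \<open>The component at \<open>c\<close> alone already detects boundaries.\<close>
  have ker: "?B = kernel (?C\<lparr>carrier := ?Z\<rparr>) (product_group ?Obj ?A) h"
  proof
    show "?B \<subseteq> kernel (?C\<lparr>carrier := ?Z\<rparr>) (product_group ?Obj ?A) h"
    proof
      fix b assume "b \<in> ?B"
      then obtain x where x: "x \<in> carrier (chains G M (Suc (Suc (Suc (2 * m)))))"
        "b = chain_boundary G M (Suc (Suc (2 * m))) x" by blast
      have "?th P b = \<one>\<^bsub>?A P\<^esub>" if "P \<in> ?Obj" for P
        unfolding x(2) by (rule ThetaH_boundary [OF G M gm [OF that] co [OF that] x(1)])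
      moreover have "b \<in> ?Z"
        using x hom_in_carrier [OF chain_boundary_hom [OF G M] x(1)] chain_boundary_boundary [OF G M x(1)] by (simp add: Z)
      ultimately show "b \<in> kernel (?C\<lparr>carrier := ?Z\<rparr>) (product_group ?Obj ?A) h"
        by (auto simp: kernel_def h_def intro!: restrict_ext)
    qed
    show "kernel (?C\<lparr>carrier := ?Z\<rparr>) (product_group ?Obj ?A) h \<subseteq> ?B"
    proof
      fix y assume "y \<in> kernel (?C\<lparr>carrier := ?Z\<rparr>) (product_group ?Obj ?A) h"
      then have y: "y \<in> ?Z" and "h y = (\<lambda>P\<in>?Obj. \<one>\<^bsub>?A P\<^esub>)" by (simp_all add: kernel_def)
      from fun_cong [OF this(2), of "(F, \<pi>)"] have "?th (F, \<pi>) y = \<one>\<^bsub>?A (F, \<pi>)\<^esub>"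
        using std(1) by (simp add: h_def)
      then show "y \<in> ?B"
        using std(4) [of y] section_change [OF std(1,2) y] y by (simp add: Z)
    qed
  qed
  have img: "h ` carrier (?C\<lparr>carrier := ?Z\<rparr>) = carrier ?L"
  proof
    show "h ` carrier (?C\<lparr>carrier := ?Z\<rparr>) \<subseteq> carrier ?L"
      using natural hom_in_carrier [OF hom] by (auto simp: limit_group_simps(2) h_def)
    show "carrier ?L \<subseteq> h ` carrier (?C\<lparr>carrier := ?Z\<rparr>)"
    proof
      fix x assume "x \<in> carrier ?L"
      then have x: "x \<in> (\<Pi>\<^sub>E P\<in>?Obj. carrier (?A P))"
        "\<And>P P' \<phi>. P \<in> ?Obj \<Longrightarrow> P' \<in> ?Obj \<Longrightarrow> \<phi> \<in> presentation_homs P P' \<Longrightarrow> limit_map m G M P' \<phi> (x P) = x P'"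
        by (simp_all add: limit_group_simps(2))
      \<comment> \<open>Members of the limit satisfy the equaliser condition at \<open>c\<close>:
        both images are the component of \<open>x\<close> at the target.\<close>
      have "x (F, \<pi>) \<in> carrier (?A (F, \<pi>))" using x(1) std(1) by (rule PiE_mem)
      then obtain y where y: "y \<in> ?Z"
        "ThetaH m G M (relation_module G (F, \<pi>)) (group_extension.sec2 G F \<pi> e) y = x (F, \<pi>)"
        using std(5) [of "x (F, \<pi>)"] x(2) [OF std(1)] by (auto simp: Z)
      \<comment> \<open>A morphism from \<open>c\<close> to \<open>P\<close> carries the agreement
        at \<open>c\<close> over to \<open>P\<close>.\<close>
      have "h y P = x P" if P: "P \<in> ?Obj" for P
      proof -
        obtain \<phi> where \<phi>: "\<phi> \<in> presentation_homs (F, \<pi>) P" using std(3) [OF P] by blast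
        have "h y P = limit_map m G M P \<phi> (?th (F, \<pi>) y)"
          using natural [OF std(1) P \<phi> y(1)] P by (simp add: h_def)
        also have "\<dots> = x P"
          using section_change [OF std(1,2) y(1)] y(2) x(2) [OF std(1) P \<phi>] by simp
        finally show ?thesis .
      qed
      then have "h y = x"
        using x(1) by (intro extensionalityI [of _ ?Obj]) (auto simp: h_def PiE_def)
      then show "x \<in> h ` carrier (?C\<lparr>carrier := ?Z\<rparr>)" using y(1) by auto
    qed
  qed
  have "?C\<lparr>carrier := ?Z\<rparr> Mod ?B \<cong> (product_group ?Obj ?A)\<lparr>carrier := carrier ?L\<rparr>"
    by (rule is_iso_Mod_image [OF C.subgroup_imp_group [OF subZ] prod hom ker img])
  then show ?thesis
    unfolding group_homology_def homology_chains_def homology_boundary_eq limit_group_simps(1) [symmetric] .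
qed

section \<open>Trivial coefficients\<close>

text \<open>The transition maps are total functions, so that they respect the carriers is a separate
  hypothesis; it allows injectivity of \<open>\<psi>\<close> to be applied to their values when a
  family is pulled back.\<close>

lemma limit_group_natural_iso:
  assumes iso: "\<And>c. c \<in> Obj \<Longrightarrow> \<psi> c \<in> iso (A c) (B c)"
    and A_map: "\<And>c c' a x. c \<in> Obj \<Longrightarrow> c' \<in> Obj \<Longrightarrow> a \<in> Hom c c' \<Longrightarrow> x \<in> carrier (A c) \<Longrightarrow>
      A_map c c' a x \<in> carrier (A c')"
    and nat: "\<And>c c' a x. c \<in> Obj \<Longrightarrow> c' \<in> Obj \<Longrightarrow> a \<in> Hom c c' \<Longrightarrow> x \<in> carrier (A c) \<Longrightarrow>
      \<psi> c' (A_map c c' a x) = B_map c c' a (\<psi> c x)"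
  shows "limit_group Obj Hom A A_map \<cong> limit_group Obj Hom B B_map"
proof -
  let ?A = "limit_group Obj Hom A A_map" and ?B = "limit_group Obj Hom B B_map"
  define h where "h x = (\<lambda>c\<in>Obj. \<psi> c (x c))" for x
  have bij: "bij_betw (\<psi> c) (carrier (A c)) (carrier (B c))" and hom: "\<psi> c \<in> hom (A c) (B c)" if "c \<in> Obj" for c
    using iso [OF that] by (auto simp: iso_def)
  have Ac: "x c \<in> carrier (A c)" if "x \<in> carrier ?A" "c \<in> Obj" for x c
    using that by (auto simp: limit_group_simps(2))
  have hom_h: "h \<in> hom ?A ?B"
  proof (rule homI)
    show "h x \<in> carrier ?B" if x: "x \<in> carrier ?A" for x
      unfolding limit_group_simps(2)
    proof (intro conjI ballI PiE_I)
      show "h x c \<in> carrier (B c)" if "c \<in> Obj" for c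
        using hom_in_carrier [OF hom [OF that] Ac [OF x that]] that by (simp add: h_def)
      show "B_map c c' a (h x c) = h x c'" if "c \<in> Obj" "c' \<in> Obj" "a \<in> Hom c c'" for c c' a
        using nat [OF that Ac [OF x that(1)]] x that by (simp add: h_def limit_group_simps(2))
    qed (simp add: h_def)
    show "h (x \<otimes>\<^bsub>?A\<^esub> y) = h x \<otimes>\<^bsub>?B\<^esub> h y" if "x \<in> carrier ?A" "y \<in> carrier ?A" for x y
      unfolding h_def mult_limit_group
      using that Ac by (intro restrict_ext) (simp add: hom_mult [OF hom])
  qed
  have inj: "inj_on h (carrier ?A)"
  proof (rule inj_onI)
    fix x y assume xy: "x \<in> carrier ?A" "y \<in> carrier ?A" "h x = h y"
    have "x c = y c" if c: "c \<in> Obj" for c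
    proof -
      have "\<psi> c (x c) = \<psi> c (y c)" using fun_cong [OF xy(3), of c] c by (simp add: h_def)
      then show ?thesis using bij [OF c] Ac xy c by (meson bij_betw_def inj_onD)
    qed
    then show "x = y"
      using xy(1,2) by (intro extensionalityI [of _ Obj]) (auto simp: limit_group_simps(2) PiE_def)
  qed
  have "carrier ?B \<subseteq> h ` carrier ?A"
  proof
    fix y assume y: "y \<in> carrier ?B"
    define x where "x = (\<lambda>c\<in>Obj. inv_into (carrier (A c)) (\<psi> c) (y c))"
    have yc: "y c \<in> carrier (B c)" if "c \<in> Obj" for c using y that by (auto simp: limit_group_simps(2))
    have xc: "x c \<in> carrier (A c)" "\<psi> c (x c) = y c" if "c \<in> Obj" for c
      using bij [OF that] yc [OF that] that
      by (auto simp: x_def bij_betw_def intro!: inv_into_into f_inv_into_f)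
    have "A_map c c' a (x c) = x c'" if c: "c \<in> Obj" "c' \<in> Obj" "a \<in> Hom c c'" for c c' a
    proof -
      have "\<psi> c' (A_map c c' a (x c)) = \<psi> c' (x c')"
        using nat [OF c xc(1) [OF c(1)]] xc c y by (simp add: limit_group_simps(2))
      then show ?thesis
        using bij [OF c(2)] A_map [OF c xc(1) [OF c(1)]] xc(1) [OF c(2)] by (meson bij_betw_def inj_onD)
    qed
    then have "x \<in> carrier ?A" using xc by (auto simp: limit_group_simps(2) x_def)
    moreover have "h x = y"
      using xc y by (intro extensionalityI [of _ Obj]) (auto simp: h_def limit_group_simps(2) PiE_def)
    ultimately show "y \<in> h ` carrier ?A" by blast
  qed
  moreover have "h ` carrier ?A \<subseteq> carrier ?B" using hom_in_carrier [OF hom_h] by blast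
  ultimately have "h \<in> iso ?A ?B"
    using hom_h inj by (simp add: iso_def bij_betw_def)
  then show ?thesis unfolding is_iso_def by blast
qed

abbreviation trivial_integers :: "('g, int) gmodule" where
  "trivial_integers \<equiv> trivial_module integer_group"

lemma trivial_integers_simps [simp]:
  "carrier trivial_integers = UNIV" "x \<otimes>\<^bsub>trivial_integers\<^esub> y = x + y" "gact trivial_integers g x = x"
  by (simp_all add: trivial_module_def)

lemma gmod_trivial_integers: "gmod G trivial_integers"
  by (auto simp: gmod_def hom_def) (simp add: trivial_module_def abelian_integer_group)

text \<open>This is the isomorphism of the integers tensored with \<open>B\<close> onto
  \<open>B\<close>, on coinvariants. Groups are written multiplicatively, so the multiple by
  \<open>k\<close> is a power. The formula on pure tensors is exported because naturality is checked
  with it.\<close>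

lemma coinvariants_integers_iso:
  assumes B: "gmod G B"
  obtains \<psi> where "\<psi> \<in> iso (coinvariants G (tensor trivial_integers B)) (coinvariants G B)"
    "\<And>k b. b \<in> carrier B \<Longrightarrow> \<psi> (coinv_tensor G trivial_integers B k b) = coinv_class G B b [^]\<^bsub>coinvariants G B\<^esub> k"
proof -
  let ?T = "coinvariants G (tensor trivial_integers B)" and ?U = "coinvariants G B"
  note Z = gmod_trivial_integers [of G]
  interpret B: comm_group B by (rule gmod_comm_group [OF B])
  interpret U: comm_group ?U by (rule comm_group_coinvariants [OF B])
  interpret T: comm_group ?T by (rule comm_group_T [OF Z B])
  note cvh = coinv_class_hom [OF B]
  note cvc = hom_in_carrier [OF cvh]
  obtain \<psi> where \<psi>: "\<psi> \<in> hom ?T ?U"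
    "\<And>k b. k \<in> carrier trivial_integers \<Longrightarrow> b \<in> carrier B \<Longrightarrow> \<psi> (coinv_tensor G trivial_integers B k b) = coinv_class G B b [^]\<^bsub>?U\<^esub> k"
    by (rule T_universal [OF Z B U.comm_group_axioms, of "\<lambda>k b. coinv_class G B b [^]\<^bsub>?U\<^esub> k"])
      (simp_all add: cvc U.int_pow_mult hom_mult [OF cvh] U.int_pow_distrib coinv_class_act [OF B])
  have act: "coinv_tensor G trivial_integers B 1 (gact B g b) = coinv_tensor G trivial_integers B 1 b" if "g \<in> carrier G" "b \<in> carrier B" for g b
    using coinv_tensor_act [OF Z B that(1) _ that(2), of 1] by simp
  have hom1: "coinv_tensor G trivial_integers B 1 \<in> hom B ?T"
    using coinv_tensor_hom_right [OF Z B, of 1] by simp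
  obtain \<theta> where \<theta>: "\<theta> \<in> hom ?U ?T" "\<And>b. b \<in> carrier B \<Longrightarrow> \<theta> (coinv_class G B b) = coinv_tensor G trivial_integers B 1 b"
    by (rule coinvariants_universal [OF B T.is_group hom1 act]) (assumption | rule that)+
  interpret \<theta>: group_hom ?U ?T \<theta> by (intro group_homI \<theta> U.is_group T.is_group)
  \<comment> \<open>Additivity in the first variable makes \<open>k \<otimes> b\<close> the
    \<open>k\<close>-fold multiple of \<open>1 \<otimes> b\<close>, also for negative
    \<open>k\<close>.\<close>
  have coinv_tensor_pow: "coinv_tensor G trivial_integers B k b = coinv_tensor G trivial_integers B 1 b [^]\<^bsub>?T\<^esub> k" if b: "b \<in> carrier B" for k b
  proof -
    have "(\<lambda>k. coinv_tensor G trivial_integers B k b) \<in> hom integer_group ?T"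
      using coinv_tensor_closed [OF Z B _ b] coinv_tensor_add_left [OF Z B _ _ b] by (intro homI) simp_all
    then interpret k: group_hom integer_group ?T "\<lambda>k. coinv_tensor G trivial_integers B k b"
      by (intro group_homI T.is_group group_integer_group)
    show ?thesis using k.hom_int_pow [of 1 k] by simp
  qed
  have id: "\<theta> (\<psi> x) = x" if "x \<in> carrier ?T" for x
  proof -
    have idT: "(\<lambda>x. x) \<in> hom ?T ?T" by (simp add: hom_def)
    have "(\<theta> \<circ> \<psi>) x = (\<lambda>x. x) x"
      by (rule T_hom_eqI [OF Z B T.is_group hom_compose [OF \<psi>(1) \<theta>(1)] idT _ that])
        (simp add: \<psi>(2) \<theta>.hom_int_pow cvc \<theta>(2) coinv_tensor_pow [symmetric])
    then show ?thesis by simp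
  qed
  have id': "\<psi> (\<theta> x) = x" if x: "x \<in> carrier ?U" for x
  proof -
    obtain b where "b \<in> carrier B" "x = coinv_class G B b" using x by (auto simp: carrier_coinvariants [OF B])
    then show ?thesis by (simp add: \<theta>(2) \<psi>(2) cvc)
  qed
  have "bij_betw \<psi> (carrier ?T) (carrier ?U)"
    by (rule bij_betw_byWitness [where f'=\<theta>])
      (use id id' hom_in_carrier [OF \<psi>(1)] hom_in_carrier [OF \<theta>(1)] in auto)
  then have "\<psi> \<in> iso ?T ?U" using \<psi>(1) by (simp add: iso_def)
  then show thesis using \<psi>(2) by (intro that [of \<psi>]) simp_all
qed

theorem limit_integers_iso:
  fixes G :: "('g, 'b) monoid_scheme"
  assumes G: "group G"
  shows "limit_group (presentations G :: ('u, 'g) presentation set) presentation_homs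
      (\<lambda>P. coinvariants G (tensor trivial_integers (tensor_power (Suc m) (relation_module G P))))
      (\<lambda>P P' \<phi>. limit_map m G trivial_integers P' \<phi>) \<cong>
    limit_group (presentations G :: ('u, 'g) presentation set) presentation_homs
        (\<lambda>P. coinvariants G (tensor_power (Suc m) (relation_module G P)))
        (\<lambda>P P' \<phi>. coinv_map G (tensor_power (Suc m) (relation_module G P'))
          (power_map (Suc m) (relation_module G P') (relation_map G P' \<phi>)))"
proof -
  let ?Obj = "presentations G :: ('u, 'g) presentation set"
  let ?B = "\<lambda>P :: ('u, 'g) presentation. tensor_power (Suc m) (relation_module G P)"
  have gm: "gmod G (?B P)" if "P \<in> ?Obj" for P
  proof -
    obtain F \<pi> where P: "P = (F, \<pi>)" by (cases P)
    interpret group_extension G F \<pi> using that P presentation_extension [OF G] by simp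
    show ?thesis unfolding P by (rule gmod_tensor_power [OF gmod_relation_module])
  qed
  \<comment> \<open>The choice fixes the values on pure tensors, and these make the family natural
    in the presentation.\<close>
  define \<psi> where "\<psi> P = (SOME \<psi>. \<psi> \<in> iso (coinvariants G (tensor trivial_integers (?B P))) (coinvariants G (?B P)) \<and>
    (\<forall>k. \<forall>b\<in>carrier (?B P). \<psi> (coinv_tensor G trivial_integers (?B P) k b) = coinv_class G (?B P) b [^]\<^bsub>coinvariants G (?B P)\<^esub> k))" for P
  have \<psi>: "\<psi> P \<in> iso (coinvariants G (tensor trivial_integers (?B P))) (coinvariants G (?B P))"
    "\<And>k b. b \<in> carrier (?B P) \<Longrightarrow> \<psi> P (coinv_tensor G trivial_integers (?B P) k b) = coinv_class G (?B P) b [^]\<^bsub>coinvariants G (?B P)\<^esub> k"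
    if P: "P \<in> ?Obj" for P
  proof -
    have "\<exists>\<psi>. \<psi> \<in> iso (coinvariants G (tensor trivial_integers (?B P))) (coinvariants G (?B P)) \<and>
      (\<forall>k. \<forall>b\<in>carrier (?B P). \<psi> (coinv_tensor G trivial_integers (?B P) k b) = coinv_class G (?B P) b [^]\<^bsub>coinvariants G (?B P)\<^esub> k)"
      by (rule coinvariants_integers_iso [OF gm [OF P]]) blast
    from someI_ex [OF this, folded \<psi>_def]
    show "\<psi> P \<in> iso (coinvariants G (tensor trivial_integers (?B P))) (coinvariants G (?B P))"
      "\<And>k b. b \<in> carrier (?B P) \<Longrightarrow> \<psi> P (coinv_tensor G trivial_integers (?B P) k b) = coinv_class G (?B P) b [^]\<^bsub>coinvariants G (?B P)\<^esub> k"
      by blast+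
  qed
  note Z = gmod_trivial_integers [of G]
  show ?thesis
  proof (rule limit_group_natural_iso [of _ \<psi>])
    show "\<psi> P \<in> iso (coinvariants G (tensor trivial_integers (?B P))) (coinvariants G (?B P))" if "P \<in> ?Obj" for P
      by (rule \<psi>(1) [OF that])
    fix P P' :: "('u, 'g) presentation" and \<phi> x
    assume P: "P \<in> ?Obj" and P': "P' \<in> ?Obj" and \<phi>: "\<phi> \<in> presentation_homs P P'"
      and x: "x \<in> carrier (coinvariants G (tensor trivial_integers (?B P)))"
    obtain F \<pi> F' \<pi>' where PP: "P = (F, \<pi>)" "P' = (F', \<pi>')" by (cases P, cases P')
    have "extension_morphism G F \<pi> F' \<pi>' \<phi>"
      using presentation_homs_morphism [OF G] P P' \<phi> unfolding PP by blast
    then interpret mor: extension_morphism G F \<pi> F' \<pi>' \<phi> .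
    note lm = mor.limit_map_hom [OF Z, where m=m, folded PP]
    let ?p = "power_map (Suc m) (relation_module G P') (relation_map G P' \<phi>)"
    have peq: "equivariant G (?B P) (?B P') ?p"
      unfolding PP by (rule power_map_equivariant [OF mor.P.gmod_relation_module mor.P'.gmod_relation_module
            mor.relation_map_equivariant])
    note cm = coinv_map_hom [OF gm [OF P] gm [OF P'] peq]
    show "limit_map m G trivial_integers P' \<phi> x \<in> carrier (coinvariants G (tensor trivial_integers (?B P')))"
      by (rule hom_in_carrier [OF lm(1) x])
    interpret U: comm_group "coinvariants G (?B P)" by (rule comm_group_coinvariants [OF gm [OF P]])
    interpret U': comm_group "coinvariants G (?B P')" by (rule comm_group_coinvariants [OF gm [OF P']])
    interpret cm: group_hom "coinvariants G (?B P)" "coinvariants G (?B P')" "coinv_map G (?B P') ?p"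
      by (intro group_homI U.is_group U'.is_group cm)
    have \<psi>h: "\<psi> P \<in> hom (coinvariants G (tensor trivial_integers (?B P))) (coinvariants G (?B P))"
      "\<psi> P' \<in> hom (coinvariants G (tensor trivial_integers (?B P'))) (coinvariants G (?B P'))"
      using \<psi>(1) P P' by (auto simp: iso_def)
    have "(\<psi> P' \<circ> limit_map m G trivial_integers P' \<phi>) x = (coinv_map G (?B P') ?p \<circ> \<psi> P) x"
    proof (rule T_hom_eqI [OF Z gm [OF P] U'.is_group hom_compose [OF lm(1) \<psi>h(2)] hom_compose [OF \<psi>h(1) cm(1)] _ x])
      fix k b assume k: "k \<in> carrier (trivial_integers :: ('g, int) gmodule)" and b: "b \<in> carrier (?B P)"
      have pb: "?p b \<in> carrier (?B P')" by (rule hom_in_carrier [OF equivariant_hom [OF peq] b])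
      have b': "b \<in> carrier (power_group (Suc m) (relation_module G P))" using b by simp
      show "(\<psi> P' \<circ> limit_map m G trivial_integers P' \<phi>) (coinv_tensor G trivial_integers (?B P) k b) =
          (coinv_map G (?B P') ?p \<circ> \<psi> P) (coinv_tensor G trivial_integers (?B P) k b)"
        using hom_in_carrier [OF coinv_class_hom [OF gm [OF P]] b]
        by (simp only: o_apply lm(2) [OF k b'] \<psi>(2) [OF P' pb] \<psi>(2) [OF P b] cm.hom_int_pow cm(2) [OF b])
    qed
    then show "\<psi> P' (limit_map m G trivial_integers P' \<phi> x) = coinv_map G (?B P') ?p (\<psi> P x)" by simp
  qed
qed

theorem theorem3p2:
  fixes G :: "('g, 'b) monoid_scheme"
    and M :: "('g, 'm) gmodule"
    and n :: nat
  assumes "group G"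
    and "G_module G M"
    and "n \<ge> 1"
    and universe_infinite: "infinite (UNIV :: 'u set)"
    and universe_contains_G: "\<exists>\<iota> :: 'g \<Rightarrow> 'u. inj_on \<iota> (carrier G)"
  shows "group_homology G M (2 * n) \<cong>
      limit_group (presentations G :: ('u, 'g) presentation set) presentation_homs
        (\<lambda>P. coinvariants G (tensor M (tensor_power n (relation_module G P))))
        (\<lambda>P P' \<phi>. coinv_map G (tensor M (tensor_power n (relation_module G P')))
          (tensor_map M (tensor_power n (relation_module G P')) (\<lambda>x. x)
            (power_map n (relation_module G P') (relation_map G P' \<phi>))))
    \<and> group_homology G (trivial_module integer_group) (2 * n) \<cong>
      limit_group (presentations G :: ('u, 'g) presentation set) presentation_homs
        (\<lambda>P. coinvariants G (tensor_power n (relation_module G P)))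
        (\<lambda>P P' \<phi>. coinv_map G (tensor_power n (relation_module G P'))
          (power_map n (relation_module G P') (relation_map G P' \<phi>)))"
proof -
  obtain m where n: "n = Suc m" using \<open>n \<ge> 1\<close> by (cases n) auto
  obtain \<iota> :: "'g \<Rightarrow> 'u" where \<iota>: "inj_on \<iota> (carrier G)" using universe_contains_G by blast
  note main = homology_limit_iso [OF \<open>group G\<close> _ universe_infinite \<iota>, of _ m]
  have "group_homology G (trivial_module integer_group) (2 * n) \<cong>
      limit_group (presentations G :: ('u, 'g) presentation set) presentation_homs
        (\<lambda>P. coinvariants G (tensor_power n (relation_module G P)))
        (\<lambda>P P' \<phi>. coinv_map G (tensor_power n (relation_module G P'))
          (power_map n (relation_module G P') (relation_map G P' \<phi>)))"
    using iso_trans [OF main [OF gmod_trivial_integers] limit_integers_iso [OF \<open>group G\<close>]] by (simp add: n)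
  moreover have "group_homology G M (2 * n) \<cong>
      limit_group (presentations G :: ('u, 'g) presentation set) presentation_homs
        (\<lambda>P. coinvariants G (tensor M (tensor_power n (relation_module G P))))
        (\<lambda>P P' \<phi>. coinv_map G (tensor M (tensor_power n (relation_module G P')))
          (tensor_map M (tensor_power n (relation_module G P')) (\<lambda>x. x)
            (power_map n (relation_module G P') (relation_map G P' \<phi>))))"
    using main [OF G_module_imp_gmod [OF \<open>G_module G M\<close>]] by (simp add: n limit_map_def Tmap_def)
  ultimately show ?thesis by blast
qed

end
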